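(* Let $(-)^*$ be a monoidal associative contravariant pseudo functor from a category $\mathcal B$ to (suspended, triangulated) symmetric monoidal closed categories, and let $\mathcal B'\subset\mathcal B$ be the subcategory with the same objects whose morphisms are those $h$ such that $h^*$ has a right adjoint $h_*$ and $h_*$ has a right adjoint $h^!$. Let $$\bar f:V\to X,\quad \bar g:V\to Y,\quad f:Y\to Z,\quad g:X\to Z$$ be morphisms of $\mathcal B$ with $f\bar g=g\bar f$ and with $g,\bar g$ in $\mathcal B'$. Assume that the natural morphism $\varepsilon:f^*g_*\to\bar g_*\bar f^*$ is an isomorphism, and let $K$ be an object of $\mathcal C_Z$. Then the isomorphism of functors $\varepsilon:f^*g_*\to\bar g_*\bar f^*$ is a morphism of duality preserving functors from $$\{f^*,\beta_K\}\{g_*,\zeta_K\}\quad\text{to}\quad\{\bar g_*,\zeta_{f^*K}\}\,I_{\gamma_K}\,\{\bar f^*,\beta_{g^!K}\}$$ (both from $(\mathcal C_X,D_{g^!K},\varpi_{g^!K})$ to $(\mathcal C_Y,D_{f^*K},\varpi_{f^*K})$).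
   Context: Closed categories. A symmetric monoidal closed category $(\mathcal C,\otimes)$ (with symmetry $s$) has an internal Hom $[-,-]$ with adjunctions $(-\otimes X)\dashv[X,-]$ natural in $X$, with counit $\mathrm{ev}^l_{X,A}:[X,A]\otimes X\to A$ and unit $\mathrm{coev}^l_{X,A}:A\to[X,A\otimes X]$. Put $\mathrm{ev}^r_{A,K}=\mathrm{ev}^l_{A,K}\circ s$. Dualities. For an object $K$, $D_K=[-,K]:\mathcal C\to\mathcal C^o$, with opposite functor $D_K^o$, and $\varpi_K:\mathrm{Id}\to D_K^oD_K$ has component $\varpi_{K,A}:A\to[[A,K],K]$ corresponding to $\mathrm{ev}^r_{A,K}:A\otimes[A,K]\to K$ under $(-\otimes[A,K])\dashv[[A,K],-]$. A duality preserving functor $\{F,\phi\}:(\mathcal C_1,D_1,\varpi_1)\to(\mathcal C_2,D_2,\varpi_2)$ is a functor $F$ and a natural transformation $\phi:FD_1^o\to D_2^oF^o$ (components $\phi_A:FD_1A\to D_2FA$) with $\phi_{D_1A}\circ F(\varpi_{1,A})=D_2(\phi_A)\circ\varpi_{2,FA}$ for all $A$. Composition: $\{F',\phi'\}\{F,\phi\}=\{F'F,\phi'F^o\circ F'\phi\}$. A morphism $\{F,\phi\}\to\{F',\phi'\}$ is a natural transformation $\rho:F\to F'$ with $\phi_A=D_2(\rho_A)\circ\phi'_A\circ\rho_{D_1A}$ for all $A$ (in the suspended/triangulated setting, $\rho$ is moreover required to be a morphism of suspended functors). A morphism $\iota:K\to M$ induces the duality preserving functor $I_\iota=\{\mathrm{Id},\tilde\iota\}:(\mathcal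 C,D_K,\varpi_K)\to(\mathcal C,D_M,\varpi_M)$, where $\tilde\iota:[-,K]\to[-,M]$ is composition with $\iota$. Pseudo functors. A contravariant pseudo functor $(-)^*$ on $\mathcal B$ assigns to each object $X$ a (suspended, triangulated) symmetric monoidal closed category $\mathcal C_X$, to each $f:X\to Y$ a (suspended, exact) functor $f^*:\mathcal C_Y\to\mathcal C_X$, with identities sent to identities, together with isomorphisms of (suspended) functors $a_{g,f}:f^*g^*\to(gf)^*$. It is associative if the two isomorphisms $f^*g^*h^*\to(hgf)^*$ built from $a$ agree. It is monoidal if each $f^*$ is symmetric monoidal, i.e. equipped with a natural isomorphism $\alpha^f_{A,B}:f^*A\otimes f^*B\to f^*(A\otimes B)$ compatible with associativity and symmetry (and units, when considered), and $a_{g,f,A\otimes B}\circ f^*(\alpha^{g}_{A,B})\circ\alpha^{f}_{g^*A,g^*B}=\alpha^{gf}_{A,B}\circ(a_{g,f,A}\otimes a_{g,f,B})$. Pull-back. $\beta_{A,K}$: $f^*[A,K]\xrightarrow{\mathrm{coev}^l}[f^*A,f^*[A,K]\otimes f^*A]\xrightarrow{\alpha}[f^*A,f^*([A,K]\otimes A)]\xrightarrow{\mathrm{ev}^l}[f^*A,f^*K]$; $\{f^*,\beta_K\}$ is a duality preserving functor from $D_K$ to $D_{f^*K}$. Push-forward. For $h$ in $\mathcal B'$ let $\eta^*_*,\epsilon^*_*$ be unit and counit of $h^*\dashv h_*$ and $\eta^!_*,\epsilon^!_*$ those of $h_*\dashv h^!$. Let $\lambda_{A,B}$: $h_*A\otimes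 h_*B\xrightarrow{\eta^*_*}h_*h^*(h_*A\otimes h_*B)\xrightarrow{\alpha^{-1}}h_*(h^*h_*A\otimes h^*h_*B)\xrightarrow{\epsilon^*_*\otimes\epsilon^*_*}h_*(A\otimes B)$, $\mu_{A,B}$: $h_*[A,B]\xrightarrow{\mathrm{coev}^l}[h_*A,h_*[A,B]\otimes h_*A]\xrightarrow{\lambda}[h_*A,h_*([A,B]\otimes A)]\xrightarrow{\mathrm{ev}^l}[h_*A,h_*B]$, and $\zeta_{A,K}$: $h_*[A,h^!K]\xrightarrow{\mu}[h_*A,h_*h^!K]\xrightarrow{\epsilon^!_*}[h_*A,K]$. Then $\{h_*,\zeta_K\}$ is a duality preserving functor from $D_{h^!K}$ to $D_K$. Base change morphisms. $\xi:\bar g^*f^*\to\bar f^*g^*$ is the isomorphism $\bar g^*f^*\xrightarrow{a}(f\bar g)^*=(g\bar f)^*\xrightarrow{a^{-1}}\bar f^*g^*$. $\varepsilon$ is the composition $f^*g_*\xrightarrow{\eta^*_*}\bar g_*\bar g^*f^*g_*\xrightarrow{\xi}\bar g_*\bar f^*g^*g_*\xrightarrow{\epsilon^*_*}\bar g_*\bar f^*$. When $\varepsilon$ is an isomorphism, $\gamma$ is the composition $\bar f^*g^!\xrightarrow{\eta^!_*}\bar g^!\bar g_*\bar f^*g^!\xrightarrow{\varepsilon^{-1}}\bar g^!f^*g_*g^!\xrightarrow{\epsilon^!_*}\bar g^!f^*$. Suspended version: a suspended category is an additive category with a functor $T$ having a strict inverse; suspended functors carry isomorphisms $FT\simeq TF$,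 and morphisms of suspended functors commute with them. In a suspended symmetric monoidal closed category $\otimes$ carries natural isomorphisms $TA\otimes B\to T(A\otimes B)$, $A\otimes TB\to T(A\otimes B)$ such that the two composites $TA\otimes TB\to T^2(A\otimes B)$ differ by the sign $-1$, compatible with associativity and symmetry; $f^*$ is suspended and $\alpha$ commutes with these isomorphisms; $h_*$, $h^!$ carry the unique suspended structures for which units and counits of the adjunctions are morphisms of suspended functors. In the triangulated version $f^*$, $\otimes$ (in both variables) and $[-,-]$ (in the first variable) are moreover exact. *)

theory Defs
  imports "HOL-Algebra.Group"
begin

section \<open>Categories, functors, adjunctions\<close>

record ('o, 'm) cat =
  Ob :: "'o set"
  Ar :: "'m set"
  Dom :: "'m \<Rightarrow> 'o"
  Cod :: "'m \<Rightarrow> 'o"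
  Ide :: "'o \<Rightarrow> 'm"
  Cmp :: "'m \<Rightarrow> 'm \<Rightarrow> 'm" (infixr "\<cdot>\<index>" 70)

definition Hom :: "('o, 'm, 'z) cat_scheme \<Rightarrow> 'o \<Rightarrow> 'o \<Rightarrow> 'm set" where
  "Hom C A B = {f \<in> Ar C. Dom C f = A \<and> Cod C f = B}"

locale category =
  fixes C :: "('o, 'm, 'z) cat_scheme" (structure)
  assumes dom_cod_Ob: "f \<in> Ar C \<Longrightarrow> Dom C f \<in> Ob C \<and> Cod C f \<in> Ob C"
    and Ide_Hom: "A \<in> Ob C \<Longrightarrow> Ide C A \<in> Hom C A A"
    and Cmp_Hom: "f \<in> Hom C A B \<Longrightarrow> g \<in> Hom C B D \<Longrightarrow> g \<cdot> f \<in> Hom C A D"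
    and Cmp_Ide_left: "f \<in> Hom C A B \<Longrightarrow> Ide C B \<cdot> f = f"
    and Cmp_Ide_right: "f \<in> Hom C A B \<Longrightarrow> f \<cdot> Ide C A = f"
    and Cmp_assoc: "f \<in> Hom C A B \<Longrightarrow> g \<in> Hom C B D \<Longrightarrow> h \<in> Hom C D E \<Longrightarrow>
        (h \<cdot> g) \<cdot> f = h \<cdot> (g \<cdot> f)"

definition opp :: "('o, 'm, 'z) cat_scheme \<Rightarrow> ('o, 'm) cat" where
  "opp C = \<lparr>Ob = Ob C, Ar = Ar C, Dom = Cod C, Cod = Dom C, Ide = Ide C,
            Cmp = (\<lambda>g f. f \<cdot>\<^bsub>C\<^esub> g)\<rparr>"

definition prod_cat ::
  "('o, 'm, 'z) cat_scheme \<Rightarrow> ('p, 'n, 'y) cat_scheme \<Rightarrow> ('o \<times> 'p, 'm \<times> 'n) cat" where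
  "prod_cat C D = \<lparr>Ob = Ob C \<times> Ob D, Ar = Ar C \<times> Ar D,
     Dom = map_prod (Dom C) (Dom D), Cod = map_prod (Cod C) (Cod D),
     Ide = map_prod (Ide C) (Ide D),
     Cmp = (\<lambda>(g, g') (f, f'). (g \<cdot>\<^bsub>C\<^esub> f, g' \<cdot>\<^bsub>D\<^esub> f'))\<rparr>"

definition inverse_arrows :: "('o, 'm, 'z) cat_scheme \<Rightarrow> 'm \<Rightarrow> 'm \<Rightarrow> bool" where
  "inverse_arrows C f g \<longleftrightarrow> f \<in> Ar C \<and> g \<in> Hom C (Cod C f) (Dom C f) \<and>
     g \<cdot>\<^bsub>C\<^esub> f = Ide C (Dom C f) \<and> f \<cdot>\<^bsub>C\<^esub> g = Ide C (Cod C f)"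

definition Iso :: "('o, 'm, 'z) cat_scheme \<Rightarrow> 'm \<Rightarrow> bool" where
  "Iso C f \<longleftrightarrow> (\<exists>g. inverse_arrows C f g)"

definition Invr :: "('o, 'm, 'z) cat_scheme \<Rightarrow> 'm \<Rightarrow> 'm" where
  "Invr C f = (THE g. inverse_arrows C f g)"

record ('o, 'm, 'p, 'n) fctr =
  Fob :: "'o \<Rightarrow> 'p"
  Far :: "'m \<Rightarrow> 'n"

definition is_functor ::
  "('o, 'm, 'z) cat_scheme \<Rightarrow> ('p, 'n, 'y) cat_scheme \<Rightarrow> ('o, 'm, 'p, 'n, 'x) fctr_scheme \<Rightarrow> bool"
where
  "is_functor C D F \<longleftrightarrow> category C \<and> category D \<and>
     (\<forall>A \<in> Ob C. Fob F A \<in> Ob D) \<and>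
     (\<forall>A B. \<forall>f \<in> Hom C A B. Far F f \<in> Hom D (Fob F A) (Fob F B)) \<and>
     (\<forall>A \<in> Ob C. Far F (Ide C A) = Ide D (Fob F A)) \<and>
     (\<forall>A B E. \<forall>f \<in> Hom C A B. \<forall>g \<in> Hom C B E.
        Far F (g \<cdot>\<^bsub>C\<^esub> f) = Far F g \<cdot>\<^bsub>D\<^esub> Far F f)"

definition id_fctr :: "('o, 'm, 'o, 'm) fctr" where
  "id_fctr = \<lparr>Fob = (\<lambda>A. A), Far = (\<lambda>f. f)\<rparr>"

definition comp_fctr ::
  "('p, 'n, 'q, 'l, 'y) fctr_scheme \<Rightarrow> ('o, 'm, 'p, 'n, 'x) fctr_scheme \<Rightarrow> ('o, 'm, 'q, 'l) fctr"
  (infixr "\<circ>\<^sub>F" 75) where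
  "G \<circ>\<^sub>F F = \<lparr>Fob = (\<lambda>A. Fob G (Fob F A)), Far = (\<lambda>f. Far G (Far F f))\<rparr>"

definition nat_trans ::
  "('o, 'm, 'z) cat_scheme \<Rightarrow> ('p, 'n, 'y) cat_scheme \<Rightarrow> ('o, 'm, 'p, 'n, 'x) fctr_scheme \<Rightarrow>
   ('o, 'm, 'p, 'n, 'w) fctr_scheme \<Rightarrow> ('o \<Rightarrow> 'n) \<Rightarrow> bool"
where
  "nat_trans C D F G \<rho> \<longleftrightarrow> is_functor C D F \<and> is_functor C D G \<and>
     (\<forall>A \<in> Ob C. \<rho> A \<in> Hom D (Fob F A) (Fob G A)) \<and>
     (\<forall>A B. \<forall>f \<in> Hom C A B. \<rho> B \<cdot>\<^bsub>D\<^esub> Far F f = Far G f \<cdot>\<^bsub>D\<^esub> \<rho> A)"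

definition nat_iso ::
  "('o, 'm, 'z) cat_scheme \<Rightarrow> ('p, 'n, 'y) cat_scheme \<Rightarrow> ('o, 'm, 'p, 'n, 'x) fctr_scheme \<Rightarrow>
   ('o, 'm, 'p, 'n, 'w) fctr_scheme \<Rightarrow> ('o \<Rightarrow> 'n) \<Rightarrow> bool"
where
  "nat_iso C D F G \<rho> \<longleftrightarrow> nat_trans C D F G \<rho> \<and> (\<forall>A \<in> Ob C. Iso D (\<rho> A))"

text \<open>\<open>F : C \<rightarrow> D\<close> is left adjoint to \<open>G : D \<rightarrow> C\<close> with unit \<open>\<eta>\<close> and counit \<open>e\<close>.\<close>

definition adjunction ::
  "('o, 'm, 'z) cat_scheme \<Rightarrow> ('p, 'n, 'y) cat_scheme \<Rightarrow> ('o, 'm, 'p, 'n, 'x) fctr_scheme \<Rightarrow>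
   ('p, 'n, 'o, 'm, 'w) fctr_scheme \<Rightarrow> ('o \<Rightarrow> 'm) \<Rightarrow> ('p \<Rightarrow> 'n) \<Rightarrow> bool"
where
  "adjunction C D F G \<eta> e \<longleftrightarrow>
     is_functor C D F \<and> is_functor D C G \<and>
     nat_trans C C id_fctr (G \<circ>\<^sub>F F) \<eta> \<and> nat_trans D D (F \<circ>\<^sub>F G) id_fctr e \<and>
     (\<forall>A \<in> Ob C. e (Fob F A) \<cdot>\<^bsub>D\<^esub> Far F (\<eta> A) = Ide D (Fob F A)) \<and>
     (\<forall>B \<in> Ob D. Far G (e B) \<cdot>\<^bsub>C\<^esub> \<eta> (Fob G B) = Ide C (Fob G B))"


section \<open>Symmetric monoidal closed categories\<close>

text \<open>\<open>Ev C X A : [X, A] \<otimes> X \<rightarrow> A\<close> and \<open>Coev C X A : A \<rightarrow> [X, A \<otimes> X]\<close>.\<close>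

record ('o, 'm) smc = "('o, 'm) cat" +
  Ten :: "'o \<Rightarrow> 'o \<Rightarrow> 'o" (infixr "\<odot>\<index>" 80)
  TenA :: "'m \<Rightarrow> 'm \<Rightarrow> 'm" (infixr "\<bullet>\<index>" 80)
  Asc :: "'o \<Rightarrow> 'o \<Rightarrow> 'o \<Rightarrow> 'm"
  Sym :: "'o \<Rightarrow> 'o \<Rightarrow> 'm"
  Uni :: "'o"
  Lun :: "'o \<Rightarrow> 'm"
  Run :: "'o \<Rightarrow> 'm"
  IHom :: "'o \<Rightarrow> 'o \<Rightarrow> 'o"
  IHomA :: "'m \<Rightarrow> 'm \<Rightarrow> 'm"
  Ev :: "'o \<Rightarrow> 'o \<Rightarrow> 'm"
  Coev :: "'o \<Rightarrow> 'o \<Rightarrow> 'm"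

locale sym_tensor = category C for C :: "('o, 'm, 'z) smc_scheme" (structure) +
  assumes tensor_functor:
      "is_functor (prod_cat C C) C \<lparr>Fob = (\<lambda>(A, B). A \<odot> B), Far = (\<lambda>(f, g). f \<bullet> g)\<rparr>"
    and Asc_nat_iso: "nat_iso (prod_cat C (prod_cat C C)) C
        \<lparr>Fob = (\<lambda>(A, B, D). (A \<odot> B) \<odot> D), Far = (\<lambda>(f, g, h). (f \<bullet> g) \<bullet> h)\<rparr>
        \<lparr>Fob = (\<lambda>(A, B, D). A \<odot> (B \<odot> D)), Far = (\<lambda>(f, g, h). f \<bullet> (g \<bullet> h))\<rparr>
        (\<lambda>(A, B, D). Asc C A B D)"
    and Sym_nat_iso: "nat_iso (prod_cat C C) C
        \<lparr>Fob = (\<lambda>(A, B). A \<odot> B), Far = (\<lambda>(f, g). f \<bullet> g)\<rparr>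
        \<lparr>Fob = (\<lambda>(A, B). B \<odot> A), Far = (\<lambda>(f, g). g \<bullet> f)\<rparr>
        (\<lambda>(A, B). Sym C A B)"
    and pentagon: "\<lbrakk>A \<in> Ob C; B \<in> Ob C; D \<in> Ob C; E \<in> Ob C\<rbrakk> \<Longrightarrow>
        (Ide C A \<bullet> Asc C B D E) \<cdot> Asc C A (B \<odot> D) E \<cdot> (Asc C A B D \<bullet> Ide C E)
        = Asc C A B (D \<odot> E) \<cdot> Asc C (A \<odot> B) D E"
    and hexagon: "\<lbrakk>A \<in> Ob C; B \<in> Ob C; D \<in> Ob C\<rbrakk> \<Longrightarrow>
        Asc C B D A \<cdot> Sym C A (B \<odot> D) \<cdot> Asc C A B D
        = (Ide C B \<bullet> Sym C A D) \<cdot> Asc C B A D \<cdot> (Sym C A B \<bullet> Ide C D)"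
    and Sym_involutive: "\<lbrakk>A \<in> Ob C; B \<in> Ob C\<rbrakk> \<Longrightarrow> Sym C B A \<cdot> Sym C A B = Ide C (A \<odot> B)"

locale sym_tensor_unit = sym_tensor C for C :: "('o, 'm, 'z) smc_scheme" (structure) +
  assumes Uni_Ob: "Uni C \<in> Ob C"
    and Lun_nat_iso: "nat_iso C C
        \<lparr>Fob = (\<lambda>A. Uni C \<odot> A), Far = (\<lambda>f. Ide C (Uni C) \<bullet> f)\<rparr> id_fctr (Lun C)"
    and Run_nat_iso: "nat_iso C C
        \<lparr>Fob = (\<lambda>A. A \<odot> Uni C), Far = (\<lambda>f. f \<bullet> Ide C (Uni C))\<rparr> id_fctr (Run C)"
    and unit_triangle: "\<lbrakk>A \<in> Ob C; B \<in> Ob C\<rbrakk> \<Longrightarrow>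
        (Ide C A \<bullet> Lun C B) \<cdot> Asc C A (Uni C) B = Run C A \<bullet> Ide C B"
    and Lun_Sym: "A \<in> Ob C \<Longrightarrow> Lun C A \<cdot> Sym C A (Uni C) = Run C A"

locale sym_tensor_closed = sym_tensor C for C :: "('o, 'm, 'z) smc_scheme" (structure) +
  assumes IHom_functor: "is_functor (prod_cat (opp C) C) C
        \<lparr>Fob = (\<lambda>(A, B). IHom C A B), Far = (\<lambda>(f, g). IHomA C f g)\<rparr>"
    and tensor_IHom_adjunction: "X \<in> Ob C \<Longrightarrow> adjunction C C
        \<lparr>Fob = (\<lambda>A. A \<odot> X), Far = (\<lambda>f. f \<bullet> Ide C X)\<rparr>
        \<lparr>Fob = (\<lambda>A. IHom C X A), Far = (\<lambda>f. IHomA C (Ide C X) f)\<rparr>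
        (Coev C X) (Ev C X)"
    and Ev_dinatural: "\<lbrakk>f \<in> Hom C X Y; A \<in> Ob C\<rbrakk> \<Longrightarrow>
        Ev C X A \<cdot> (IHomA C f (Ide C A) \<bullet> Ide C X) = Ev C Y A \<cdot> (Ide C (IHom C Y A) \<bullet> f)"
    and Coev_dinatural: "\<lbrakk>f \<in> Hom C X Y; A \<in> Ob C\<rbrakk> \<Longrightarrow>
        IHomA C (Ide C X) (Ide C A \<bullet> f) \<cdot> Coev C X A
        = IHomA C f (Ide C (A \<odot> Y)) \<cdot> Coev C Y A"


section \<open>Suspended structures\<close>

text \<open>
  \<open>Add\<close> and \<open>Zer\<close> give the group structures on hom sets, \<open>Sus\<close> is the suspension \<open>T\<close>, and
  \<open>Tl C A B : TA \<otimes> B \<rightarrow> T(A \<otimes> B)\<close>, \<open>Tr C A B : A \<otimes> TB \<rightarrow> T(A \<otimes> B)\<close>.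
\<close>

record ('o, 'm) ssmc = "('o, 'm) smc" +
  Add :: "'m \<Rightarrow> 'm \<Rightarrow> 'm"
  Zer :: "'o \<Rightarrow> 'o \<Rightarrow> 'm"
  Sus :: "('o, 'm, 'o, 'm) fctr"
  Tl :: "'o \<Rightarrow> 'o \<Rightarrow> 'm"
  Tr :: "'o \<Rightarrow> 'o \<Rightarrow> 'm"

definition hom_group :: "('o, 'm, 'z) ssmc_scheme \<Rightarrow> 'o \<Rightarrow> 'o \<Rightarrow> 'm monoid" where
  "hom_group C A B = \<lparr>carrier = Hom C A B, mult = Add C, one = Zer C A B\<rparr>"

definition Neg :: "('o, 'm, 'z) ssmc_scheme \<Rightarrow> 'm \<Rightarrow> 'm" where
  "Neg C f = m_inv (hom_group C (Dom C f) (Cod C f)) f"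

locale additive = category C for C :: "('o, 'm, 'z) ssmc_scheme" (structure) +
  assumes hom_comm_group: "\<lbrakk>A \<in> Ob C; B \<in> Ob C\<rbrakk> \<Longrightarrow> comm_group (hom_group C A B)"
    and Cmp_Add_left: "\<lbrakk>f \<in> Hom C A B; g \<in> Hom C B D; g' \<in> Hom C B D\<rbrakk> \<Longrightarrow>
        Add C g g' \<cdot> f = Add C (g \<cdot> f) (g' \<cdot> f)"
    and Cmp_Add_right: "\<lbrakk>f \<in> Hom C A B; f' \<in> Hom C A B; g \<in> Hom C B D\<rbrakk> \<Longrightarrow>
        g \<cdot> Add C f f' = Add C (g \<cdot> f) (g \<cdot> f')"
    and zero_object: "\<exists>Z \<in> Ob C. Ide C Z = Zer C Z Z"
    and biproducts: "\<lbrakk>A \<in> Ob C; B \<in> Ob C\<rbrakk> \<Longrightarrow>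
        \<exists>S \<in> Ob C. \<exists>i \<in> Hom C A S. \<exists>j \<in> Hom C B S. \<exists>p \<in> Hom C S A. \<exists>q \<in> Hom C S B.
          p \<cdot> i = Ide C A \<and> q \<cdot> j = Ide C B \<and> q \<cdot> i = Zer C A B \<and> p \<cdot> j = Zer C B A \<and>
          Add C (i \<cdot> p) (j \<cdot> q) = Ide C S"

locale suspended = additive C for C :: "('o, 'm, 'z) ssmc_scheme" (structure) +
  assumes Sus_functor: "is_functor C C (Sus C)"
    and Sus_strict_inverse: "\<exists>S. is_functor C C (S :: ('o, 'm, 'o, 'm) fctr) \<and>
        (\<forall>A \<in> Ob C. Fob S (Fob (Sus C) A) = A \<and> Fob (Sus C) (Fob S A) = A) \<and>
        (\<forall>f \<in> Ar C. Far S (Far (Sus C) f) = f \<and> Far (Sus C) (Far S f) = f)"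

locale suspended_tensor = suspended C + sym_tensor_closed C
  for C :: "('o, 'm, 'z) ssmc_scheme" (structure) +
  assumes Tl_nat_iso: "nat_iso (prod_cat C C) C
        \<lparr>Fob = (\<lambda>(A, B). Fob (Sus C) A \<odot> B), Far = (\<lambda>(f, g). Far (Sus C) f \<bullet> g)\<rparr>
        \<lparr>Fob = (\<lambda>(A, B). Fob (Sus C) (A \<odot> B)), Far = (\<lambda>(f, g). Far (Sus C) (f \<bullet> g))\<rparr>
        (\<lambda>(A, B). Tl C A B)"
    and Tr_nat_iso: "nat_iso (prod_cat C C) C
        \<lparr>Fob = (\<lambda>(A, B). A \<odot> Fob (Sus C) B), Far = (\<lambda>(f, g). f \<bullet> Far (Sus C) g)\<rparr>
        \<lparr>Fob = (\<lambda>(A, B). Fob (Sus C) (A \<odot> B)), Far = (\<lambda>(f, g). Far (Sus C) (f \<bullet> g))\<rparr>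
        (\<lambda>(A, B). Tr C A B)"
    and Tl_Tr_anticommute: "\<lbrakk>A \<in> Ob C; B \<in> Ob C\<rbrakk> \<Longrightarrow>
        Far (Sus C) (Tr C A B) \<cdot> Tl C A (Fob (Sus C) B)
        = Neg C (Far (Sus C) (Tl C A B) \<cdot> Tr C (Fob (Sus C) A) B)"
    and Tl_Asc: "\<lbrakk>A \<in> Ob C; B \<in> Ob C; D \<in> Ob C\<rbrakk> \<Longrightarrow>
        Far (Sus C) (Asc C A B D) \<cdot> Tl C (A \<odot> B) D \<cdot> (Tl C A B \<bullet> Ide C D)
        = Tl C A (B \<odot> D) \<cdot> Asc C (Fob (Sus C) A) B D"
    and Tr_Tl_Asc: "\<lbrakk>A \<in> Ob C; B \<in> Ob C; D \<in> Ob C\<rbrakk> \<Longrightarrow>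
        Far (Sus C) (Asc C A B D) \<cdot> Tl C (A \<odot> B) D \<cdot> (Tr C A B \<bullet> Ide C D)
        = Tr C A (B \<odot> D) \<cdot> (Ide C A \<bullet> Tl C B D) \<cdot> Asc C A (Fob (Sus C) B) D"
    and Tr_Asc: "\<lbrakk>A \<in> Ob C; B \<in> Ob C; D \<in> Ob C\<rbrakk> \<Longrightarrow>
        Far (Sus C) (Asc C A B D) \<cdot> Tr C (A \<odot> B) D
        = Tr C A (B \<odot> D) \<cdot> (Ide C A \<bullet> Tr C B D) \<cdot> Asc C A B (Fob (Sus C) D)"
    and Tl_Sym: "\<lbrakk>A \<in> Ob C; B \<in> Ob C\<rbrakk> \<Longrightarrow>
        Far (Sus C) (Sym C A B) \<cdot> Tl C A B = Tr C B A \<cdot> Sym C (Fob (Sus C) A) B"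

text \<open>\<open>Theta F A : F(TA) \<rightarrow> T(FA)\<close> is the suspended structure of \<open>F\<close>.\<close>

record ('o, 'm, 'p, 'n) sfctr = "('o, 'm, 'p, 'n) fctr" +
  Theta :: "'o \<Rightarrow> 'n"

definition suspended_functor ::
  "('o, 'm, 'z) ssmc_scheme \<Rightarrow> ('p, 'n, 'y) ssmc_scheme \<Rightarrow> ('o, 'm, 'p, 'n, 'x) sfctr_scheme \<Rightarrow> bool"
where
  "suspended_functor C D F \<longleftrightarrow> is_functor C D F \<and>
     nat_iso C D (F \<circ>\<^sub>F Sus C) (Sus D \<circ>\<^sub>F F) (Theta F)"

definition id_sfctr :: "('o, 'm, 'z) ssmc_scheme \<Rightarrow> ('o, 'm, 'o, 'm) sfctr" where
  "id_sfctr C = \<lparr>Fob = (\<lambda>A. A), Far = (\<lambda>f. f), Theta = (\<lambda>A. Ide C (Fob (Sus C) A))\<rparr>"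

text \<open>In \<open>comp_sfctr D G F\<close>, the category \<open>D\<close> is the target of \<open>G\<close>.\<close>

definition comp_sfctr ::
  "('q, 'l, 'z) cat_scheme \<Rightarrow> ('p, 'n, 'q, 'l, 'y) sfctr_scheme \<Rightarrow>
   ('o, 'm, 'p, 'n, 'x) sfctr_scheme \<Rightarrow> ('o, 'm, 'q, 'l) sfctr"
where
  "comp_sfctr D G F = \<lparr>Fob = (\<lambda>A. Fob G (Fob F A)), Far = (\<lambda>f. Far G (Far F f)),
     Theta = (\<lambda>A. Theta G (Fob F A) \<cdot>\<^bsub>D\<^esub> Far G (Theta F A))\<rparr>"

definition suspended_morphism ::
  "('o, 'm, 'z) ssmc_scheme \<Rightarrow> ('p, 'n, 'y) ssmc_scheme \<Rightarrow> ('o, 'm, 'p, 'n, 'x) sfctr_scheme \<Rightarrow>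
   ('o, 'm, 'p, 'n, 'w) sfctr_scheme \<Rightarrow> ('o \<Rightarrow> 'n) \<Rightarrow> bool"
where
  "suspended_morphism C D F G \<rho> \<longleftrightarrow>
     suspended_functor C D F \<and> suspended_functor C D G \<and> nat_trans C D F G \<rho> \<and>
     (\<forall>A \<in> Ob C. Theta G A \<cdot>\<^bsub>D\<^esub> \<rho> (Fob (Sus C) A) = Far (Sus D) (\<rho> A) \<cdot>\<^bsub>D\<^esub> Theta F A)"


section \<open>Triangulated structures\<close>

text \<open>\<open>(u, v, w) \<in> Tri C\<close> stands for an exact triangle \<open>A -u\<rightarrow> B -v\<rightarrow> D -w\<rightarrow> TA\<close>.\<close>

record ('o, 'm) tsmc = "('o, 'm) ssmc" +
  Tri :: "('m \<times> 'm \<times> 'm) set"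

definition is_triangle :: "('o, 'm, 'z) ssmc_scheme \<Rightarrow> 'm \<Rightarrow> 'm \<Rightarrow> 'm \<Rightarrow> bool" where
  "is_triangle C u v w \<longleftrightarrow> u \<in> Ar C \<and> v \<in> Ar C \<and> w \<in> Ar C \<and> Dom C v = Cod C u \<and>
     Dom C w = Cod C v \<and> Cod C w = Fob (Sus C) (Dom C u)"

locale triangulated = suspended C for C :: "('o, 'm, 'z) tsmc_scheme" (structure) +
  assumes Tri_triangle: "(u, v, w) \<in> Tri C \<Longrightarrow> is_triangle C u v w"
    and Tri_iso_closed:
      "\<lbrakk>(u, v, w) \<in> Tri C; is_triangle C u' v' w';
        a \<in> Hom C (Dom C u) (Dom C u'); b \<in> Hom C (Cod C u) (Cod C u');
        d \<in> Hom C (Cod C v) (Cod C v'); Iso C a; Iso C b; Iso C d;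
        b \<cdot> u = u' \<cdot> a; d \<cdot> v = v' \<cdot> b; Far (Sus C) a \<cdot> w = w' \<cdot> d\<rbrakk> \<Longrightarrow> (u', v', w') \<in> Tri C"
    and Tri_Ide: "\<lbrakk>A \<in> Ob C; Z \<in> Ob C; Ide C Z = Zer C Z Z\<rbrakk> \<Longrightarrow>
        (Ide C A, Zer C A Z, Zer C Z (Fob (Sus C) A)) \<in> Tri C"
    and Tri_cone: "u \<in> Ar C \<Longrightarrow> \<exists>v w. (u, v, w) \<in> Tri C"
    and Tri_rotate: "is_triangle C u v w \<Longrightarrow>
        (u, v, w) \<in> Tri C \<longleftrightarrow> (v, w, Neg C (Far (Sus C) u)) \<in> Tri C"
    and Tri_complete:
      "\<lbrakk>(u, v, w) \<in> Tri C; (u', v', w') \<in> Tri C;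
        a \<in> Hom C (Dom C u) (Dom C u'); b \<in> Hom C (Cod C u) (Cod C u'); b \<cdot> u = u' \<cdot> a\<rbrakk> \<Longrightarrow>
        \<exists>d \<in> Hom C (Cod C v) (Cod C v'). d \<cdot> v = v' \<cdot> b \<and> Far (Sus C) a \<cdot> w = w' \<cdot> d"
    and octahedron:
      "\<lbrakk>(u, i, i') \<in> Tri C; (v, j, j') \<in> Tri C; Dom C v = Cod C u; (v \<cdot> u, k, k') \<in> Tri C\<rbrakk> \<Longrightarrow>
        \<exists>m \<in> Hom C (Cod C i) (Cod C k). \<exists>n \<in> Hom C (Cod C k) (Cod C j).
          (m, n, Far (Sus C) i \<cdot> j') \<in> Tri C \<and>
          m \<cdot> i = k \<cdot> v \<and> k' \<cdot> m = i' \<and> n \<cdot> k = j \<and> j' \<cdot> n = Far (Sus C) u \<cdot> k'"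

definition exact_functor ::
  "('o, 'm, 'z) tsmc_scheme \<Rightarrow> ('p, 'n, 'y) tsmc_scheme \<Rightarrow> ('o, 'm, 'p, 'n, 'x) sfctr_scheme \<Rightarrow> bool"
where
  "exact_functor C D F \<longleftrightarrow> suspended_functor C D F \<and>
     (\<forall>(u, v, w) \<in> Tri C. (Far F u, Far F v, Theta F (Dom C u) \<cdot>\<^bsub>D\<^esub> Far F w) \<in> Tri D)"

text \<open>
  The suspended structure of \<open>[-, K]\<close>, in the form \<open>T[TA, K] \<rightarrow> [A, K]\<close>: it corresponds under
  the adjunction \<open>(- \<otimes> A) \<stileturn> [A, -]\<close> to
  \<open>T[TA, K] \<otimes> A \<rightarrow> T([TA, K] \<otimes> A) \<leftarrow> [TA, K] \<otimes> TA \<rightarrow> K\<close>.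
\<close>

definition ihom_susp :: "('o, 'm, 'z) ssmc_scheme \<Rightarrow> 'o \<Rightarrow> 'o \<Rightarrow> 'm" where
  "ihom_susp C A K =
     (let TA = Fob (Sus C) A; H = IHom C TA K in
      IHomA C (Ide C A) (Ev C TA K \<cdot>\<^bsub>C\<^esub> Invr C (Tr C H A) \<cdot>\<^bsub>C\<^esub> Tl C H A)
        \<cdot>\<^bsub>C\<^esub> Coev C A (Fob (Sus C) H))"

text \<open>
  Exactness of \<open>[-, K]\<close> sends \<open>A -u\<rightarrow> B -v\<rightarrow> D -w\<rightarrow> TA\<close> to
  \<open>[D, K] \<rightarrow> [B, K] \<rightarrow> [A, K] \<simeq> T[TA, K] \<rightarrow> T[D, K]\<close>. No extra sign is needed: for complexes,
  with cone triangles and the Koszul sign rule for \<open>\<otimes>\<close>, \<open>Tr\<close> and \<open>[-, -]\<close>, this triangle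
  itself is exact.
\<close>

locale triangulated_tensor = triangulated C + suspended_tensor C
  for C :: "('o, 'm, 'z) tsmc_scheme" (structure) +
  assumes tensor_exact_left: "\<lbrakk>(u, v, w) \<in> Tri C; B \<in> Ob C\<rbrakk> \<Longrightarrow>
        (u \<bullet> Ide C B, v \<bullet> Ide C B, Tl C (Dom C u) B \<cdot> (w \<bullet> Ide C B)) \<in> Tri C"
    and tensor_exact_right: "\<lbrakk>(u, v, w) \<in> Tri C; B \<in> Ob C\<rbrakk> \<Longrightarrow>
        (Ide C B \<bullet> u, Ide C B \<bullet> v, Tr C B (Dom C u) \<cdot> (Ide C B \<bullet> w)) \<in> Tri C"
    and IHom_exact_left: "\<lbrakk>(u, v, w) \<in> Tri C; K \<in> Ob C\<rbrakk> \<Longrightarrow>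
        (IHomA C v (Ide C K), IHomA C u (Ide C K),
         Far (Sus C) (IHomA C w (Ide C K)) \<cdot> Invr C (ihom_susp C (Dom C u) K)) \<in> Tri C"


section \<open>The plain, suspended and triangulated settings\<close>

text \<open>
  The data of the suspended and triangulated settings are record fields that are left
  unconstrained in the settings where they play no role. The flag \<open>u\<close> below says whether units
  of the tensor products are considered.
\<close>

datatype flavour = Plain | Suspended | Triangulated

definition smc_category :: "bool \<Rightarrow> flavour \<Rightarrow> ('o, 'm, 'z) tsmc_scheme \<Rightarrow> bool" where
  "smc_category u k C \<longleftrightarrow> sym_tensor_closed C \<and> (u \<longrightarrow> sym_tensor_unit C) \<and>
     (k \<noteq> Plain \<longrightarrow> suspended_tensor C) \<and> (k = Triangulated \<longrightarrow> triangulated_tensor C)"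

definition flavoured_functor ::
  "flavour \<Rightarrow> ('o, 'm, 'z) tsmc_scheme \<Rightarrow> ('p, 'n, 'y) tsmc_scheme \<Rightarrow>
   ('o, 'm, 'p, 'n, 'x) sfctr_scheme \<Rightarrow> bool"
where
  "flavoured_functor k C D F \<longleftrightarrow> is_functor C D F \<and>
     (k \<noteq> Plain \<longrightarrow> suspended_functor C D F) \<and> (k = Triangulated \<longrightarrow> exact_functor C D F)"

definition flavoured_morphism ::
  "flavour \<Rightarrow> ('o, 'm, 'z) ssmc_scheme \<Rightarrow> ('p, 'n, 'y) ssmc_scheme \<Rightarrow>
   ('o, 'm, 'p, 'n, 'x) sfctr_scheme \<Rightarrow> ('o, 'm, 'p, 'n, 'w) sfctr_scheme \<Rightarrow> ('o \<Rightarrow> 'n) \<Rightarrow> bool"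
where
  "flavoured_morphism k C D F G \<rho> \<longleftrightarrow> nat_trans C D F G \<rho> \<and>
     (k \<noteq> Plain \<longrightarrow> suspended_morphism C D F G \<rho>)"


section \<open>Dualities\<close>

type_synonym ('o, 'm) dcat = "('o, 'm) tsmc \<times> ('o, 'm, 'o, 'm) fctr \<times> ('o \<Rightarrow> 'm)"

type_synonym ('o, 'm, 'p, 'n) dfctr = "('o, 'm, 'p, 'n) sfctr \<times> ('o \<Rightarrow> 'n)"

definition duality :: "('o, 'm, 'z) smc_scheme \<Rightarrow> 'o \<Rightarrow> ('o, 'm, 'o, 'm) fctr" where
  "duality C K = \<lparr>Fob = (\<lambda>A. IHom C A K), Far = (\<lambda>f. IHomA C f (Ide C K))\<rparr>"

definition ev_right :: "('o, 'm, 'z) smc_scheme \<Rightarrow> 'o \<Rightarrow> 'o \<Rightarrow> 'm" where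
  "ev_right C A K = Ev C A K \<cdot>\<^bsub>C\<^esub> Sym C A (IHom C A K)"

definition bidual :: "('o, 'm, 'z) smc_scheme \<Rightarrow> 'o \<Rightarrow> 'o \<Rightarrow> 'm" where
  "bidual C K A =
     IHomA C (Ide C (IHom C A K)) (ev_right C A K) \<cdot>\<^bsub>C\<^esub> Coev C (IHom C A K) A"

definition with_duality :: "('o, 'm) tsmc \<Rightarrow> 'o \<Rightarrow> ('o, 'm) dcat" where
  "with_duality C K = (C, duality C K, bidual C K)"

text \<open>
  \<open>D\<^sub>1\<close> and \<open>D\<^sub>2\<close> are contravariant, so both composites below are functors from the opposite
  of \<open>C\<^sub>1\<close> to \<open>C\<^sub>2\<close>. Outside the plain setting the functor \<open>F\<close> is suspended.
\<close>

fun dp_functor ::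
  "flavour \<Rightarrow> ('o, 'm) dcat \<Rightarrow> ('p, 'n) dcat \<Rightarrow> ('o, 'm, 'p, 'n) dfctr \<Rightarrow> bool"
where
  "dp_functor k (C\<^sub>1, D\<^sub>1, w\<^sub>1) (C\<^sub>2, D\<^sub>2, w\<^sub>2) (F, \<phi>) \<longleftrightarrow>
     is_functor C\<^sub>1 C\<^sub>2 F \<and> (k \<noteq> Plain \<longrightarrow> suspended_functor C\<^sub>1 C\<^sub>2 F) \<and>
     nat_trans (opp C\<^sub>1) C\<^sub>2 (F \<circ>\<^sub>F D\<^sub>1) (D\<^sub>2 \<circ>\<^sub>F F) \<phi> \<and>
     (\<forall>A \<in> Ob C\<^sub>1. \<phi> (Fob D\<^sub>1 A) \<cdot>\<^bsub>C\<^sub>2\<^esub> Far F (w\<^sub>1 A) = Far D\<^sub>2 (\<phi> A) \<cdot>\<^bsub>C\<^sub>2\<^esub> w\<^sub>2 (Fob F A))"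

text \<open>In \<open>dp_comp C G F\<close>, the category \<open>C\<close> is the target of \<open>G\<close>.\<close>

fun dp_comp ::
  "('q, 'l, 'z) cat_scheme \<Rightarrow> ('p, 'n, 'q, 'l) dfctr \<Rightarrow> ('o, 'm, 'p, 'n) dfctr \<Rightarrow>
   ('o, 'm, 'q, 'l) dfctr"
where
  "dp_comp C (F', \<phi>') (F, \<phi>) =
     (comp_sfctr C F' F, \<lambda>A. \<phi>' (Fob F A) \<cdot>\<^bsub>C\<^esub> Far F' (\<phi> A))"

fun dp_morphism ::
  "flavour \<Rightarrow> ('o, 'm) dcat \<Rightarrow> ('p, 'n) dcat \<Rightarrow> ('o, 'm, 'p, 'n) dfctr \<Rightarrow>
   ('o, 'm, 'p, 'n) dfctr \<Rightarrow> ('o \<Rightarrow> 'n) \<Rightarrow> bool"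
where
  "dp_morphism k (C\<^sub>1, D\<^sub>1, w\<^sub>1) (C\<^sub>2, D\<^sub>2, w\<^sub>2) (F, \<phi>) (F', \<phi>') \<rho> \<longleftrightarrow>
     dp_functor k (C\<^sub>1, D\<^sub>1, w\<^sub>1) (C\<^sub>2, D\<^sub>2, w\<^sub>2) (F, \<phi>) \<and>
     dp_functor k (C\<^sub>1, D\<^sub>1, w\<^sub>1) (C\<^sub>2, D\<^sub>2, w\<^sub>2) (F', \<phi>') \<and>
     flavoured_morphism k C\<^sub>1 C\<^sub>2 F F' \<rho> \<and>
     (\<forall>A \<in> Ob C\<^sub>1. \<phi> A = Far D\<^sub>2 (\<rho> A) \<cdot>\<^bsub>C\<^sub>2\<^esub> \<phi>' A \<cdot>\<^bsub>C\<^sub>2\<^esub> \<rho> (Fob D\<^sub>1 A))"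

definition dp_change :: "('o, 'm, 'z) ssmc_scheme \<Rightarrow> 'm \<Rightarrow> ('o, 'm, 'o, 'm) dfctr" where
  "dp_change C \<iota> = (id_sfctr C, \<lambda>A. IHomA C (Ide C A) \<iota>)"


section \<open>Monoidal contravariant pseudo functors\<close>

text \<open>
  Only the existence of the unit isomorphism is required: it is determined by the two unit
  conditions.
\<close>

definition sym_monoidal_functor ::
  "bool \<Rightarrow> ('o, 'm, 'z) smc_scheme \<Rightarrow> ('p, 'n, 'y) smc_scheme \<Rightarrow> ('o, 'm, 'p, 'n, 'x) fctr_scheme \<Rightarrow>
   ('o \<Rightarrow> 'o \<Rightarrow> 'n) \<Rightarrow> bool"
where
  "sym_monoidal_functor u C D F \<alpha> \<longleftrightarrow>
     nat_iso (prod_cat C C) D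
       \<lparr>Fob = (\<lambda>(A, B). Fob F A \<odot>\<^bsub>D\<^esub> Fob F B), Far = (\<lambda>(f, g). Far F f \<bullet>\<^bsub>D\<^esub> Far F g)\<rparr>
       \<lparr>Fob = (\<lambda>(A, B). Fob F (A \<odot>\<^bsub>C\<^esub> B)), Far = (\<lambda>(f, g). Far F (f \<bullet>\<^bsub>C\<^esub> g))\<rparr>
       (\<lambda>(A, B). \<alpha> A B) \<and>
     (\<forall>A \<in> Ob C. \<forall>B \<in> Ob C. \<forall>E \<in> Ob C.
        Far F (Asc C A B E) \<cdot>\<^bsub>D\<^esub> \<alpha> (A \<odot>\<^bsub>C\<^esub> B) E \<cdot>\<^bsub>D\<^esub> (\<alpha> A B \<bullet>\<^bsub>D\<^esub> Ide D (Fob F E))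
        = \<alpha> A (B \<odot>\<^bsub>C\<^esub> E) \<cdot>\<^bsub>D\<^esub> (Ide D (Fob F A) \<bullet>\<^bsub>D\<^esub> \<alpha> B E)
            \<cdot>\<^bsub>D\<^esub> Asc D (Fob F A) (Fob F B) (Fob F E)) \<and>
     (\<forall>A \<in> Ob C. \<forall>B \<in> Ob C.
        Far F (Sym C A B) \<cdot>\<^bsub>D\<^esub> \<alpha> A B = \<alpha> B A \<cdot>\<^bsub>D\<^esub> Sym D (Fob F A) (Fob F B)) \<and>
     (u \<longrightarrow> (\<exists>i \<in> Hom D (Uni D) (Fob F (Uni C)). Iso D i \<and>
        (\<forall>A \<in> Ob C.
           Far F (Lun C A) \<cdot>\<^bsub>D\<^esub> \<alpha> (Uni C) A \<cdot>\<^bsub>D\<^esub> (i \<bullet>\<^bsub>D\<^esub> Ide D (Fob F A)) = Lun D (Fob F A) \<and>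
           Far F (Run C A) \<cdot>\<^bsub>D\<^esub> \<alpha> A (Uni C) \<cdot>\<^bsub>D\<^esub> (Ide D (Fob F A) \<bullet>\<^bsub>D\<^esub> i) = Run D (Fob F A))))"

definition suspended_monoidal ::
  "('o, 'm, 'z) ssmc_scheme \<Rightarrow> ('p, 'n, 'y) ssmc_scheme \<Rightarrow> ('o, 'm, 'p, 'n, 'x) sfctr_scheme \<Rightarrow>
   ('o \<Rightarrow> 'o \<Rightarrow> 'n) \<Rightarrow> bool"
where
  "suspended_monoidal C D F \<alpha> \<longleftrightarrow> (\<forall>A \<in> Ob C. \<forall>B \<in> Ob C.
     Theta F (A \<odot>\<^bsub>C\<^esub> B) \<cdot>\<^bsub>D\<^esub> Far F (Tl C A B) \<cdot>\<^bsub>D\<^esub> \<alpha> (Fob (Sus C) A) B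
       = Far (Sus D) (\<alpha> A B) \<cdot>\<^bsub>D\<^esub> Tl D (Fob F A) (Fob F B)
           \<cdot>\<^bsub>D\<^esub> (Theta F A \<bullet>\<^bsub>D\<^esub> Ide D (Fob F B)) \<and>
     Theta F (A \<odot>\<^bsub>C\<^esub> B) \<cdot>\<^bsub>D\<^esub> Far F (Tr C A B) \<cdot>\<^bsub>D\<^esub> \<alpha> A (Fob (Sus C) B)
       = Far (Sus D) (\<alpha> A B) \<cdot>\<^bsub>D\<^esub> Tr D (Fob F A) (Fob F B)
           \<cdot>\<^bsub>D\<^esub> (Ide D (Fob F A) \<bullet>\<^bsub>D\<^esub> Theta F B))"

text \<open>
  \<open>Fib P X\<close> is the category attached to \<open>X\<close>, \<open>Pull P f = f\<^sup>*\<close>,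
  \<open>Pcomp P g f A : f\<^sup>*g\<^sup>*A \<rightarrow> (gf)\<^sup>*A\<close> and \<open>Pten P f A B : f\<^sup>*A \<otimes> f\<^sup>*B \<rightarrow> f\<^sup>*(A \<otimes> B)\<close>.
  All the categories attached to objects share one type of objects and one type of arrows; this
  is no restriction, since they have carriers and one may pass to disjoint unions.
\<close>

record ('b, 'a, 'o, 'm) pfctr =
  Fib :: "'b \<Rightarrow> ('o, 'm) tsmc"
  Pull :: "'a \<Rightarrow> ('o, 'm, 'o, 'm) sfctr"
  Pcomp :: "'a \<Rightarrow> 'a \<Rightarrow> 'o \<Rightarrow> 'm"
  Pten :: "'a \<Rightarrow> 'o \<Rightarrow> 'o \<Rightarrow> 'm"

definition pseudo_functor ::
  "bool \<Rightarrow> flavour \<Rightarrow> ('b, 'a) cat \<Rightarrow> ('b, 'a, 'o, 'm) pfctr \<Rightarrow> bool"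
where
  "pseudo_functor u k B P \<longleftrightarrow> category B \<and>
     (\<forall>X \<in> Ob B. smc_category u k (Fib P X)) \<and>
     (\<forall>X Y. \<forall>f \<in> Hom B X Y. flavoured_functor k (Fib P Y) (Fib P X) (Pull P f)) \<and>
     (\<forall>X \<in> Ob B.
        (\<forall>A \<in> Ob (Fib P X). Fob (Pull P (Ide B X)) A = A) \<and>
        (\<forall>f \<in> Ar (Fib P X). Far (Pull P (Ide B X)) f = f) \<and>
        (k \<noteq> Plain \<longrightarrow> (\<forall>A \<in> Ob (Fib P X).
           Theta (Pull P (Ide B X)) A = Ide (Fib P X) (Fob (Sus (Fib P X)) A)))) \<and>
     (\<forall>X Y Z. \<forall>f \<in> Hom B X Y. \<forall>g \<in> Hom B Y Z.
        flavoured_morphism k (Fib P Z) (Fib P X)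
          (comp_sfctr (Fib P X) (Pull P f) (Pull P g)) (Pull P (g \<cdot>\<^bsub>B\<^esub> f)) (Pcomp P g f) \<and>
        (\<forall>A \<in> Ob (Fib P Z). Iso (Fib P X) (Pcomp P g f A)))"

definition associative_pf :: "('b, 'a) cat \<Rightarrow> ('b, 'a, 'o, 'm) pfctr \<Rightarrow> bool" where
  "associative_pf B P \<longleftrightarrow>
     (\<forall>X Y Z W. \<forall>f \<in> Hom B X Y. \<forall>g \<in> Hom B Y Z. \<forall>h \<in> Hom B Z W. \<forall>A \<in> Ob (Fib P W).
        Pcomp P (h \<cdot>\<^bsub>B\<^esub> g) f A \<cdot>\<^bsub>Fib P X\<^esub> Far (Pull P f) (Pcomp P h g A)
        = Pcomp P h (g \<cdot>\<^bsub>B\<^esub> f) A \<cdot>\<^bsub>Fib P X\<^esub> Pcomp P g f (Fob (Pull P h) A))"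

definition monoidal_pf ::
  "bool \<Rightarrow> flavour \<Rightarrow> ('b, 'a) cat \<Rightarrow> ('b, 'a, 'o, 'm) pfctr \<Rightarrow> bool"
where
  "monoidal_pf u k B P \<longleftrightarrow>
     (\<forall>X Y. \<forall>f \<in> Hom B X Y.
        sym_monoidal_functor u (Fib P Y) (Fib P X) (Pull P f) (Pten P f) \<and>
        (k \<noteq> Plain \<longrightarrow> suspended_monoidal (Fib P Y) (Fib P X) (Pull P f) (Pten P f))) \<and>
     (\<forall>X Y Z. \<forall>f \<in> Hom B X Y. \<forall>g \<in> Hom B Y Z. \<forall>A \<in> Ob (Fib P Z). \<forall>E \<in> Ob (Fib P Z).
        Pcomp P g f (A \<odot>\<^bsub>Fib P Z\<^esub> E)
          \<cdot>\<^bsub>Fib P X\<^esub> Far (Pull P f) (Pten P g A E)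
          \<cdot>\<^bsub>Fib P X\<^esub> Pten P f (Fob (Pull P g) A) (Fob (Pull P g) E)
        = Pten P (g \<cdot>\<^bsub>B\<^esub> f) A E \<cdot>\<^bsub>Fib P X\<^esub> (Pcomp P g f A \<bullet>\<^bsub>Fib P X\<^esub> Pcomp P g f E))"

text \<open>The subcategory of \<open>B\<close> of those \<open>h\<close> for which \<open>h\<^sup>* \<stileturn> h\<^sub>* \<stileturn> h\<^sup>!\<close> exist.\<close>

definition adjoint_subcat :: "('b, 'a) cat \<Rightarrow> ('b, 'a, 'o, 'm) pfctr \<Rightarrow> ('b, 'a) cat" where
  "adjoint_subcat B P = B\<lparr>Ar := {h \<in> Ar B.
     \<exists>(G :: ('o, 'm, 'o, 'm) fctr) (R :: ('o, 'm, 'o, 'm) fctr) \<eta> e \<eta>' e'.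
       adjunction (Fib P (Cod B h)) (Fib P (Dom B h)) (Pull P h) G \<eta> e \<and>
       adjunction (Fib P (Dom B h)) (Fib P (Cod B h)) G R \<eta>' e'}\<rparr>"

text \<open>
  A choice of adjoints: \<open>Push S h = h\<^sub>*\<close>, \<open>Shriek S h = h\<^sup>!\<close>, with units and counits
  \<open>Eta\<close>, \<open>Eps\<close> for \<open>h\<^sup>* \<stileturn> h\<^sub>*\<close> and \<open>Eta'\<close>, \<open>Eps'\<close> for \<open>h\<^sub>* \<stileturn> h\<^sup>!\<close>.
\<close>

record ('a, 'o, 'm) adjoints =
  Push :: "'a \<Rightarrow> ('o, 'm, 'o, 'm) sfctr"
  Shriek :: "'a \<Rightarrow> ('o, 'm, 'o, 'm) sfctr"
  Eta :: "'a \<Rightarrow> 'o \<Rightarrow> 'm"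
  Eps :: "'a \<Rightarrow> 'o \<Rightarrow> 'm"
  Eta' :: "'a \<Rightarrow> 'o \<Rightarrow> 'm"
  Eps' :: "'a \<Rightarrow> 'o \<Rightarrow> 'm"

text \<open>
  The conditions for \<open>k \<noteq> Plain\<close> do not restrict the choice of adjoints: they characterise the
  suspended structures of \<open>h\<^sub>*\<close> and \<open>h\<^sup>!\<close>, which exist and are unique.
\<close>

definition adjoint_choice ::
  "flavour \<Rightarrow> ('b, 'a) cat \<Rightarrow> ('b, 'a, 'o, 'm) pfctr \<Rightarrow> ('a, 'o, 'm) adjoints \<Rightarrow> bool"
where
  "adjoint_choice k B P S \<longleftrightarrow> (\<forall>X Y. \<forall>h \<in> Hom (adjoint_subcat B P) X Y.
     adjunction (Fib P Y) (Fib P X) (Pull P h) (Push S h) (Eta S h) (Eps S h) \<and>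
     adjunction (Fib P X) (Fib P Y) (Push S h) (Shriek S h) (Eta' S h) (Eps' S h) \<and>
     (k \<noteq> Plain \<longrightarrow>
        suspended_functor (Fib P X) (Fib P Y) (Push S h) \<and>
        suspended_functor (Fib P Y) (Fib P X) (Shriek S h) \<and>
        suspended_morphism (Fib P Y) (Fib P Y) (id_sfctr (Fib P Y))
          (comp_sfctr (Fib P Y) (Push S h) (Pull P h)) (Eta S h) \<and>
        suspended_morphism (Fib P X) (Fib P X)
          (comp_sfctr (Fib P X) (Pull P h) (Push S h)) (id_sfctr (Fib P X)) (Eps S h) \<and>
        suspended_morphism (Fib P X) (Fib P X) (id_sfctr (Fib P X))
          (comp_sfctr (Fib P X) (Shriek S h) (Push S h)) (Eta' S h) \<and>
        suspended_morphism (Fib P Y) (Fib P Y)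
          (comp_sfctr (Fib P Y) (Push S h) (Shriek S h)) (id_sfctr (Fib P Y)) (Eps' S h)))"


section \<open>Pull-back, push-forward, base change\<close>

text \<open>For \<open>F : C \<rightarrow> D\<close> and \<open>\<nu> A B : FA \<otimes> FB \<rightarrow> F(A \<otimes> B)\<close>, the morphism \<open>F[A, K] \<rightarrow> [FA, FK]\<close>.\<close>

definition hom_compare ::
  "('o, 'm, 'z) smc_scheme \<Rightarrow> ('p, 'n, 'y) smc_scheme \<Rightarrow> ('o, 'm, 'p, 'n, 'x) fctr_scheme \<Rightarrow>
   ('o \<Rightarrow> 'o \<Rightarrow> 'n) \<Rightarrow> 'o \<Rightarrow> 'o \<Rightarrow> 'n"
where
  "hom_compare C D F \<nu> A K =
     IHomA D (Ide D (Fob F A)) (Far F (Ev C A K))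
       \<cdot>\<^bsub>D\<^esub> IHomA D (Ide D (Fob F A)) (\<nu> (IHom C A K) A)
       \<cdot>\<^bsub>D\<^esub> Coev D (Fob F A) (Fob F (IHom C A K))"

definition pull_beta ::
  "('b, 'a) cat \<Rightarrow> ('b, 'a, 'o, 'm) pfctr \<Rightarrow> 'a \<Rightarrow> 'o \<Rightarrow> 'o \<Rightarrow> 'm"
where
  "pull_beta B P f A K =
     hom_compare (Fib P (Cod B f)) (Fib P (Dom B f)) (Pull P f) (Pten P f) A K"

definition push_lambda ::
  "('b, 'a) cat \<Rightarrow> ('b, 'a, 'o, 'm) pfctr \<Rightarrow> ('a, 'o, 'm) adjoints \<Rightarrow> 'a \<Rightarrow> 'o \<Rightarrow> 'o \<Rightarrow> 'm"
where
  "push_lambda B P S h A E =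
     (let X = Fib P (Dom B h); Y = Fib P (Cod B h); hA = Fob (Push S h) A; hE = Fob (Push S h) E in
      Far (Push S h) (Eps S h A \<bullet>\<^bsub>X\<^esub> Eps S h E)
        \<cdot>\<^bsub>Y\<^esub> Far (Push S h) (Invr X (Pten P h hA hE))
        \<cdot>\<^bsub>Y\<^esub> Eta S h (hA \<odot>\<^bsub>Y\<^esub> hE))"

definition push_mu ::
  "('b, 'a) cat \<Rightarrow> ('b, 'a, 'o, 'm) pfctr \<Rightarrow> ('a, 'o, 'm) adjoints \<Rightarrow> 'a \<Rightarrow> 'o \<Rightarrow> 'o \<Rightarrow> 'm"
where
  "push_mu B P S h A K =
     hom_compare (Fib P (Dom B h)) (Fib P (Cod B h)) (Push S h) (push_lambda B P S h) A K"

definition push_zeta ::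
  "('b, 'a) cat \<Rightarrow> ('b, 'a, 'o, 'm) pfctr \<Rightarrow> ('a, 'o, 'm) adjoints \<Rightarrow> 'a \<Rightarrow> 'o \<Rightarrow> 'o \<Rightarrow> 'm"
where
  "push_zeta B P S h A K =
     IHomA (Fib P (Cod B h)) (Ide (Fib P (Cod B h)) (Fob (Push S h) A)) (Eps' S h K)
       \<cdot>\<^bsub>Fib P (Cod B h)\<^esub> push_mu B P S h A (Fob (Shriek S h) K)"

definition dp_pull ::
  "('b, 'a) cat \<Rightarrow> ('b, 'a, 'o, 'm) pfctr \<Rightarrow> 'a \<Rightarrow> 'o \<Rightarrow> ('o, 'm, 'o, 'm) dfctr"
where
  "dp_pull B P f K = (Pull P f, \<lambda>A. pull_beta B P f A K)"

definition dp_push ::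
  "('b, 'a) cat \<Rightarrow> ('b, 'a, 'o, 'm) pfctr \<Rightarrow> ('a, 'o, 'm) adjoints \<Rightarrow> 'a \<Rightarrow> 'o \<Rightarrow>
   ('o, 'm, 'o, 'm) dfctr"
where
  "dp_push B P S h K = (Push S h, \<lambda>A. push_zeta B P S h A K)"

text \<open>
  The next three definitions refer to a commutative square \<open>f gb = g fb\<close>, with
  \<open>fb : V \<rightarrow> X\<close>, \<open>gb : V \<rightarrow> Y\<close>, \<open>f : Y \<rightarrow> Z\<close>, \<open>g : X \<rightarrow> Z\<close>.
\<close>

definition bc_xi ::
  "('b, 'a) cat \<Rightarrow> ('b, 'a, 'o, 'm) pfctr \<Rightarrow> 'a \<Rightarrow> 'a \<Rightarrow> 'a \<Rightarrow> 'a \<Rightarrow> 'o \<Rightarrow> 'm"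
where
  "bc_xi B P fb gb f g A =
     Invr (Fib P (Dom B gb)) (Pcomp P g fb A) \<cdot>\<^bsub>Fib P (Dom B gb)\<^esub> Pcomp P f gb A"

definition bc_epsilon ::
  "('b, 'a) cat \<Rightarrow> ('b, 'a, 'o, 'm) pfctr \<Rightarrow> ('a, 'o, 'm) adjoints \<Rightarrow>
   'a \<Rightarrow> 'a \<Rightarrow> 'a \<Rightarrow> 'a \<Rightarrow> 'o \<Rightarrow> 'm"
where
  "bc_epsilon B P S fb gb f g A =
     Far (Push S gb) (Far (Pull P fb) (Eps S g A))
       \<cdot>\<^bsub>Fib P (Cod B gb)\<^esub> Far (Push S gb) (bc_xi B P fb gb f g (Fob (Push S g) A))
       \<cdot>\<^bsub>Fib P (Cod B gb)\<^esub> Eta S gb (Fob (Pull P f) (Fob (Push S g) A))"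

definition bc_gamma ::
  "('b, 'a) cat \<Rightarrow> ('b, 'a, 'o, 'm) pfctr \<Rightarrow> ('a, 'o, 'm) adjoints \<Rightarrow>
   'a \<Rightarrow> 'a \<Rightarrow> 'a \<Rightarrow> 'a \<Rightarrow> 'o \<Rightarrow> 'm"
where
  "bc_gamma B P S fb gb f g K =
     Far (Shriek S gb) (Far (Pull P f) (Eps' S g K))
       \<cdot>\<^bsub>Fib P (Dom B gb)\<^esub>
         Far (Shriek S gb) (Invr (Fib P (Cod B gb)) (bc_epsilon B P S fb gb f g (Fob (Shriek S g) K)))
       \<cdot>\<^bsub>Fib P (Dom B gb)\<^esub> Eta' S gb (Fob (Pull P fb) (Fob (Shriek S g) K))"

end

theory Submission
  imports Defs
begin

text \<open>
  A morphism into \<open>[A, K]\<close> is tested by composing it, after \<open>- \<otimes> A\<close>, with evaluation, and a morphism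
  into \<open>h\<^sub>*B\<close> by applying \<open>h\<^sup>*\<close> and composing with the counit. The transpose of
  \<open>F[A, K] \<rightarrow> [FA, FK]\<close> is \<open>F[A, K] \<otimes> FA \<rightarrow> F([A, K] \<otimes> A) \<rightarrow> FK\<close>, so any functor with a natural symmetric
  \<open>FA \<otimes> FB \<rightarrow> F(A \<otimes> B)\<close> preserves dualities; this covers pull-backs and push-forwards alike. After
  transposition, the compatibility of \<open>\<epsilon>\<close> with the dualities reduces to the defining property of
  \<open>\<gamma>\<close> and to the fact that \<open>\<epsilon>\<close> is monoidal, which by the second test
  reduces to \<open>\<xi>\<close> being monoidal.
\<close>

section \<open>Categories and adjunctions\<close>

text \<open>Two ingredients are defined through inverses: \<lambda> contains the inverse of the
  tensor isomorphism and \<gamma> the inverse of \<epsilon>. Neither inverse is carried through the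
  main computations. For \<lambda>, transposed equations are precomposed with the tensor isomorphism
  \<alpha>, which leaves only a tensor product e \<otimes> e of counits of h^* \<stileturn> h_*. For
  \<gamma>, the only equation used is e'_{f^*K} gb_*(\<gamma>_K) \<epsilon>_{g^!K} = f^*(e'_K),
  where e' is the counit of h_* \<stileturn> h^!. It mentions h^! only through its two counit
  components, so the core identity can be proved for arbitrary arrows c, c' and \<gamma> in such a
  square.

  A morphism of duality preserving functors presupposes that its source and target preserve
  dualities. For the push-forward this is obtained by viewing \<zeta> as \<mu> followed by the
  change of dualising object along e'. Outside the plain setting \<epsilon> must moreover commute
  with suspensions, which is inherited from its constituents: a unit, \<xi> and a counit.\<close>

context category
begin

lemma Dom_Ob [simp]: "f \<in> Ar C \<Longrightarrow> Dom C f \<in> Ob C"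
  and Cod_Ob [simp]: "f \<in> Ar C \<Longrightarrow> Cod C f \<in> Ob C"
  using dom_cod_Ob by auto

lemma Ide_simps [simp]:
  assumes "A \<in> Ob C"
  shows "Ide C A \<in> Ar C" "Dom C (Ide C A) = A" "Cod C (Ide C A) = A"
  using Ide_Hom[OF assms] by (auto simp: Hom_def)

lemma Cmp_simps [simp]:
  assumes "f \<in> Ar C" "g \<in> Ar C" "Dom C g = Cod C f"
  shows "g \<cdot> f \<in> Ar C" "Dom C (g \<cdot> f) = Dom C f" "Cod C (g \<cdot> f) = Cod C g"
  using Cmp_Hom[of f "Dom C f" "Cod C f" g "Cod C g"] assms by (auto simp: Hom_def)

lemma Cmp_Ide [simp]:
  assumes "f \<in> Ar C"
  shows "Cod C f = A \<Longrightarrow> Ide C A \<cdot> f = f" "Dom C f = A \<Longrightarrow> f \<cdot> Ide C A = f"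
  using Cmp_Ide_left Cmp_Ide_right assms by (auto simp: Hom_def)

lemma Cmp_assoc_Ar [simp]:
  assumes "f \<in> Ar C" "g \<in> Ar C" "h \<in> Ar C" "Dom C g = Cod C f" "Dom C h = Cod C g"
  shows "(h \<cdot> g) \<cdot> f = h \<cdot> (g \<cdot> f)"
  using Cmp_assoc[of f "Dom C f" "Cod C f" g "Cod C g" h "Cod C h"] assms by (auto simp: Hom_def)

text \<open>Composites are kept bracketed to the right, so a commuting square g f = k h does not
  occur literally in the middle of a longer composite; the tail \<open>x\<close> makes it applicable
  there. \<open>Cmp_extend1\<close> is the case of a triangle.\<close>

lemma Cmp_extend:
  assumes "g \<cdot> f = k \<cdot> h"
    and "f \<in> Ar C" "g \<in> Ar C" "h \<in> Ar C" "k \<in> Ar C" "Dom C g = Cod C f" "Dom C k = Cod C h"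
    and "x \<in> Ar C" "Cod C x = Dom C f" "Dom C h = Dom C f"
  shows "g \<cdot> (f \<cdot> x) = k \<cdot> (h \<cdot> x)"
  using assms by (metis Cmp_assoc_Ar)

lemma Cmp_extend1:
  assumes "g \<cdot> f = k" "f \<in> Ar C" "g \<in> Ar C" "Dom C g = Cod C f" "x \<in> Ar C" "Cod C x = Dom C f"
  shows "g \<cdot> (f \<cdot> x) = k \<cdot> x"
  using assms by (metis Cmp_assoc_Ar)

text \<open>Uniqueness gives the definite description in \<open>Invr\<close> its meaning.\<close>

lemma inverse_arrows_unique:
  assumes "inverse_arrows C f g" "inverse_arrows C f g'"
  shows "g = g'"
proof -
  have ty: "g \<in> Ar C" "g' \<in> Ar C" "f \<in> Ar C" "Dom C g = Cod C f" "Dom C g' = Cod C f"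
    "Cod C g = Dom C f" "Cod C g' = Dom C f"
    and inv: "g' \<cdot> f = Ide C (Dom C f)" "f \<cdot> g = Ide C (Cod C f)"
    using assms by (auto simp: inverse_arrows_def Hom_def)
  have "(g' \<cdot> f) \<cdot> g = g' \<cdot> (f \<cdot> g)"
    by (rule Cmp_assoc_Ar) (use ty in simp_all)
  with ty show ?thesis
    unfolding inv by simp
qed

lemma inverse_arrows_Invr: "Iso C f \<Longrightarrow> inverse_arrows C f (Invr C f)"
  unfolding Iso_def Invr_def by (metis inverse_arrows_unique theI)

lemma Invr_simps [simp]:
  assumes "Iso C f"
  shows "Invr C f \<in> Ar C" "Dom C (Invr C f) = Cod C f" "Cod C (Invr C f) = Dom C f"
    "Invr C f \<cdot> f = Ide C (Dom C f)" "f \<cdot> Invr C f = Ide C (Cod C f)"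
  using inverse_arrows_Invr[OF assms] by (auto simp: inverse_arrows_def Hom_def)

lemma Iso_Ar: "Iso C f \<Longrightarrow> f \<in> Ar C"
  by (auto simp: Iso_def inverse_arrows_def)

lemma IsoI:
  assumes "f \<in> Ar C" "g \<in> Ar C" "Dom C g = Cod C f" "Cod C g = Dom C f"
    "g \<cdot> f = Ide C (Dom C f)" "f \<cdot> g = Ide C (Cod C f)"
  shows "Iso C f"
  using assms by (auto simp: Iso_def inverse_arrows_def Hom_def)

lemma Iso_Ide: "A \<in> Ob C \<Longrightarrow> Iso C (Ide C A)"
  by (rule IsoI[where g = "Ide C A"]) simp_all

lemma Iso_Cmp:
  assumes "Iso C f" "Iso C g" "Dom C g = Cod C f"
  shows "Iso C (g \<cdot> f)"
proof (rule IsoI[where g = "Invr C f \<cdot> Invr C g"])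
  have "f \<in> Ar C" "g \<in> Ar C"
    using assms Iso_Ar by auto
  with assms show "g \<cdot> f \<in> Ar C" "Invr C f \<cdot> Invr C g \<in> Ar C"
    "Dom C (Invr C f \<cdot> Invr C g) = Cod C (g \<cdot> f)" "Cod C (Invr C f \<cdot> Invr C g) = Dom C (g \<cdot> f)"
    "(Invr C f \<cdot> Invr C g) \<cdot> (g \<cdot> f) = Ide C (Dom C (g \<cdot> f))"
    "(g \<cdot> f) \<cdot> (Invr C f \<cdot> Invr C g) = Ide C (Cod C (g \<cdot> f))"
    by (simp_all add: Cmp_extend1[OF Invr_simps(4)] Cmp_extend1[OF Invr_simps(5)])
qed

lemma Invr_cancel [simp]:
  assumes "Iso C f" "x \<in> Ar C"
  shows "Cod C x = Dom C f \<Longrightarrow> Invr C f \<cdot> (f \<cdot> x) = x"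
    "Cod C x = Cod C f \<Longrightarrow> f \<cdot> (Invr C f \<cdot> x) = x"
  using assms Iso_Ar[of f] by (simp_all add: Cmp_extend1[OF Invr_simps(4)] Cmp_extend1[OF Invr_simps(5)])

text \<open>The cancellation behind the treatment of inverses: an equation whose sides involve the
  inverse of \<open>f\<close> is tested after precomposing with \<open>f\<close>.\<close>

lemma Iso_epi:
  assumes "Iso C f" "p \<in> Ar C" "q \<in> Ar C" "Dom C p = Cod C f" "Dom C q = Cod C f"
    and "p \<cdot> f = q \<cdot> f"
  shows "p = q"
proof -
  have "(p \<cdot> f) \<cdot> Invr C f = p" "(q \<cdot> f) \<cdot> Invr C f = q"
    using assms(1-5) Iso_Ar[of f] by simp_all
  then show ?thesis
    using assms(6) by metis
qed

end

section \<open>Functors, opposite and product categories, natural transformations\<close>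

lemma comp_fctr_simps [simp]:
  "Fob (G \<circ>\<^sub>F F) A = Fob G (Fob F A)" "Far (G \<circ>\<^sub>F F) f = Far G (Far F f)"
  by (simp_all add: comp_fctr_def)

lemma id_fctr_simps [simp]: "Fob id_fctr A = A" "Far id_fctr f = f"
  by (simp_all add: id_fctr_def)

lemma adjunctionD:
  assumes "adjunction C D F G \<eta> e"
  shows "is_functor C D F" "is_functor D C G"
    "nat_trans C C id_fctr (G \<circ>\<^sub>F F) \<eta>" "nat_trans D D (F \<circ>\<^sub>F G) id_fctr e"
    "\<And>A. A \<in> Ob C \<Longrightarrow> e (Fob F A) \<cdot>\<^bsub>D\<^esub> Far F (\<eta> A) = Ide D (Fob F A)"
    "\<And>E. E \<in> Ob D \<Longrightarrow> Far G (e E) \<cdot>\<^bsub>C\<^esub> \<eta> (Fob G E) = Ide C (Fob G E)"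
  using assms by (auto simp: adjunction_def)

lemma opp_simps [simp]:
  "Ob (opp C) = Ob C" "Ar (opp C) = Ar C" "Dom (opp C) = Cod C" "Cod (opp C) = Dom C"
  "Ide (opp C) = Ide C" "g \<cdot>\<^bsub>opp C\<^esub> f = f \<cdot>\<^bsub>C\<^esub> g" "Hom (opp C) A B = Hom C B A"
  by (auto simp: opp_def Hom_def)

lemma (in category) category_opp: "category (opp C)"
  by unfold_locales (auto simp: Hom_def)

lemma prod_cat_simps [simp]:
  "Ob (prod_cat C D) = Ob C \<times> Ob D" "Ar (prod_cat C D) = Ar C \<times> Ar D"
  "Dom (prod_cat C D) (f, g) = (Dom C f, Dom D g)" "Cod (prod_cat C D) (f, g) = (Cod C f, Cod D g)"
  "Ide (prod_cat C D) (A, E) = (Ide C A, Ide D E)"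
  "(f', g') \<cdot>\<^bsub>prod_cat C D\<^esub> (f, g) = (f' \<cdot>\<^bsub>C\<^esub> f, g' \<cdot>\<^bsub>D\<^esub> g)"
  by (auto simp: prod_cat_def)

locale cat_functor = C: category C + D: category D
  for C :: "('o, 'm, 'z) cat_scheme" and D :: "('p, 'n, 'y) cat_scheme"
    and F :: "('o, 'm, 'p, 'n, 'x) fctr_scheme" +
  assumes is_functor: "is_functor C D F"
begin

lemma Fob_Ob [simp]: "A \<in> Ob C \<Longrightarrow> Fob F A \<in> Ob D"
  using is_functor by (auto simp: is_functor_def)

lemma Far_simps [simp]:
  assumes "f \<in> Ar C"
  shows "Far F f \<in> Ar D" "Dom D (Far F f) = Fob F (Dom C f)" "Cod D (Far F f) = Fob F (Cod C f)"
  using is_functor assms by (auto simp: is_functor_def Hom_def)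

lemma Far_Ide [simp]: "A \<in> Ob C \<Longrightarrow> Far F (Ide C A) = Ide D (Fob F A)"
  using is_functor by (auto simp: is_functor_def)

lemma Far_Cmp [simp]:
  assumes "f \<in> Ar C" "g \<in> Ar C" "Dom C g = Cod C f"
  shows "Far F (g \<cdot>\<^bsub>C\<^esub> f) = Far F g \<cdot>\<^bsub>D\<^esub> Far F f"
  using is_functor assms by (auto simp: is_functor_def Hom_def)

lemma Far_square:
  assumes "q \<cdot>\<^bsub>C\<^esub> p = s \<cdot>\<^bsub>C\<^esub> r"
    and "p \<in> Ar C" "q \<in> Ar C" "r \<in> Ar C" "s \<in> Ar C" "Dom C q = Cod C p" "Dom C s = Cod C r"
  shows "Far F q \<cdot>\<^bsub>D\<^esub> Far F p = Far F s \<cdot>\<^bsub>D\<^esub> Far F r"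
  using assms by (metis Far_Cmp)

lemma Iso_Far:
  assumes "Iso C f"
  shows "Iso D (Far F f)"
proof (rule D.IsoI[where g = "Far F (Invr C f)"])
  have f: "f \<in> Ar C" using assms C.Iso_Ar by auto
  then show "Far F (Invr C f) \<cdot>\<^bsub>D\<^esub> Far F f = Ide D (Dom D (Far F f))"
    "Far F f \<cdot>\<^bsub>D\<^esub> Far F (Invr C f) = Ide D (Cod D (Far F f))"
    using assms by (simp_all flip: Far_Cmp)
qed (use assms C.Iso_Ar in auto)

end

lemma cat_functor_iff: "cat_functor C D F \<longleftrightarrow> is_functor C D F"
  by (auto simp: cat_functor_def cat_functor_axioms_def is_functor_def)

lemma is_functorI:
  assumes "category C" "category D"
    and "\<And>A. A \<in> Ob C \<Longrightarrow> Fob F A \<in> Ob D"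
    and "\<And>f. f \<in> Ar C \<Longrightarrow> Far F f \<in> Ar D \<and> Dom D (Far F f) = Fob F (Dom C f) \<and>
                                    Cod D (Far F f) = Fob F (Cod C f)"
    and "\<And>A. A \<in> Ob C \<Longrightarrow> Far F (Ide C A) = Ide D (Fob F A)"
    and "\<And>f g. f \<in> Ar C \<Longrightarrow> g \<in> Ar C \<Longrightarrow> Dom C g = Cod C f \<Longrightarrow>
           Far F (g \<cdot>\<^bsub>C\<^esub> f) = Far F g \<cdot>\<^bsub>D\<^esub> Far F f"
  shows "is_functor C D F"
  using assms by (auto simp: is_functor_def Hom_def)

text \<open>\<open>H\<close> only has to agree with the composite on objects and arrows, so that
  plain composites and suspended composites, which carry a further field, are both covered.\<close>

lemma functor_comp:
  assumes "is_functor C D F" "is_functor D E G"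
    and "\<And>A. Fob H A = Fob G (Fob F A)" "\<And>f. Far H f = Far G (Far F f)"
  shows "is_functor C E H"
proof -
  interpret F: cat_functor C D F using assms(1) by (simp add: cat_functor_iff)
  interpret G: cat_functor D E G using assms(2) by (simp add: cat_functor_iff)
  show ?thesis
    by (rule is_functorI) (use assms in \<open>auto simp: F.C.category_axioms G.D.category_axioms\<close>)
qed

lemma nat_trans_simps:
  assumes "nat_trans C D F G \<rho>"
  shows "\<And>A. A \<in> Ob C \<Longrightarrow> \<rho> A \<in> Ar D"
    and "\<And>A. A \<in> Ob C \<Longrightarrow> Dom D (\<rho> A) = Fob F A"
    and "\<And>A. A \<in> Ob C \<Longrightarrow> Cod D (\<rho> A) = Fob G A"
    and "\<And>f. f \<in> Ar C \<Longrightarrow> \<rho> (Cod C f) \<cdot>\<^bsub>D\<^esub> Far F f = Far G f \<cdot>\<^bsub>D\<^esub> \<rho> (Dom C f)"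
  using assms by (auto simp: nat_trans_def Hom_def)

lemma nat_transI:
  assumes "is_functor C D F" "is_functor C D G"
    and "\<And>A. A \<in> Ob C \<Longrightarrow> \<rho> A \<in> Ar D \<and> Dom D (\<rho> A) = Fob F A \<and> Cod D (\<rho> A) = Fob G A"
    and "\<And>f. f \<in> Ar C \<Longrightarrow> \<rho> (Cod C f) \<cdot>\<^bsub>D\<^esub> Far F f = Far G f \<cdot>\<^bsub>D\<^esub> \<rho> (Dom C f)"
  shows "nat_trans C D F G \<rho>"
  using assms by (auto simp: nat_trans_def Hom_def)

section \<open>Symmetric tensor products\<close>

context sym_tensor
begin

lemma Ten_Ob [simp]: "A \<in> Ob C \<Longrightarrow> E \<in> Ob C \<Longrightarrow> A \<odot> E \<in> Ob C"
  using tensor_functor by (auto simp: is_functor_def)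

lemma TenA_simps [simp]:
  assumes "f \<in> Ar C" "g \<in> Ar C"
  shows "f \<bullet> g \<in> Ar C" "Dom C (f \<bullet> g) = Dom C f \<odot> Dom C g" "Cod C (f \<bullet> g) = Cod C f \<odot> Cod C g"
  using cat_functor.Far_simps[OF tensor_functor[folded cat_functor_iff], of "(f, g)"] assms by auto

lemma TenA_Ide [simp]: "A \<in> Ob C \<Longrightarrow> E \<in> Ob C \<Longrightarrow> Ide C A \<bullet> Ide C E = Ide C (A \<odot> E)"
  using cat_functor.Far_Ide[OF tensor_functor[folded cat_functor_iff], of "(A, E)"] by auto

lemma TenA_Cmp:
  assumes "f \<in> Ar C" "g \<in> Ar C" "Dom C g = Cod C f" "f' \<in> Ar C" "g' \<in> Ar C" "Dom C g' = Cod C f'"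
  shows "(g \<bullet> g') \<cdot> (f \<bullet> f') = (g \<cdot> f) \<bullet> (g' \<cdot> f')"
  using cat_functor.Far_Cmp[OF tensor_functor[folded cat_functor_iff], of "(f, f')" "(g, g')"] assms by auto

lemma Sym_simps [simp]:
  assumes "A \<in> Ob C" "E \<in> Ob C"
  shows "Sym C A E \<in> Ar C" "Dom C (Sym C A E) = A \<odot> E" "Cod C (Sym C A E) = E \<odot> A"
  using Sym_nat_iso assms by (auto simp: nat_iso_def nat_trans_def Hom_def)

lemma Sym_natural:
  assumes "f \<in> Ar C" "g \<in> Ar C"
  shows "Sym C (Cod C f) (Cod C g) \<cdot> (f \<bullet> g) = (g \<bullet> f) \<cdot> Sym C (Dom C f) (Dom C g)"
  using nat_trans_simps(4)[OF Sym_nat_iso[unfolded nat_iso_def, THEN conjunct1], of "(f, g)"] assms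
  by simp

end

section \<open>Internal Hom and transposition through evaluation\<close>

context sym_tensor_closed
begin

lemma IHom_Ob [simp]: "A \<in> Ob C \<Longrightarrow> E \<in> Ob C \<Longrightarrow> IHom C A E \<in> Ob C"
  using IHom_functor by (auto simp: is_functor_def)

lemma IHomA_simps [simp]:
  assumes "f \<in> Ar C" "g \<in> Ar C"
  shows "IHomA C f g \<in> Ar C" "Dom C (IHomA C f g) = IHom C (Cod C f) (Dom C g)"
    "Cod C (IHomA C f g) = IHom C (Dom C f) (Cod C g)"
  using cat_functor.Far_simps[OF IHom_functor[folded cat_functor_iff], of "(f, g)"] assms by auto

lemma IHomA_Ide [simp]: "A \<in> Ob C \<Longrightarrow> E \<in> Ob C \<Longrightarrow> IHomA C (Ide C A) (Ide C E) = Ide C (IHom C A E)"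
  using cat_functor.Far_Ide[OF IHom_functor[folded cat_functor_iff], of "(A, E)"] by auto

lemma IHomA_Cmp:
  assumes "f \<in> Ar C" "g \<in> Ar C" "Dom C g = Cod C f" "f' \<in> Ar C" "g' \<in> Ar C" "Dom C g' = Cod C f'"
  shows "IHomA C f g' \<cdot> IHomA C g f' = IHomA C (g \<cdot> f) (g' \<cdot> f')"
  using cat_functor.Far_Cmp[OF IHom_functor[folded cat_functor_iff], of "(g, f')" "(f, g')"] assms by auto

lemma Coev_Ev_simps [simp]:
  assumes "X \<in> Ob C" "A \<in> Ob C"
  shows "Coev C X A \<in> Ar C" "Dom C (Coev C X A) = A" "Cod C (Coev C X A) = IHom C X (A \<odot> X)"
    "Ev C X A \<in> Ar C" "Dom C (Ev C X A) = IHom C X A \<odot> X" "Cod C (Ev C X A) = A"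
  using tensor_IHom_adjunction[OF assms(1)] assms
  by (auto simp: adjunction_def nat_trans_def Hom_def id_fctr_def comp_fctr_def)

lemma Coev_natural:
  assumes "X \<in> Ob C" "f \<in> Ar C"
  shows "Coev C X (Cod C f) \<cdot> f = IHomA C (Ide C X) (f \<bullet> Ide C X) \<cdot> Coev C X (Dom C f)"
  using nat_trans_simps(4)[OF adjunctionD(3)[OF tensor_IHom_adjunction[OF assms(1)]], of f] assms
  by simp

lemma Ev_natural:
  assumes "X \<in> Ob C" "f \<in> Ar C"
  shows "Ev C X (Cod C f) \<cdot> (IHomA C (Ide C X) f \<bullet> Ide C X) = f \<cdot> Ev C X (Dom C f)"
  using nat_trans_simps(4)[OF adjunctionD(4)[OF tensor_IHom_adjunction[OF assms(1)]], of f] assms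
  by simp

lemma Ev_Coev_triangle:
  assumes "X \<in> Ob C" "A \<in> Ob C"
  shows "Ev C X (A \<odot> X) \<cdot> (Coev C X A \<bullet> Ide C X) = Ide C (A \<odot> X)"
    "IHomA C (Ide C X) (Ev C X A) \<cdot> Coev C X (IHom C X A) = Ide C (IHom C X A)"
  using tensor_IHom_adjunction[OF assms(1)] assms(2) by (auto simp: adjunction_def)

lemma Ev_dinatural_Ar:
  assumes "f \<in> Ar C" "A \<in> Ob C"
  shows "Ev C (Dom C f) A \<cdot> (IHomA C f (Ide C A) \<bullet> Ide C (Dom C f))
    = Ev C (Cod C f) A \<cdot> (Ide C (IHom C (Cod C f) A) \<bullet> f)"
  using Ev_dinatural[of f "Dom C f" "Cod C f" A] assms by (auto simp: Hom_def)

text \<open>Naturality of the coevaluation moves \<open>p\<close> to the right, and a triangle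
  identity removes what remains on its left.\<close>

lemma curry_uncurry:
  assumes "X \<in> Ob C" "p \<in> Ar C" "Cod C p = IHom C X A" "A \<in> Ob C"
  shows "IHomA C (Ide C X) (Ev C X A \<cdot> (p \<bullet> Ide C X)) \<cdot> Coev C X (Dom C p) = p"
proof -
  have "IHomA C (Ide C X) (Ev C X A \<cdot> (p \<bullet> Ide C X)) \<cdot> Coev C X (Dom C p)
      = IHomA C (Ide C X) (Ev C X A) \<cdot> IHomA C (Ide C X) (p \<bullet> Ide C X) \<cdot> Coev C X (Dom C p)"
    using assms IHomA_Cmp[of "Ide C X" "Ide C X" "p \<bullet> Ide C X" "Ev C X A"]
    by (simp flip: Cmp_assoc_Ar)
  also have "\<dots> = IHomA C (Ide C X) (Ev C X A) \<cdot> Coev C X (IHom C X A) \<cdot> p"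
    using assms Coev_natural[of X p] by simp
  also have "\<dots> = p"
    using assms Ev_Coev_triangle by (simp add: Cmp_extend1[OF Ev_Coev_triangle(2)])
  finally show ?thesis .
qed

text \<open>By \<open>curry_uncurry\<close>, \<open>p\<close> and \<open>q\<close> are the same
  expression in their transposes. This is the test for arrows into an internal Hom.\<close>

lemma Ev_eqI:
  assumes "X \<in> Ob C" "A \<in> Ob C" "p \<in> Ar C" "q \<in> Ar C" "Dom C p = Dom C q"
    "Cod C p = IHom C X A" "Cod C q = IHom C X A"
    and "Ev C X A \<cdot> (p \<bullet> Ide C X) = Ev C X A \<cdot> (q \<bullet> Ide C X)"
  shows "p = q"
  using assms curry_uncurry[of X p A] curry_uncurry[of X q A] by metis

lemma TenA_Cmp_left:
  assumes "f \<in> Ar C" "g \<in> Ar C" "Dom C g = Cod C f" "X \<in> Ob C"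
  shows "(g \<cdot> f) \<bullet> Ide C X = (g \<bullet> Ide C X) \<cdot> (f \<bullet> Ide C X)"
  using assms TenA_Cmp[of f g "Ide C X" "Ide C X"] by simp

text \<open>The other half of the bijection: naturality of the evaluation, followed by the other
  triangle identity.\<close>

lemma Ev_curry:
  assumes "X \<in> Ob C" "H \<in> Ob C" "f \<in> Ar C" "Dom C f = H \<odot> X"
  shows "Ev C X (Cod C f) \<cdot> ((IHomA C (Ide C X) f \<cdot> Coev C X H) \<bullet> Ide C X) = f"
proof -
  have "Ev C X (Cod C f) \<cdot> ((IHomA C (Ide C X) f \<cdot> Coev C X H) \<bullet> Ide C X)
      = Ev C X (Cod C f) \<cdot> (IHomA C (Ide C X) f \<bullet> Ide C X) \<cdot> (Coev C X H \<bullet> Ide C X)"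
    using assms by (simp add: TenA_Cmp_left)
  also have "\<dots> = f \<cdot> Ev C X (H \<odot> X) \<cdot> (Coev C X H \<bullet> Ide C X)"
    using assms Cmp_extend[OF Ev_natural, of X f] by simp
  also have "\<dots> = f"
    using assms by (simp add: Ev_Coev_triangle)
  finally show ?thesis .
qed

lemma Ev_postcompose:
  assumes "X \<in> Ob C" "p \<in> Ar C" "f \<in> Ar C" "Cod C p = IHom C X (Dom C f)"
  shows "Ev C X (Cod C f) \<cdot> ((IHomA C (Ide C X) f \<cdot> p) \<bullet> Ide C X)
    = f \<cdot> Ev C X (Dom C f) \<cdot> (p \<bullet> Ide C X)"
  using assms Cmp_extend[OF Ev_natural, of X f] by (simp add: TenA_Cmp_left)

text \<open>Dinaturality trades [f, A] for \<open>f\<close> acting on the second tensor factor,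
  where it commutes with \<open>p\<close> acting on the first. Contravariance thus disappears under
  transposition.\<close>

lemma Ev_precompose:
  assumes "f \<in> Ar C" "A \<in> Ob C" "p \<in> Ar C" "Cod C p = IHom C (Cod C f) A"
  shows "Ev C (Dom C f) A \<cdot> ((IHomA C f (Ide C A) \<cdot> p) \<bullet> Ide C (Dom C f))
    = Ev C (Cod C f) A \<cdot> (p \<bullet> Ide C (Cod C f)) \<cdot> (Ide C (Dom C p) \<bullet> f)"
proof -
  have "Ev C (Dom C f) A \<cdot> ((IHomA C f (Ide C A) \<cdot> p) \<bullet> Ide C (Dom C f))
     = Ev C (Cod C f) A \<cdot> (Ide C (IHom C (Cod C f) A) \<bullet> f) \<cdot> (p \<bullet> Ide C (Dom C f))"
    using assms Cmp_extend[OF Ev_dinatural_Ar, of f A] by (simp add: TenA_Cmp_left)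
  then show ?thesis
    using assms by (simp add: TenA_Cmp)
qed

lemma bidual_simps [simp]:
  assumes "K \<in> Ob C" "A \<in> Ob C"
  shows "bidual C K A \<in> Ar C" "Dom C (bidual C K A) = A"
    "Cod C (bidual C K A) = IHom C (IHom C A K) K"
  using assms by (simp_all add: bidual_def ev_right_def)

text \<open>Biduality is defined by currying \<open>ev_right\<close>, so transposing it back returns
  \<open>ev_right\<close>. Later identities use biduality only in this form.\<close>

lemma Ev_bidual:
  assumes "K \<in> Ob C" "A \<in> Ob C"
  shows "Ev C (IHom C A K) K \<cdot> (bidual C K A \<bullet> Ide C (IHom C A K)) = Ev C A K \<cdot> Sym C A (IHom C A K)"
  using assms Ev_curry[of "IHom C A K" A "ev_right C A K"] by (simp add: bidual_def ev_right_def)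

lemma duality_functor: "K \<in> Ob C \<Longrightarrow> is_functor (opp C) C (duality C K)"
  by (rule is_functorI)
    (auto simp: duality_def category_opp category_axioms IHomA_Cmp)

end

section \<open>Functors compatible with symmetric tensor products\<close>

text \<open>Here \<nu> stands both for the isomorphism \<alpha> of a pull-back and for \<lambda> of
  a push-forward; the latter is not invertible in general, which is why \<nu> is a mere
  morphism.\<close>

locale sym_functor = C: sym_tensor_closed C + D: sym_tensor_closed D + cat_functor C D F
  for C :: "('o, 'm, 'z) smc_scheme" and D :: "('p, 'n, 'y) smc_scheme"
    and F :: "('o, 'm, 'p, 'n, 'x) fctr_scheme" +
  fixes \<nu> :: "'o \<Rightarrow> 'o \<Rightarrow> 'n"
  assumes \<nu>_Hom: "A \<in> Ob C \<Longrightarrow> E \<in> Ob C \<Longrightarrow> \<nu> A E \<in> Hom D (Fob F A \<odot>\<^bsub>D\<^esub> Fob F E) (Fob F (A \<odot>\<^bsub>C\<^esub> E))"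
    and \<nu>_natural: "f \<in> Ar C \<Longrightarrow> g \<in> Ar C \<Longrightarrow>
      \<nu> (Cod C f) (Cod C g) \<cdot>\<^bsub>D\<^esub> (Far F f \<bullet>\<^bsub>D\<^esub> Far F g)
        = Far F (f \<bullet>\<^bsub>C\<^esub> g) \<cdot>\<^bsub>D\<^esub> \<nu> (Dom C f) (Dom C g)"
    and \<nu>_Sym: "A \<in> Ob C \<Longrightarrow> E \<in> Ob C \<Longrightarrow>
      Far F (Sym C A E) \<cdot>\<^bsub>D\<^esub> \<nu> A E = \<nu> E A \<cdot>\<^bsub>D\<^esub> Sym D (Fob F A) (Fob F E)"
begin

lemma \<nu>_simps [simp]:
  assumes "A \<in> Ob C" "E \<in> Ob C"
  shows "\<nu> A E \<in> Ar D" "Dom D (\<nu> A E) = Fob F A \<odot>\<^bsub>D\<^esub> Fob F E" "Cod D (\<nu> A E) = Fob F (A \<odot>\<^bsub>C\<^esub> E)"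
  using \<nu>_Hom[OF assms] by (auto simp: Hom_def)

abbreviation "hc \<equiv> hom_compare C D F \<nu>"

text \<open>Fusing the two factors [FA, -] exhibits the comparison as the curried form of F(ev)
  after \<nu>, to which \<open>D.Ev_curry\<close> applies.\<close>

lemma hom_compare_eq:
  assumes "A \<in> Ob C" "K \<in> Ob C"
  shows "hc A K = IHomA D (Ide D (Fob F A)) (Far F (Ev C A K) \<cdot>\<^bsub>D\<^esub> \<nu> (IHom C A K) A)
    \<cdot>\<^bsub>D\<^esub> Coev D (Fob F A) (Fob F (IHom C A K))"
  using assms D.IHomA_Cmp[of "Ide D (Fob F A)" "Ide D (Fob F A)" "\<nu> (IHom C A K) A" "Far F (Ev C A K)"]
  by (simp add: hom_compare_def flip: D.Cmp_assoc_Ar)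

lemma hom_compare_simps [simp]:
  assumes "A \<in> Ob C" "K \<in> Ob C"
  shows "hc A K \<in> Ar D" "Dom D (hc A K) = Fob F (IHom C A K)"
    "Cod D (hc A K) = IHom D (Fob F A) (Fob F K)"
  using assms by (simp_all add: hom_compare_eq)

lemma Ev_hom_compare:
  assumes "A \<in> Ob C" "K \<in> Ob C"
  shows "Ev D (Fob F A) (Fob F K) \<cdot>\<^bsub>D\<^esub> (hc A K \<bullet>\<^bsub>D\<^esub> Ide D (Fob F A))
    = Far F (Ev C A K) \<cdot>\<^bsub>D\<^esub> \<nu> (IHom C A K) A"
  using assms D.Ev_curry[of "Fob F A" "Fob F (IHom C A K)" "Far F (Ev C A K) \<cdot>\<^bsub>D\<^esub> \<nu> (IHom C A K) A"]
  by (simp add: hom_compare_eq)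

text \<open>Naturality of \<nu> carries \<open>p\<close> inside F: up to \<nu>, the comparison turns
  F of an arrow into F of its transpose.\<close>

lemma Ev_hom_compare_Far:
  assumes "A \<in> Ob C" "K \<in> Ob C" "p \<in> Ar C" "Cod C p = IHom C A K"
  shows "Ev D (Fob F A) (Fob F K) \<cdot>\<^bsub>D\<^esub> ((hc A K \<cdot>\<^bsub>D\<^esub> Far F p) \<bullet>\<^bsub>D\<^esub> Ide D (Fob F A))
    = Far F (Ev C A K \<cdot>\<^bsub>C\<^esub> (p \<bullet>\<^bsub>C\<^esub> Ide C A)) \<cdot>\<^bsub>D\<^esub> \<nu> (Dom C p) A"
  using assms \<nu>_natural[of p "Ide C A"]
  by (simp add: D.TenA_Cmp_left D.Cmp_extend[OF Ev_hom_compare])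

text \<open>Both sides have the transpose F(ev) \<nu> (id \<otimes> Ff): on the left by dinaturality
  of the evaluation in \<open>C\<close> and naturality of \<nu>, on the right by dinaturality in
  \<open>D\<close>.\<close>

lemma hom_compare_natural:
  assumes "f \<in> Ar C" "K \<in> Ob C"
  shows "hc (Dom C f) K \<cdot>\<^bsub>D\<^esub> Far F (IHomA C f (Ide C K))
    = IHomA D (Far F f) (Ide D (Fob F K)) \<cdot>\<^bsub>D\<^esub> hc (Cod C f) K"
proof (rule D.Ev_eqI[of "Fob F (Dom C f)" "Fob F K"])
  let ?A = "Dom C f" and ?E = "Cod C f"
  have "Ev D (Fob F ?A) (Fob F K) \<cdot>\<^bsub>D\<^esub> ((hc ?A K \<cdot>\<^bsub>D\<^esub> Far F (IHomA C f (Ide C K))) \<bullet>\<^bsub>D\<^esub> Ide D (Fob F ?A))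
      = Far F (Ev C ?E K \<cdot>\<^bsub>C\<^esub> (Ide C (IHom C ?E K) \<bullet>\<^bsub>C\<^esub> f)) \<cdot>\<^bsub>D\<^esub> \<nu> (IHom C ?E K) ?A"
    using assms by (simp add: Ev_hom_compare_Far C.Ev_dinatural_Ar del: Far_Cmp)
  also have "\<dots> = Far F (Ev C ?E K) \<cdot>\<^bsub>D\<^esub> \<nu> (IHom C ?E K) ?E \<cdot>\<^bsub>D\<^esub> (Ide D (Fob F (IHom C ?E K)) \<bullet>\<^bsub>D\<^esub> Far F f)"
    using assms \<nu>_natural[of "Ide C (IHom C ?E K)" f] by simp
  also have "\<dots> = Ev D (Fob F ?A) (Fob F K) \<cdot>\<^bsub>D\<^esub>
      ((IHomA D (Far F f) (Ide D (Fob F K)) \<cdot>\<^bsub>D\<^esub> hc ?E K) \<bullet>\<^bsub>D\<^esub> Ide D (Fob F ?A))"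
    using assms D.Ev_precompose[of "Far F f" "Fob F K" "hc ?E K"]
    by (simp add: D.Cmp_extend[OF Ev_hom_compare])
  finally show "Ev D (Fob F ?A) (Fob F K) \<cdot>\<^bsub>D\<^esub> ((hc ?A K \<cdot>\<^bsub>D\<^esub> Far F (IHomA C f (Ide C K))) \<bullet>\<^bsub>D\<^esub> Ide D (Fob F ?A))
    = Ev D (Fob F ?A) (Fob F K) \<cdot>\<^bsub>D\<^esub>
      ((IHomA D (Far F f) (Ide D (Fob F K)) \<cdot>\<^bsub>D\<^esub> hc ?E K) \<bullet>\<^bsub>D\<^esub> Ide D (Fob F ?A))" .
qed (use assms in simp_all)

text \<open>Both sides have the transpose F(ev) \<nu> s. On the left the symmetry first appears as
  F(s), and \<open>\<nu>_Sym\<close> moves it past \<nu>; on the right it comes from the biduality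
  in \<open>D\<close> and is moved past the comparison by its naturality.\<close>

lemma hom_compare_bidual:
  assumes "A \<in> Ob C" "K \<in> Ob C"
  shows "hc (IHom C A K) K \<cdot>\<^bsub>D\<^esub> Far F (bidual C K A)
    = IHomA D (hc A K) (Ide D (Fob F K)) \<cdot>\<^bsub>D\<^esub> bidual D (Fob F K) (Fob F A)"
proof (rule D.Ev_eqI[of "Fob F (IHom C A K)" "Fob F K"])
  let ?I = "IHom C A K" and ?FI = "Fob F (IHom C A K)" and ?FA = "Fob F A" and ?FK = "Fob F K"
  have "Ev D ?FI ?FK \<cdot>\<^bsub>D\<^esub> ((hc ?I K \<cdot>\<^bsub>D\<^esub> Far F (bidual C K A)) \<bullet>\<^bsub>D\<^esub> Ide D ?FI)
      = Far F (Ev C A K) \<cdot>\<^bsub>D\<^esub> \<nu> ?I A \<cdot>\<^bsub>D\<^esub> Sym D ?FA ?FI"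
    using assms \<nu>_Sym[of A ?I] by (simp add: Ev_hom_compare_Far C.Ev_bidual del: Far_Cmp) simp
  also have "\<dots> = Ev D ?FA ?FK \<cdot>\<^bsub>D\<^esub> (hc A K \<bullet>\<^bsub>D\<^esub> Ide D ?FA) \<cdot>\<^bsub>D\<^esub> Sym D ?FA ?FI"
    using assms by (simp add: D.Cmp_extend[OF Ev_hom_compare])
  also have "\<dots> = Ev D ?FA ?FK \<cdot>\<^bsub>D\<^esub> Sym D ?FA (IHom D ?FA ?FK) \<cdot>\<^bsub>D\<^esub> (Ide D ?FA \<bullet>\<^bsub>D\<^esub> hc A K)"
    using assms D.Sym_natural[of "Ide D ?FA" "hc A K"] by simp
  also have "\<dots> = Ev D ?FI ?FK \<cdot>\<^bsub>D\<^esub>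
      ((IHomA D (hc A K) (Ide D ?FK) \<cdot>\<^bsub>D\<^esub> bidual D ?FK ?FA) \<bullet>\<^bsub>D\<^esub> Ide D ?FI)"
    using assms D.Ev_precompose[of "hc A K" ?FK "bidual D ?FK ?FA"]
    by (simp add: D.Cmp_extend[OF D.Ev_bidual])
  finally show "Ev D ?FI ?FK \<cdot>\<^bsub>D\<^esub> ((hc ?I K \<cdot>\<^bsub>D\<^esub> Far F (bidual C K A)) \<bullet>\<^bsub>D\<^esub> Ide D ?FI)
    = Ev D ?FI ?FK \<cdot>\<^bsub>D\<^esub> ((IHomA D (hc A K) (Ide D ?FK) \<cdot>\<^bsub>D\<^esub> bidual D ?FK ?FA) \<bullet>\<^bsub>D\<^esub> Ide D ?FI)" .
qed (use assms in simp_all)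

end

section \<open>Suspended and duality preserving functors\<close>

lemma duality_simps [simp]:
  "Fob (duality C K) A = IHom C A K" "Far (duality C K) f = IHomA C f (Ide C K)"
  by (simp_all add: duality_def)

lemma comp_sfctr_simps [simp]:
  "Fob (comp_sfctr D G F) A = Fob G (Fob F A)" "Far (comp_sfctr D G F) f = Far G (Far F f)"
  "Theta (comp_sfctr D G F) A = Theta G (Fob F A) \<cdot>\<^bsub>D\<^esub> Far G (Theta F A)"
  by (simp_all add: comp_sfctr_def)

lemma id_sfctr_simps [simp]:
  "Fob (id_sfctr C) A = A" "Far (id_sfctr C) f = f" "Theta (id_sfctr C) A = Ide C (Fob (Sus C) A)"
  by (simp_all add: id_sfctr_def)

lemma (in category) functor_id_like:
  assumes "\<And>A. Fob F A = A" "\<And>f. Far F f = f"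
  shows "is_functor C C F"
  by (rule is_functorI) (use assms category_axioms in auto)

lemma is_functor_opp:
  assumes "is_functor C D F"
  shows "is_functor (opp C) (opp D) F"
proof -
  interpret cat_functor C D F using assms by (simp add: cat_functor_iff)
  show ?thesis
    by (rule is_functorI) (simp_all add: C.category_opp D.category_opp)
qed

text \<open>Naturality of \<phi> is over the opposite category, which accounts for the exchanged
  roles of \<open>Dom\<close> and \<open>Cod\<close> in \<open>natural\<close>.\<close>

lemma dp_functorI:
  assumes C: "sym_tensor_closed C" and D: "sym_tensor_closed D" and KM: "K \<in> Ob C" "M \<in> Ob D"
    and F: "is_functor C D F" and "k \<noteq> Plain \<Longrightarrow> suspended_functor C D F"
    and simps: "\<And>A. A \<in> Ob C \<Longrightarrow> \<phi> A \<in> Ar D \<and> Dom D (\<phi> A) = Fob F (IHom C A K) \<and>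
                                     Cod D (\<phi> A) = IHom D (Fob F A) M"
    and natural: "\<And>f. f \<in> Ar C \<Longrightarrow> \<phi> (Dom C f) \<cdot>\<^bsub>D\<^esub> Far F (IHomA C f (Ide C K))
        = IHomA D (Far F f) (Ide D M) \<cdot>\<^bsub>D\<^esub> \<phi> (Cod C f)"
    and bidual: "\<And>A. A \<in> Ob C \<Longrightarrow> \<phi> (IHom C A K) \<cdot>\<^bsub>D\<^esub> Far F (bidual C K A)
        = IHomA D (\<phi> A) (Ide D M) \<cdot>\<^bsub>D\<^esub> bidual D M (Fob F A)"
  shows "dp_functor k (with_duality C K) (with_duality D M) (F, \<phi>)"
proof -
  interpret C: sym_tensor_closed C by fact
  interpret D: sym_tensor_closed D by fact
  have "is_functor (opp C) D (F \<circ>\<^sub>F duality C K)"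
    by (rule functor_comp[OF C.duality_functor F]) (use KM in auto)
  moreover have "is_functor (opp C) D (duality D M \<circ>\<^sub>F F)"
    by (rule functor_comp[OF is_functor_opp[OF F] D.duality_functor]) (use KM in auto)
  ultimately have "nat_trans (opp C) D (F \<circ>\<^sub>F duality C K) (duality D M \<circ>\<^sub>F F) \<phi>"
    by (rule nat_transI) (use simps natural in auto)
  with assms show ?thesis
    by (simp add: with_duality_def)
qed

lemma dp_functorD:
  assumes "dp_functor k (with_duality C K) (with_duality D M) (F, \<phi>)"
  shows "is_functor C D F" "k \<noteq> Plain \<Longrightarrow> suspended_functor C D F"
    "\<And>A. A \<in> Ob C \<Longrightarrow> \<phi> A \<in> Ar D"
    "\<And>A. A \<in> Ob C \<Longrightarrow> Dom D (\<phi> A) = Fob F (IHom C A K)"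
    "\<And>A. A \<in> Ob C \<Longrightarrow> Cod D (\<phi> A) = IHom D (Fob F A) M"
    "\<And>f. f \<in> Ar C \<Longrightarrow> \<phi> (Dom C f) \<cdot>\<^bsub>D\<^esub> Far F (IHomA C f (Ide C K))
        = IHomA D (Far F f) (Ide D M) \<cdot>\<^bsub>D\<^esub> \<phi> (Cod C f)"
    "\<And>A. A \<in> Ob C \<Longrightarrow> \<phi> (IHom C A K) \<cdot>\<^bsub>D\<^esub> Far F (bidual C K A)
        = IHomA D (\<phi> A) (Ide D M) \<cdot>\<^bsub>D\<^esub> bidual D M (Fob F A)"
proof -
  have nt: "nat_trans (opp C) D (F \<circ>\<^sub>F duality C K) (duality D M \<circ>\<^sub>F F) \<phi>"
    using assms by (simp add: with_duality_def)
  show "\<And>A. A \<in> Ob C \<Longrightarrow> \<phi> A \<in> Ar D" "\<And>A. A \<in> Ob C \<Longrightarrow> Dom D (\<phi> A) = Fob F (IHom C A K)"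
    "\<And>A. A \<in> Ob C \<Longrightarrow> Cod D (\<phi> A) = IHom D (Fob F A) M"
    "\<And>f. f \<in> Ar C \<Longrightarrow> \<phi> (Dom C f) \<cdot>\<^bsub>D\<^esub> Far F (IHomA C f (Ide C K))
        = IHomA D (Far F f) (Ide D M) \<cdot>\<^bsub>D\<^esub> \<phi> (Cod C f)"
    using nat_trans_simps[OF nt] by simp_all
qed (use assms in \<open>simp_all add: with_duality_def\<close>)

lemma suspended_functorI:
  assumes "is_functor C C (Sus C)" "is_functor D D (Sus D)" "is_functor C D F"
    and "\<And>A. A \<in> Ob C \<Longrightarrow> Theta F A \<in> Ar D \<and> Dom D (Theta F A) = Fob F (Fob (Sus C) A) \<and>
                                    Cod D (Theta F A) = Fob (Sus D) (Fob F A)"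
    and "\<And>f. f \<in> Ar C \<Longrightarrow> Theta F (Cod C f) \<cdot>\<^bsub>D\<^esub> Far F (Far (Sus C) f)
                            = Far (Sus D) (Far F f) \<cdot>\<^bsub>D\<^esub> Theta F (Dom C f)"
    and "\<And>A. A \<in> Ob C \<Longrightarrow> Iso D (Theta F A)"
  shows "suspended_functor C D F"
proof -
  have "is_functor C D (F \<circ>\<^sub>F Sus C)" "is_functor C D (Sus D \<circ>\<^sub>F F)"
    by (rule functor_comp[OF assms(1,3)] functor_comp[OF assms(3,2)]; simp)+
  then have "nat_trans C D (F \<circ>\<^sub>F Sus C) (Sus D \<circ>\<^sub>F F) (Theta F)"
    by (rule nat_transI) (use assms in simp_all)
  with assms show ?thesis
    by (simp add: suspended_functor_def nat_iso_def)
qed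

lemma suspended_functorD:
  assumes "suspended_functor C D F"
  shows "is_functor C D F"
    "\<And>A. A \<in> Ob C \<Longrightarrow> Theta F A \<in> Ar D"
    "\<And>A. A \<in> Ob C \<Longrightarrow> Dom D (Theta F A) = Fob F (Fob (Sus C) A)"
    "\<And>A. A \<in> Ob C \<Longrightarrow> Cod D (Theta F A) = Fob (Sus D) (Fob F A)"
    "\<And>f. f \<in> Ar C \<Longrightarrow> Theta F (Cod C f) \<cdot>\<^bsub>D\<^esub> Far F (Far (Sus C) f)
                            = Far (Sus D) (Far F f) \<cdot>\<^bsub>D\<^esub> Theta F (Dom C f)"
    "\<And>A. A \<in> Ob C \<Longrightarrow> Iso D (Theta F A)"
proof -
  have nt: "nat_trans C D (F \<circ>\<^sub>F Sus C) (Sus D \<circ>\<^sub>F F) (Theta F)"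
    using assms by (simp add: suspended_functor_def nat_iso_def)
  show "\<And>A. A \<in> Ob C \<Longrightarrow> Theta F A \<in> Ar D"
    "\<And>A. A \<in> Ob C \<Longrightarrow> Dom D (Theta F A) = Fob F (Fob (Sus C) A)"
    "\<And>A. A \<in> Ob C \<Longrightarrow> Cod D (Theta F A) = Fob (Sus D) (Fob F A)"
    "\<And>f. f \<in> Ar C \<Longrightarrow> Theta F (Cod C f) \<cdot>\<^bsub>D\<^esub> Far F (Far (Sus C) f)
                            = Far (Sus D) (Far F f) \<cdot>\<^bsub>D\<^esub> Theta F (Dom C f)"
    using nat_trans_simps[OF nt] by simp_all
qed (use assms in \<open>auto simp: suspended_functor_def nat_iso_def\<close>)

lemma suspended_functor_id:
  assumes "suspended C"
  shows "suspended_functor C C (id_sfctr C)"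
proof -
  interpret suspended C by fact
  interpret T: cat_functor C C "Sus C" by (simp add: cat_functor_iff Sus_functor)
  show ?thesis
    by (rule suspended_functorI)
      (auto simp: Sus_functor functor_id_like Iso_Ide)
qed

text \<open>The naturality square of the composite \<open>Theta\<close> is pasted from the image
  under G of the square of F and from the square of G at Ff.\<close>

lemma suspended_functor_comp:
  assumes "suspended_functor C D F" "suspended_functor D E G"
    and "suspended C" "suspended D" "suspended E"
  shows "suspended_functor C E (comp_sfctr E G F)"
proof -
  interpret C: suspended C by fact
  interpret D: suspended D by fact
  interpret E: suspended E by fact
  interpret TC: cat_functor C C "Sus C" by (simp add: cat_functor_iff C.Sus_functor)
  interpret TD: cat_functor D D "Sus D" by (simp add: cat_functor_iff D.Sus_functor)
  interpret TE: cat_functor E E "Sus E" by (simp add: cat_functor_iff E.Sus_functor)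
  note F = suspended_functorD[OF assms(1)] and G = suspended_functorD[OF assms(2)]
  interpret F: cat_functor C D F using F by (simp add: cat_functor_iff)
  interpret G: cat_functor D E G using G by (simp add: cat_functor_iff)
  show ?thesis
  proof (rule suspended_functorI)
    fix f assume "f \<in> Ar C"
    then show "Theta (comp_sfctr E G F) (Cod C f) \<cdot>\<^bsub>E\<^esub> Far (comp_sfctr E G F) (Far (Sus C) f)
      = Far (Sus E) (Far (comp_sfctr E G F) f) \<cdot>\<^bsub>E\<^esub> Theta (comp_sfctr E G F) (Dom C f)"
      using G.Far_square[OF F(5), of f] E.Cmp_extend[OF G(5), of "Far F f" "Far G (Theta F (Dom C f))"]
      by (simp add: F(2-4) G(2-4))
  next
    fix A assume "A \<in> Ob C"
    then show "Iso E (Theta (comp_sfctr E G F) A)"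
      by (simp add: F(2-4,6) G(2-4,6) E.Iso_Cmp G.Iso_Far)
  next
    show "is_functor C E (comp_sfctr E G F)"
      by (rule functor_comp[OF F(1) G(1)]) simp_all
  qed (use C.Sus_functor E.Sus_functor in \<open>auto simp: F(2-4) G(2-4)\<close>)
qed

text \<open>Naturality is again a pasting of squares. Compatibility with biduality uses the
  condition for F under G, then naturality of \<psi>, then the condition for G.\<close>

lemma dp_functor_comp:
  assumes C: "sym_tensor_closed C" and D: "sym_tensor_closed D" and E: "sym_tensor_closed E"
    and Ob: "K \<in> Ob C" "M \<in> Ob D" "N \<in> Ob E"
    and s: "k \<noteq> Plain \<Longrightarrow> suspended C \<and> suspended D \<and> suspended E"
    and F: "dp_functor k (with_duality C K) (with_duality D M) (F, \<phi>)"
    and G: "dp_functor k (with_duality D M) (with_duality E N) (G, \<psi>)"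
  shows "dp_functor k (with_duality C K) (with_duality E N) (dp_comp E (G, \<psi>) (F, \<phi>))"
proof -
  interpret C: sym_tensor_closed C by fact
  interpret D: sym_tensor_closed D by fact
  interpret E: sym_tensor_closed E by fact
  note F = dp_functorD[OF F] and G = dp_functorD[OF G]
  interpret F: cat_functor C D F using F by (simp add: cat_functor_iff)
  interpret G: cat_functor D E G using G by (simp add: cat_functor_iff)
  let ?\<chi> = "\<lambda>A. \<psi> (Fob F A) \<cdot>\<^bsub>E\<^esub> Far G (\<phi> A)"
  have "dp_functor k (with_duality C K) (with_duality E N) (comp_sfctr E G F, ?\<chi>)"
  proof (rule dp_functorI)
    fix f assume f: "f \<in> Ar C"
    have "?\<chi> (Dom C f) \<cdot>\<^bsub>E\<^esub> Far G (Far F (IHomA C f (Ide C K)))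
      = \<psi> (Fob F (Dom C f)) \<cdot>\<^bsub>E\<^esub> Far G (IHomA D (Far F f) (Ide D M)) \<cdot>\<^bsub>E\<^esub> Far G (\<phi> (Cod C f))"
      using f G.Far_square[OF F(6), of f] by (simp add: F(3-5) G(3-5) Ob)
    also have "\<dots> = IHomA E (Far G (Far F f)) (Ide E N) \<cdot>\<^bsub>E\<^esub> ?\<chi> (Cod C f)"
      using f E.Cmp_extend[OF G(6), of "Far F f" "Far G (\<phi> (Cod C f))"] by (simp add: F(3-5) G(3-5) Ob)
    finally show "?\<chi> (Dom C f) \<cdot>\<^bsub>E\<^esub> Far (comp_sfctr E G F) (IHomA C f (Ide C K))
      = IHomA E (Far (comp_sfctr E G F) f) (Ide E N) \<cdot>\<^bsub>E\<^esub> ?\<chi> (Cod C f)"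
      by simp
  next
    fix A assume A: "A \<in> Ob C"
    have "?\<chi> (IHom C A K) \<cdot>\<^bsub>E\<^esub> Far G (Far F (bidual C K A))
      = \<psi> (Fob F (IHom C A K)) \<cdot>\<^bsub>E\<^esub> Far G (IHomA D (\<phi> A) (Ide D M)) \<cdot>\<^bsub>E\<^esub> Far G (bidual D M (Fob F A))"
      using A G.Far_square[OF F(7), of A] by (simp add: F(3-5) G(3-5) Ob)
    \<comment> \<open>Naturality of \<psi> is applied to the structure arrow \<open>\<phi> A\<close>
      itself; this lets the condition for G act at FA.\<close>
    also have "\<dots> = IHomA E (Far G (\<phi> A)) (Ide E N) \<cdot>\<^bsub>E\<^esub> \<psi> (IHom D (Fob F A) M)
        \<cdot>\<^bsub>E\<^esub> Far G (bidual D M (Fob F A))"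
      using A E.Cmp_extend[OF G(6), of "\<phi> A" "Far G (bidual D M (Fob F A))"]
      by (simp add: F(3-5) G(3-5) Ob)
    also have "\<dots> = IHomA E (Far G (\<phi> A)) (Ide E N) \<cdot>\<^bsub>E\<^esub> IHomA E (\<psi> (Fob F A)) (Ide E N)
        \<cdot>\<^bsub>E\<^esub> bidual E N (Fob G (Fob F A))"
      using A by (simp add: G(7))
    also have "\<dots> = IHomA E (?\<chi> A) (Ide E N) \<cdot>\<^bsub>E\<^esub> bidual E N (Fob G (Fob F A))"
      using A E.IHomA_Cmp[of "Far G (\<phi> A)" "\<psi> (Fob F A)" "Ide E N" "Ide E N"]
      by (simp add: F(3-5) G(3-5) Ob flip: E.Cmp_assoc_Ar)
    finally show "?\<chi> (IHom C A K) \<cdot>\<^bsub>E\<^esub> Far (comp_sfctr E G F) (bidual C K A)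
      = IHomA E (?\<chi> A) (Ide E N) \<cdot>\<^bsub>E\<^esub> bidual E N (Fob (comp_sfctr E G F) A)"
      by simp
  next
    show "is_functor C E (comp_sfctr E G F)"
      by (rule functor_comp[OF F(1) G(1)]) simp_all
  qed (use F G Ob s C E in \<open>auto intro: suspended_functor_comp\<close>)
  then show ?thesis
    by simp
qed

text \<open>Naturality is bifunctoriality of the internal Hom. For biduality, both transposes equal
  \<iota> ev s, since naturality of the evaluation moves \<iota> from outside ev to the first factor
  inside.\<close>

lemma dp_functor_change:
  assumes C: "sym_tensor_closed C" and s: "k \<noteq> Plain \<Longrightarrow> suspended C" and \<iota>: "\<iota> \<in> Hom C K M"
  shows "dp_functor k (with_duality C K) (with_duality C M) (dp_change C \<iota>)"
proof -
  interpret C: sym_tensor_closed C by fact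
  have \<iota>: "\<iota> \<in> Ar C" "Dom C \<iota> = K" "Cod C \<iota> = M" and KM: "K \<in> Ob C" "M \<in> Ob C"
    using \<iota> by (auto simp: Hom_def)
  have "dp_functor k (with_duality C K) (with_duality C M) (id_sfctr C, \<lambda>A. IHomA C (Ide C A) \<iota>)"
  proof (rule dp_functorI)
    fix A assume A: "A \<in> Ob C"
    let ?I = "IHom C A K" and ?J = "IHom C A M" and ?i = "IHomA C (Ide C A) \<iota>"
    have "IHomA C (Ide C ?I) \<iota> \<cdot>\<^bsub>C\<^esub> bidual C K A = IHomA C ?i (Ide C M) \<cdot>\<^bsub>C\<^esub> bidual C M A"
    proof (rule C.Ev_eqI[of ?I M])
      have "Ev C ?I M \<cdot>\<^bsub>C\<^esub> ((IHomA C (Ide C ?I) \<iota> \<cdot>\<^bsub>C\<^esub> bidual C K A) \<bullet>\<^bsub>C\<^esub> Ide C ?I)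
          = \<iota> \<cdot>\<^bsub>C\<^esub> Ev C A K \<cdot>\<^bsub>C\<^esub> Sym C A ?I"
        using A \<iota> KM C.Ev_postcompose[of ?I "bidual C K A" \<iota>] by (simp add: C.Ev_bidual)
      also have "\<dots> = Ev C A M \<cdot>\<^bsub>C\<^esub> (?i \<bullet>\<^bsub>C\<^esub> Ide C A) \<cdot>\<^bsub>C\<^esub> Sym C A ?I"
        using A \<iota> KM C.Cmp_extend[OF C.Ev_natural, of A \<iota> "Sym C A ?I"] by simp
      also have "\<dots> = Ev C A M \<cdot>\<^bsub>C\<^esub> Sym C A ?J \<cdot>\<^bsub>C\<^esub> (Ide C A \<bullet>\<^bsub>C\<^esub> ?i)"
        using A \<iota> KM C.Sym_natural[of "Ide C A" ?i] by simp
      also have "\<dots> = Ev C ?I M \<cdot>\<^bsub>C\<^esub> ((IHomA C ?i (Ide C M) \<cdot>\<^bsub>C\<^esub> bidual C M A) \<bullet>\<^bsub>C\<^esub> Ide C ?I)"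
        using A \<iota> KM C.Ev_precompose[of ?i M "bidual C M A"]
        by (simp add: C.Cmp_extend[OF C.Ev_bidual])
      finally show "Ev C ?I M \<cdot>\<^bsub>C\<^esub> ((IHomA C (Ide C ?I) \<iota> \<cdot>\<^bsub>C\<^esub> bidual C K A) \<bullet>\<^bsub>C\<^esub> Ide C ?I)
        = Ev C ?I M \<cdot>\<^bsub>C\<^esub> ((IHomA C ?i (Ide C M) \<cdot>\<^bsub>C\<^esub> bidual C M A) \<bullet>\<^bsub>C\<^esub> Ide C ?I)" .
    qed (use A \<iota> KM in simp_all)
    then show "IHomA C (Ide C ?I) \<iota> \<cdot>\<^bsub>C\<^esub> Far (id_sfctr C) (bidual C K A)
        = IHomA C ?i (Ide C M) \<cdot>\<^bsub>C\<^esub> bidual C M (Fob (id_sfctr C) A)"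
      by simp
  qed (use C \<iota> KM s in \<open>auto simp: C.functor_id_like C.IHomA_Cmp suspended_functor_id\<close>)
  then show ?thesis
    by (simp add: dp_change_def)
qed

section \<open>Push-forward and base change\<close>

text \<open>Serves both adjunctions of a morphism h: h^* \<stileturn> h_*, where the tensor
  structure is added later, and h_* \<stileturn> h^!.\<close>

locale adjoint_pair = C: category C + D: category D + cat_functor C D F
  for C :: "('o, 'm, 'z) cat_scheme" and D :: "('p, 'n, 'y) cat_scheme"
    and F :: "('o, 'm, 'p, 'n, 'x) fctr_scheme" +
  fixes G :: "('p, 'n, 'o, 'm, 'w) fctr_scheme" and \<eta> :: "'o \<Rightarrow> 'm" and e :: "'p \<Rightarrow> 'n"
  assumes adjunction: "adjunction C D F G \<eta> e"
begin

sublocale G: cat_functor D C G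
  using adjunctionD(2)[OF adjunction] by (simp add: cat_functor_iff)

lemma unit_simps [simp]:
  assumes "A \<in> Ob C"
  shows "\<eta> A \<in> Ar C" "Dom C (\<eta> A) = A" "Cod C (\<eta> A) = Fob G (Fob F A)"
  using nat_trans_simps(1-3)[OF adjunctionD(3)[OF adjunction] assms] by simp_all

lemma counit_simps [simp]:
  assumes "A \<in> Ob D"
  shows "e A \<in> Ar D" "Dom D (e A) = Fob F (Fob G A)" "Cod D (e A) = A"
  using nat_trans_simps(1-3)[OF adjunctionD(4)[OF adjunction] assms] by simp_all

lemma unit_natural: "f \<in> Ar C \<Longrightarrow> \<eta> (Cod C f) \<cdot>\<^bsub>C\<^esub> f = Far G (Far F f) \<cdot>\<^bsub>C\<^esub> \<eta> (Dom C f)"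
  using nat_trans_simps(4)[OF adjunctionD(3)[OF adjunction], of f] by simp

lemma counit_natural: "f \<in> Ar D \<Longrightarrow> e (Cod D f) \<cdot>\<^bsub>D\<^esub> Far F (Far G f) = f \<cdot>\<^bsub>D\<^esub> e (Dom D f)"
  using nat_trans_simps(4)[OF adjunctionD(4)[OF adjunction], of f] by simp

lemma transpose:
  assumes "H \<in> Ob C" "f \<in> Ar D" "Dom D f = Fob F H"
  shows "e (Cod D f) \<cdot>\<^bsub>D\<^esub> Far F (Far G f \<cdot>\<^bsub>C\<^esub> \<eta> H) = f"
  using assms D.Cmp_extend[OF counit_natural, of f "Far F (\<eta> H)"] adjunctionD(5)[OF adjunction, of H]
  by simp

text \<open>Naturality of the unit and a triangle identity recover every arrow r into GE from its
  transpose as G(e Fr) \<eta>. This is the test for arrows into a push-forward.\<close>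

lemma transpose_eqI:
  assumes "p \<in> Ar C" "q \<in> Ar C" "Dom C p = Dom C q" "Cod C p = Fob G E" "Cod C q = Fob G E" "E \<in> Ob D"
    and eq: "e E \<cdot>\<^bsub>D\<^esub> Far F p = e E \<cdot>\<^bsub>D\<^esub> Far F q"
  shows "p = q"
proof -
  have "Far G (e E \<cdot>\<^bsub>D\<^esub> Far F r) \<cdot>\<^bsub>C\<^esub> \<eta> (Dom C r) = r" if "r \<in> Ar C" "Cod C r = Fob G E" for r
    using that assms(6) unit_natural[of r] C.Cmp_extend1[OF adjunctionD(6)[OF adjunction], of E r]
    by simp
  from this[of p] this[of q] show ?thesis
    using assms by metis
qed

end

section \<open>The lax tensor structure of a right adjoint\<close>

locale sym_adjunction = sym_functor C D F \<alpha> + adjoint_pair C D F G \<eta> e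
  for C :: "('o, 'm, 'z) smc_scheme" and D :: "('p, 'n, 'y) smc_scheme"
    and F :: "('o, 'm, 'p, 'n, 'x) fctr_scheme" and \<alpha> :: "'o \<Rightarrow> 'o \<Rightarrow> 'n"
    and G :: "('p, 'n, 'o, 'm, 'w) fctr_scheme" and \<eta> :: "'o \<Rightarrow> 'm" and e :: "'p \<Rightarrow> 'n" +
  assumes \<alpha>_Iso: "A \<in> Ob C \<Longrightarrow> E \<in> Ob C \<Longrightarrow> Iso D (\<alpha> A E)"
begin

text \<open>The mate of the inverse of \<alpha>: a right adjoint of a functor with invertible tensor
  comparison has a comparison in the same direction as \<alpha>, in general not invertible.\<close>

definition lam :: "'p \<Rightarrow> 'p \<Rightarrow> 'm" where
  "lam A E = Far G (e A \<bullet>\<^bsub>D\<^esub> e E) \<cdot>\<^bsub>C\<^esub> Far G (Invr D (\<alpha> (Fob G A) (Fob G E)))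
    \<cdot>\<^bsub>C\<^esub> \<eta> (Fob G A \<odot>\<^bsub>C\<^esub> Fob G E)"

lemma lam_simps [simp]:
  assumes "A \<in> Ob D" "E \<in> Ob D"
  shows "lam A E \<in> Ar C" "Dom C (lam A E) = Fob G A \<odot>\<^bsub>C\<^esub> Fob G E"
    "Cod C (lam A E) = Fob G (A \<odot>\<^bsub>D\<^esub> E)"
  using assms by (simp_all add: lam_def \<alpha>_Iso)

lemma lam_transpose:
  assumes "A \<in> Ob D" "E \<in> Ob D"
  shows "e (A \<odot>\<^bsub>D\<^esub> E) \<cdot>\<^bsub>D\<^esub> Far F (lam A E)
    = (e A \<bullet>\<^bsub>D\<^esub> e E) \<cdot>\<^bsub>D\<^esub> Invr D (\<alpha> (Fob G A) (Fob G E))"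
  using assms transpose[of "Fob G A \<odot>\<^bsub>C\<^esub> Fob G E"
      "(e A \<bullet>\<^bsub>D\<^esub> e E) \<cdot>\<^bsub>D\<^esub> Invr D (\<alpha> (Fob G A) (Fob G E))"]
  by (simp add: lam_def \<alpha>_Iso)

text \<open>Precomposing the transpose with \<alpha> clears the inverse. In this form \<lambda>
  enters all the arguments below.\<close>

lemma lam_transpose_\<alpha>:
  assumes "A \<in> Ob D" "E \<in> Ob D"
  shows "e (A \<odot>\<^bsub>D\<^esub> E) \<cdot>\<^bsub>D\<^esub> Far F (lam A E) \<cdot>\<^bsub>D\<^esub> \<alpha> (Fob G A) (Fob G E) = e A \<bullet>\<^bsub>D\<^esub> e E"
  using assms D.Cmp_extend[OF lam_transpose, of A E "\<alpha> (Fob G A) (Fob G E)"] by (simp add: \<alpha>_Iso)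

text \<open>Transposed and precomposed with \<alpha>, both sides become (f \<otimes> g)(e \<otimes>
  e), by naturality of \<alpha> and of the counit; \<alpha> is then cancelled.\<close>

lemma lam_natural:
  assumes "f \<in> Ar D" "g \<in> Ar D"
  shows "lam (Cod D f) (Cod D g) \<cdot>\<^bsub>C\<^esub> (Far G f \<bullet>\<^bsub>C\<^esub> Far G g)
    = Far G (f \<bullet>\<^bsub>D\<^esub> g) \<cdot>\<^bsub>C\<^esub> lam (Dom D f) (Dom D g)" (is "?p = ?q")
proof (rule transpose_eqI[of _ _ "Cod D f \<odot>\<^bsub>D\<^esub> Cod D g"])
  let ?e = "e (Cod D f \<odot>\<^bsub>D\<^esub> Cod D g)" and ?\<alpha> = "\<alpha> (Fob G (Dom D f)) (Fob G (Dom D g))"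
  have "(?e \<cdot>\<^bsub>D\<^esub> Far F ?p) \<cdot>\<^bsub>D\<^esub> ?\<alpha>
      = ?e \<cdot>\<^bsub>D\<^esub> Far F (lam (Cod D f) (Cod D g)) \<cdot>\<^bsub>D\<^esub> \<alpha> (Fob G (Cod D f)) (Fob G (Cod D g))
        \<cdot>\<^bsub>D\<^esub> (Far F (Far G f) \<bullet>\<^bsub>D\<^esub> Far F (Far G g))"
    using assms \<nu>_natural[of "Far G f" "Far G g"] by simp
  also have "\<dots> = (e (Cod D f) \<bullet>\<^bsub>D\<^esub> e (Cod D g)) \<cdot>\<^bsub>D\<^esub> (Far F (Far G f) \<bullet>\<^bsub>D\<^esub> Far F (Far G g))"
    using assms lam_transpose_\<alpha>[of "Cod D f" "Cod D g"] by (simp flip: D.Cmp_assoc_Ar)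
  also have "\<dots> = (f \<bullet>\<^bsub>D\<^esub> g) \<cdot>\<^bsub>D\<^esub> (e (Dom D f) \<bullet>\<^bsub>D\<^esub> e (Dom D g))"
    using assms by (simp add: D.TenA_Cmp counit_natural)
  also have "\<dots> = (?e \<cdot>\<^bsub>D\<^esub> Far F ?q) \<cdot>\<^bsub>D\<^esub> ?\<alpha>"
    using assms lam_transpose_\<alpha>[of "Dom D f" "Dom D g"]
      D.Cmp_extend[OF counit_natural, of "f \<bullet>\<^bsub>D\<^esub> g" "Far F (lam (Dom D f) (Dom D g)) \<cdot>\<^bsub>D\<^esub> ?\<alpha>"]
    by simp
  finally show "?e \<cdot>\<^bsub>D\<^esub> Far F ?p = ?e \<cdot>\<^bsub>D\<^esub> Far F ?q"
    by (rule D.Iso_epi[of ?\<alpha>, rotated -1]) (use assms in \<open>simp_all add: \<alpha>_Iso\<close>)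
qed (use assms in simp_all)

text \<open>Same method: both sides reduce to s (e \<otimes> e), once through naturality of the
  counit at s, once through compatibility of \<alpha> with s.\<close>

lemma lam_Sym:
  assumes "A \<in> Ob D" "E \<in> Ob D"
  shows "Far G (Sym D A E) \<cdot>\<^bsub>C\<^esub> lam A E = lam E A \<cdot>\<^bsub>C\<^esub> Sym C (Fob G A) (Fob G E)" (is "?p = ?q")
proof (rule transpose_eqI[of _ _ "E \<odot>\<^bsub>D\<^esub> A"])
  let ?e = "e (E \<odot>\<^bsub>D\<^esub> A)" and ?\<alpha> = "\<alpha> (Fob G A) (Fob G E)"
  have "(?e \<cdot>\<^bsub>D\<^esub> Far F ?p) \<cdot>\<^bsub>D\<^esub> ?\<alpha> = Sym D A E \<cdot>\<^bsub>D\<^esub> (e A \<bullet>\<^bsub>D\<^esub> e E)"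
    using assms lam_transpose_\<alpha>[of A E]
      D.Cmp_extend[OF counit_natural, of "Sym D A E" "Far F (lam A E) \<cdot>\<^bsub>D\<^esub> ?\<alpha>"]
    by simp
  also have "\<dots> = (e E \<bullet>\<^bsub>D\<^esub> e A) \<cdot>\<^bsub>D\<^esub> Sym D (Fob F (Fob G A)) (Fob F (Fob G E))"
    using assms D.Sym_natural[of "e A" "e E"] by simp
  also have "\<dots> = ?e \<cdot>\<^bsub>D\<^esub> Far F (lam E A) \<cdot>\<^bsub>D\<^esub> \<alpha> (Fob G E) (Fob G A)
      \<cdot>\<^bsub>D\<^esub> Sym D (Fob F (Fob G A)) (Fob F (Fob G E))"
    using assms by (simp flip: lam_transpose_\<alpha>)
  also have "\<dots> = (?e \<cdot>\<^bsub>D\<^esub> Far F ?q) \<cdot>\<^bsub>D\<^esub> ?\<alpha>"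
    using assms \<nu>_Sym[of "Fob G A" "Fob G E"] by simp
  finally show "?e \<cdot>\<^bsub>D\<^esub> Far F ?p = ?e \<cdot>\<^bsub>D\<^esub> Far F ?q"
    by (rule D.Iso_epi[of ?\<alpha>, rotated -1]) (use assms in \<open>simp_all add: \<alpha>_Iso\<close>)
qed (use assms in simp_all)

text \<open>Makes the facts about \<open>hom_compare\<close> available for the right adjoint, where
  the comparison is \<mu>.\<close>

sublocale push: sym_functor D C G lam
  by unfold_locales (auto simp: lam_natural lam_Sym Hom_def)

end

text \<open>
  \<open>Ff, Ffb, Fg, Fgb\<close> play the roles of \<open>f\<^sup>*, fb\<^sup>*, g\<^sup>*, gb\<^sup>*\<close>, with tensor structures \<open>af, \<dots>\<close>, for a square
  \<open>f gb = g fb\<close>; \<open>Gg\<close> and \<open>Gb\<close> play those of \<open>g\<^sub>*\<close> and \<open>gb\<^sub>*\<close>.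
\<close>

locale base_change =
  f: sym_functor Z Y Ff af + fb: sym_functor X V Ffb afb +
  g: sym_adjunction Z X Fg ag Gg \<eta>g eg + gb: sym_adjunction Y V Fgb agb Gb \<eta>b eb
  for Z X Y V :: "('o, 'm, 'z) smc_scheme"
    and Ff Ffb Fg Gg Fgb Gb :: "('o, 'm, 'o, 'm, 'x) fctr_scheme"
    and af afb ag agb :: "'o \<Rightarrow> 'o \<Rightarrow> 'm" and \<eta>g eg \<eta>b eb :: "'o \<Rightarrow> 'm" +
  fixes \<xi> :: "'o \<Rightarrow> 'm"
  assumes \<xi>_Hom: "M \<in> Ob Z \<Longrightarrow> \<xi> M \<in> Hom V (Fob Fgb (Fob Ff M)) (Fob Ffb (Fob Fg M))"
    and \<xi>_natural: "m \<in> Ar Z \<Longrightarrow>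
      \<xi> (Cod Z m) \<cdot>\<^bsub>V\<^esub> Far Fgb (Far Ff m) = Far Ffb (Far Fg m) \<cdot>\<^bsub>V\<^esub> \<xi> (Dom Z m)"
    and \<xi>_monoidal: "M \<in> Ob Z \<Longrightarrow> N \<in> Ob Z \<Longrightarrow>
      \<xi> (M \<odot>\<^bsub>Z\<^esub> N) \<cdot>\<^bsub>V\<^esub> Far Fgb (af M N) \<cdot>\<^bsub>V\<^esub> agb (Fob Ff M) (Fob Ff N)
      = Far Ffb (ag M N) \<cdot>\<^bsub>V\<^esub> afb (Fob Fg M) (Fob Fg N) \<cdot>\<^bsub>V\<^esub> (\<xi> M \<bullet>\<^bsub>V\<^esub> \<xi> N)"
begin

lemma \<xi>_simps [simp]:
  assumes "M \<in> Ob Z"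
  shows "\<xi> M \<in> Ar V" "Dom V (\<xi> M) = Fob Fgb (Fob Ff M)" "Cod V (\<xi> M) = Fob Ffb (Fob Fg M)"
  using \<xi>_Hom[OF assms] by (auto simp: Hom_def)

text \<open>The base change morphism \<epsilon>, that is, the mate of \<xi> across the adjunctions
  for g and gb.\<close>

definition bc :: "'o \<Rightarrow> 'm" where
  "bc A = Far Gb (Far Ffb (eg A)) \<cdot>\<^bsub>Y\<^esub> Far Gb (\<xi> (Fob Gg A)) \<cdot>\<^bsub>Y\<^esub> \<eta>b (Fob Ff (Fob Gg A))"

lemma bc_simps [simp]:
  assumes "A \<in> Ob X"
  shows "bc A \<in> Ar Y" "Dom Y (bc A) = Fob Ff (Fob Gg A)" "Cod Y (bc A) = Fob Gb (Fob Ffb A)"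
  using assms by (simp_all add: bc_def)

lemma bc_natural:
  assumes "m \<in> Ar X"
  shows "bc (Cod X m) \<cdot>\<^bsub>Y\<^esub> Far Ff (Far Gg m) = Far Gb (Far Ffb m) \<cdot>\<^bsub>Y\<^esub> bc (Dom X m)"
proof -
  let ?A = "Dom X m" and ?E = "Cod X m"
  have "bc ?E \<cdot>\<^bsub>Y\<^esub> Far Ff (Far Gg m) = Far Gb (Far Ffb (eg ?E) \<cdot>\<^bsub>V\<^esub> \<xi> (Fob Gg ?E) \<cdot>\<^bsub>V\<^esub> Far Fgb (Far Ff (Far Gg m)))
      \<cdot>\<^bsub>Y\<^esub> \<eta>b (Fob Ff (Fob Gg ?A))"
    using assms gb.unit_natural[of "Far Ff (Far Gg m)"] by (simp add: bc_def)
  also have "\<dots> = Far Gb (Far Ffb m \<cdot>\<^bsub>V\<^esub> Far Ffb (eg ?A) \<cdot>\<^bsub>V\<^esub> \<xi> (Fob Gg ?A)) \<cdot>\<^bsub>Y\<^esub> \<eta>b (Fob Ff (Fob Gg ?A))"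
    using assms \<xi>_natural[of "Far Gg m"]
      fb.D.Cmp_extend[OF fb.Far_square[OF g.counit_natural], of m "\<xi> (Fob Gg ?A)"]
    by (simp del: gb.G.Far_Cmp)
  also have "\<dots> = Far Gb (Far Ffb m) \<cdot>\<^bsub>Y\<^esub> bc ?A"
    using assms by (simp add: bc_def)
  finally show ?thesis .
qed

lemma bc_transpose:
  assumes "A \<in> Ob X"
  shows "eb (Fob Ffb A) \<cdot>\<^bsub>V\<^esub> Far Fgb (bc A) = Far Ffb (eg A) \<cdot>\<^bsub>V\<^esub> \<xi> (Fob Gg A)"
  using assms gb.transpose[of "Fob Ff (Fob Gg A)" "Far Ffb (eg A) \<cdot>\<^bsub>V\<^esub> \<xi> (Fob Gg A)"]
  by (simp add: bc_def)

text \<open>Transposed along gb^* \<stileturn> gb_* and precomposed with \<open>agb\<close>, both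
  sides become fb^*(eg \<otimes> eg) \<open>afb\<close> (\<xi> \<otimes> \<xi>). The left side gets
  there because \<lambda> and \<epsilon> both dissolve into counits and \<xi>, the right side
  because \<xi> is monoidal and natural.\<close>

lemma bc_monoidal:
  assumes "A \<in> Ob X" "E \<in> Ob X"
  shows "Far Gb (afb A E) \<cdot>\<^bsub>Y\<^esub> gb.lam (Fob Ffb A) (Fob Ffb E) \<cdot>\<^bsub>Y\<^esub> (bc A \<bullet>\<^bsub>Y\<^esub> bc E)
    = bc (A \<odot>\<^bsub>X\<^esub> E) \<cdot>\<^bsub>Y\<^esub> Far Ff (g.lam A E) \<cdot>\<^bsub>Y\<^esub> af (Fob Gg A) (Fob Gg E)" (is "?p = ?q")
proof (rule gb.transpose_eqI[of _ _ "Fob Ffb (A \<odot>\<^bsub>X\<^esub> E)"])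
  let ?A = "Fob Gg A" and ?E = "Fob Gg E" and ?e = "eb (Fob Ffb (A \<odot>\<^bsub>X\<^esub> E))"
  let ?fA = "Fob Ff ?A" and ?fE = "Fob Ff ?E"
  let ?\<alpha> = "agb ?fA ?fE"
  have "(?e \<cdot>\<^bsub>V\<^esub> Far Fgb ?p) \<cdot>\<^bsub>V\<^esub> ?\<alpha>
      = afb A E \<cdot>\<^bsub>V\<^esub> eb (Fob Ffb A \<odot>\<^bsub>V\<^esub> Fob Ffb E) \<cdot>\<^bsub>V\<^esub> Far Fgb (gb.lam (Fob Ffb A) (Fob Ffb E))
        \<cdot>\<^bsub>V\<^esub> Far Fgb (bc A \<bullet>\<^bsub>Y\<^esub> bc E) \<cdot>\<^bsub>V\<^esub> ?\<alpha>"
    using assms fb.D.Cmp_extend[OF gb.counit_natural, of "afb A E"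
        "Far Fgb (gb.lam (Fob Ffb A) (Fob Ffb E)) \<cdot>\<^bsub>V\<^esub> Far Fgb (bc A \<bullet>\<^bsub>Y\<^esub> bc E) \<cdot>\<^bsub>V\<^esub> ?\<alpha>"]
    by simp
  also have "\<dots> = afb A E \<cdot>\<^bsub>V\<^esub> (eb (Fob Ffb A \<odot>\<^bsub>V\<^esub> Fob Ffb E) \<cdot>\<^bsub>V\<^esub> Far Fgb (gb.lam (Fob Ffb A) (Fob Ffb E))
        \<cdot>\<^bsub>V\<^esub> agb (Fob Gb (Fob Ffb A)) (Fob Gb (Fob Ffb E))) \<cdot>\<^bsub>V\<^esub> (Far Fgb (bc A) \<bullet>\<^bsub>V\<^esub> Far Fgb (bc E))"
    using assms gb.\<nu>_natural[of "bc A" "bc E"] by simp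
  also have "\<dots> = afb A E \<cdot>\<^bsub>V\<^esub> ((eb (Fob Ffb A) \<bullet>\<^bsub>V\<^esub> eb (Fob Ffb E)) \<cdot>\<^bsub>V\<^esub> (Far Fgb (bc A) \<bullet>\<^bsub>V\<^esub> Far Fgb (bc E)))"
    using assms by (subst gb.lam_transpose_\<alpha>) simp_all
  also have "\<dots> = afb A E \<cdot>\<^bsub>V\<^esub> ((Far Ffb (eg A) \<bullet>\<^bsub>V\<^esub> Far Ffb (eg E)) \<cdot>\<^bsub>V\<^esub> (\<xi> ?A \<bullet>\<^bsub>V\<^esub> \<xi> ?E))"
    using assms by (simp add: fb.D.TenA_Cmp bc_transpose)
  also have "\<dots> = Far Ffb (eg A \<bullet>\<^bsub>X\<^esub> eg E) \<cdot>\<^bsub>V\<^esub> afb (Fob Fg ?A) (Fob Fg ?E) \<cdot>\<^bsub>V\<^esub> (\<xi> ?A \<bullet>\<^bsub>V\<^esub> \<xi> ?E)"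
    using assms fb.D.Cmp_extend[OF fb.\<nu>_natural, of "eg A" "eg E" "\<xi> ?A \<bullet>\<^bsub>V\<^esub> \<xi> ?E"] by simp
  \<comment> \<open>The defining property of \<lambda> for g is read backwards: expanding eg
    \<otimes> eg brings in \<open>ag\<close>, which completes the right-hand side of
    \<open>\<xi>_monoidal\<close>.\<close>
  also have "\<dots> = Far Ffb (eg (A \<odot>\<^bsub>X\<^esub> E)) \<cdot>\<^bsub>V\<^esub> Far Ffb (Far Fg (g.lam A E)) \<cdot>\<^bsub>V\<^esub> Far Ffb (ag ?A ?E)
      \<cdot>\<^bsub>V\<^esub> afb (Fob Fg ?A) (Fob Fg ?E) \<cdot>\<^bsub>V\<^esub> (\<xi> ?A \<bullet>\<^bsub>V\<^esub> \<xi> ?E)"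
    using assms by (simp flip: g.lam_transpose_\<alpha>)
  also have "\<dots> = Far Ffb (eg (A \<odot>\<^bsub>X\<^esub> E)) \<cdot>\<^bsub>V\<^esub> Far Ffb (Far Fg (g.lam A E)) \<cdot>\<^bsub>V\<^esub> \<xi> (?A \<odot>\<^bsub>Z\<^esub> ?E)
      \<cdot>\<^bsub>V\<^esub> Far Fgb (af ?A ?E) \<cdot>\<^bsub>V\<^esub> ?\<alpha>"
    using assms \<xi>_monoidal[of ?A ?E] by simp
  also have "\<dots> = Far Ffb (eg (A \<odot>\<^bsub>X\<^esub> E)) \<cdot>\<^bsub>V\<^esub> \<xi> (Fob Gg (A \<odot>\<^bsub>X\<^esub> E)) \<cdot>\<^bsub>V\<^esub> Far Fgb (Far Ff (g.lam A E))
      \<cdot>\<^bsub>V\<^esub> Far Fgb (af ?A ?E) \<cdot>\<^bsub>V\<^esub> ?\<alpha>"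
    using assms fb.D.Cmp_extend[OF \<xi>_natural, of "g.lam A E" "Far Fgb (af ?A ?E) \<cdot>\<^bsub>V\<^esub> ?\<alpha>"] by simp
  also have "\<dots> = (?e \<cdot>\<^bsub>V\<^esub> Far Fgb ?q) \<cdot>\<^bsub>V\<^esub> ?\<alpha>"
    using assms fb.D.Cmp_extend[OF bc_transpose, of "A \<odot>\<^bsub>X\<^esub> E"
        "Far Fgb (Far Ff (g.lam A E)) \<cdot>\<^bsub>V\<^esub> Far Fgb (af ?A ?E) \<cdot>\<^bsub>V\<^esub> ?\<alpha>"] by simp
  finally show "?e \<cdot>\<^bsub>V\<^esub> Far Fgb ?p = ?e \<cdot>\<^bsub>V\<^esub> Far Fgb ?q"
    by (rule fb.D.Iso_epi[of ?\<alpha>, rotated -1]) (use assms in \<open>simp_all add: gb.\<alpha>_Iso\<close>)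
qed (use assms in simp_all)

text \<open>Applied later with \<open>R\<close> = g^!K, \<open>R'\<close> = gb^!f^*K and with
  \<open>c\<close>, \<open>c'\<close> the counits of h_* \<stileturn> h^!. After transposition,
  \<open>square\<close> brings in \<epsilon> at \<open>R\<close>, naturality moves it past ev to the
  tensor product [A, R] \<otimes> A, and \<open>bc_monoidal\<close> splits it into one factor for
  each of the two occurrences of \<epsilon> in the claim.\<close>

lemma duality_compatible:
  assumes "K \<in> Ob Z" "R \<in> Ob X" "R' \<in> Ob V" "A \<in> Ob X"
    and c: "c \<in> Hom Z (Fob Gg R) K" and c': "c' \<in> Hom Y (Fob Gb R') (Fob Ff K)"
    and \<gamma>: "\<gamma> \<in> Hom V (Fob Ffb R) R'"
    and square: "c' \<cdot>\<^bsub>Y\<^esub> Far Gb \<gamma> \<cdot>\<^bsub>Y\<^esub> bc R = Far Ff c"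
  shows "f.hc (Fob Gg A) K \<cdot>\<^bsub>Y\<^esub> Far Ff (IHomA Z (Ide Z (Fob Gg A)) c \<cdot>\<^bsub>Z\<^esub> g.push.hc A R)
    = IHomA Y (bc A) (Ide Y (Fob Ff K)) \<cdot>\<^bsub>Y\<^esub>
        (IHomA Y (Ide Y (Fob Gb (Fob Ffb A))) c' \<cdot>\<^bsub>Y\<^esub> gb.push.hc (Fob Ffb A) R'
          \<cdot>\<^bsub>Y\<^esub> Far Gb (IHomA V (Ide V (Fob Ffb A)) \<gamma> \<cdot>\<^bsub>V\<^esub> fb.hc A R)) \<cdot>\<^bsub>Y\<^esub> bc (IHom X A R)"
    (is "?l = _ \<cdot>\<^bsub>Y\<^esub> (_ \<cdot>\<^bsub>Y\<^esub> _ \<cdot>\<^bsub>Y\<^esub> Far Gb ?q) \<cdot>\<^bsub>Y\<^esub> _")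
proof (rule f.D.Ev_eqI[of "Fob Ff (Fob Gg A)" "Fob Ff K"])
  let ?I = "IHom X A R" and ?fA = "Fob Ffb A" and ?gA = "Fob Gg A"
  let ?fgA = "Fob Ff ?gA" and ?gfA = "Fob Gb ?fA" and ?K = "Fob Ff K"
  let ?p = "IHomA Z (Ide Z ?gA) c \<cdot>\<^bsub>Z\<^esub> g.push.hc A R"
  let ?\<Phi> = "IHomA Y (Ide Y ?gfA) c' \<cdot>\<^bsub>Y\<^esub> gb.push.hc ?fA R' \<cdot>\<^bsub>Y\<^esub> Far Gb ?q"
  let ?w = "Far Ff (g.lam ?I A) \<cdot>\<^bsub>Y\<^esub> af (Fob Gg ?I) ?gA"
  have c [simp]: "c \<in> Ar Z" "Dom Z c = Fob Gg R" "Cod Z c = K"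
    and c' [simp]: "c' \<in> Ar Y" "Dom Y c' = Fob Gb R'" "Cod Y c' = ?K"
    and \<gamma> [simp]: "\<gamma> \<in> Ar V" "Dom V \<gamma> = Fob Ffb R" "Cod V \<gamma> = R'"
    using c c' \<gamma> by (simp_all add: Hom_def)
  \<comment> \<open>The three transposes computed here are those of \<zeta> for g, of \<beta> for fb
    followed by \<gamma>, and of the structure of the whole composite gb_* I_\<gamma> fb^*.\<close>
  have p: "Ev Z ?gA K \<cdot>\<^bsub>Z\<^esub> (?p \<bullet>\<^bsub>Z\<^esub> Ide Z ?gA) = c \<cdot>\<^bsub>Z\<^esub> Far Gg (Ev X A R) \<cdot>\<^bsub>Z\<^esub> g.lam ?I A"
    using assms(1-4) f.C.Ev_postcompose[of ?gA "g.push.hc A R" c] by (simp add: g.push.Ev_hom_compare)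
  have q: "Ev V ?fA R' \<cdot>\<^bsub>V\<^esub> (?q \<bullet>\<^bsub>V\<^esub> Ide V ?fA) = \<gamma> \<cdot>\<^bsub>V\<^esub> Far Ffb (Ev X A R) \<cdot>\<^bsub>V\<^esub> afb ?I A"
    using assms(1-4) fb.D.Ev_postcompose[of ?fA "fb.hc A R" \<gamma>] by (simp add: fb.Ev_hom_compare)
  have \<Phi>: "Ev Y ?gfA ?K \<cdot>\<^bsub>Y\<^esub> (?\<Phi> \<bullet>\<^bsub>Y\<^esub> Ide Y ?gfA)
      = c' \<cdot>\<^bsub>Y\<^esub> Far Gb (\<gamma> \<cdot>\<^bsub>V\<^esub> Far Ffb (Ev X A R) \<cdot>\<^bsub>V\<^esub> afb ?I A) \<cdot>\<^bsub>Y\<^esub> gb.lam (Fob Ffb ?I) ?fA"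
    using assms(1-4) f.D.Ev_postcompose[of ?gfA "gb.push.hc ?fA R' \<cdot>\<^bsub>Y\<^esub> Far Gb ?q" c']
      gb.push.Ev_hom_compare_Far[of ?fA R' ?q]
    by (simp add: q del: gb.G.Far_Cmp)
  have "Ev Y ?fgA ?K \<cdot>\<^bsub>Y\<^esub> (?l \<bullet>\<^bsub>Y\<^esub> Ide Y ?fgA) = Far Ff c \<cdot>\<^bsub>Y\<^esub> Far Ff (Far Gg (Ev X A R)) \<cdot>\<^bsub>Y\<^esub> ?w"
    using assms(1-4) f.Ev_hom_compare_Far[of ?gA K ?p] by (simp add: p del: f.Far_Cmp) simp
  \<comment> \<open>\<open>square\<close> is read from right to left, which creates the factor
    \<open>bc R\<close>.\<close>
  also have "\<dots> = c' \<cdot>\<^bsub>Y\<^esub> Far Gb \<gamma> \<cdot>\<^bsub>Y\<^esub> (bc R \<cdot>\<^bsub>Y\<^esub> Far Ff (Far Gg (Ev X A R))) \<cdot>\<^bsub>Y\<^esub> ?w"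
    using assms(1-4) by (simp flip: square)
  also have "\<dots> = c' \<cdot>\<^bsub>Y\<^esub> Far Gb \<gamma> \<cdot>\<^bsub>Y\<^esub> Far Gb (Far Ffb (Ev X A R)) \<cdot>\<^bsub>Y\<^esub> bc (?I \<odot>\<^bsub>X\<^esub> A) \<cdot>\<^bsub>Y\<^esub> ?w"
    using assms(1-4) f.D.Cmp_extend[OF bc_natural, of "Ev X A R" ?w] by simp
  also have "\<dots> = c' \<cdot>\<^bsub>Y\<^esub> Far Gb \<gamma> \<cdot>\<^bsub>Y\<^esub> Far Gb (Far Ffb (Ev X A R)) \<cdot>\<^bsub>Y\<^esub> Far Gb (afb ?I A)
      \<cdot>\<^bsub>Y\<^esub> gb.lam (Fob Ffb ?I) ?fA \<cdot>\<^bsub>Y\<^esub> (bc ?I \<bullet>\<^bsub>Y\<^esub> bc A)"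
    using assms(1-4) bc_monoidal[of ?I A] by simp
  also have "\<dots> = (Ev Y ?gfA ?K \<cdot>\<^bsub>Y\<^esub> (?\<Phi> \<bullet>\<^bsub>Y\<^esub> Ide Y ?gfA)) \<cdot>\<^bsub>Y\<^esub> (bc ?I \<bullet>\<^bsub>Y\<^esub> bc A)"
    using assms(1-4) unfolding \<Phi> by simp
  \<comment> \<open>The two tensor factors part: \<epsilon> at [A, R] joins \<open>?\<Phi>\<close>
    on the first factor, while \<epsilon> at \<open>A\<close> stays on the second and becomes
    precomposition by \<open>Ev_precompose\<close>.\<close>
  also have "\<dots> = Ev Y ?gfA ?K \<cdot>\<^bsub>Y\<^esub> ((?\<Phi> \<cdot>\<^bsub>Y\<^esub> bc ?I) \<bullet>\<^bsub>Y\<^esub> Ide Y ?gfA) \<cdot>\<^bsub>Y\<^esub> (Ide Y (Fob Ff (Fob Gg ?I)) \<bullet>\<^bsub>Y\<^esub> bc A)"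
    using assms(1-4) by (simp add: f.D.TenA_Cmp)
  also have "\<dots> = Ev Y ?fgA ?K \<cdot>\<^bsub>Y\<^esub> ((IHomA Y (bc A) (Ide Y ?K) \<cdot>\<^bsub>Y\<^esub> ?\<Phi> \<cdot>\<^bsub>Y\<^esub> bc ?I) \<bullet>\<^bsub>Y\<^esub> Ide Y ?fgA)"
    using assms(1-4) f.D.Ev_precompose[of "bc A" ?K "?\<Phi> \<cdot>\<^bsub>Y\<^esub> bc ?I"] by simp
  finally show "Ev Y ?fgA ?K \<cdot>\<^bsub>Y\<^esub> (?l \<bullet>\<^bsub>Y\<^esub> Ide Y ?fgA)
    = Ev Y ?fgA ?K \<cdot>\<^bsub>Y\<^esub> ((IHomA Y (bc A) (Ide Y ?K) \<cdot>\<^bsub>Y\<^esub> ?\<Phi> \<cdot>\<^bsub>Y\<^esub> bc ?I) \<bullet>\<^bsub>Y\<^esub> Ide Y ?fgA)" .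
qed (use assms in \<open>simp_all add: Hom_def\<close>)

end

section \<open>Base change and suspensions\<close>

lemma nat_trans_comp:
  assumes "nat_trans C D F G \<rho>" "nat_trans C D G H \<sigma>"
  shows "nat_trans C D F H (\<lambda>A. \<sigma> A \<cdot>\<^bsub>D\<^esub> \<rho> A)"
proof -
  have fn: "is_functor C D F" "is_functor C D G" "is_functor C D H"
    using assms by (simp_all add: nat_trans_def)
  interpret F: cat_functor C D F using fn by (simp add: cat_functor_iff)
  interpret G: cat_functor C D G using fn by (simp add: cat_functor_iff)
  interpret H: cat_functor C D H using fn by (simp add: cat_functor_iff)
  note \<rho> = nat_trans_simps[OF assms(1)] and \<sigma> = nat_trans_simps[OF assms(2)]
  show ?thesis
  proof (rule nat_transI)
    fix f assume "f \<in> Ar C"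
    then show "(\<sigma> (Cod C f) \<cdot>\<^bsub>D\<^esub> \<rho> (Cod C f)) \<cdot>\<^bsub>D\<^esub> Far F f = Far H f \<cdot>\<^bsub>D\<^esub> \<sigma> (Dom C f) \<cdot>\<^bsub>D\<^esub> \<rho> (Dom C f)"
      using F.D.Cmp_extend[OF \<sigma>(4), of f "\<rho> (Dom C f)"] by (simp add: \<rho> \<sigma>(1-3))
  qed (use fn in \<open>simp_all add: \<rho> \<sigma>\<close>)
qed

text \<open>Reverses the two invertible sides of a commuting square; naturality of an inverse
  transformation is the case of a naturality square.\<close>

lemma (in category) Invr_square:
  assumes "q \<cdot> a = b \<cdot> p" "Iso C p" "Iso C q" "a \<in> Ar C" "b \<in> Ar C"
    "Dom C a = Dom C p" "Cod C a = Dom C q" "Dom C b = Cod C p" "Cod C b = Cod C q"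
  shows "Invr C q \<cdot> b = a \<cdot> Invr C p"
proof (rule Iso_epi[of p])
  have "p \<in> Ar C" "q \<in> Ar C" using assms Iso_Ar by auto
  then show "(Invr C q \<cdot> b) \<cdot> p = (a \<cdot> Invr C p) \<cdot> p" "Invr C q \<cdot> b \<in> Ar C" "a \<cdot> Invr C p \<in> Ar C"
    using assms by (simp_all flip: assms(1))
qed (use assms Iso_Ar in auto)

lemma nat_trans_Invr:
  assumes "nat_trans C D F G \<rho>" and iso: "\<And>A. A \<in> Ob C \<Longrightarrow> Iso D (\<rho> A)"
  shows "nat_trans C D G F (\<lambda>A. Invr D (\<rho> A))"
proof -
  have fn: "is_functor C D F" "is_functor C D G"
    using assms by (simp_all add: nat_trans_def)
  interpret F: cat_functor C D F using fn by (simp add: cat_functor_iff)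
  interpret G: cat_functor C D G using fn by (simp add: cat_functor_iff)
  note \<rho> = nat_trans_simps[OF assms(1)]
  show ?thesis
  proof (rule nat_transI)
    fix f assume "f \<in> Ar C"
    then show "Invr D (\<rho> (Cod C f)) \<cdot>\<^bsub>D\<^esub> Far G f = Far F f \<cdot>\<^bsub>D\<^esub> Invr D (\<rho> (Dom C f))"
      by (intro F.D.Invr_square) (simp_all add: \<rho> iso)
  qed (use fn in \<open>simp_all add: \<rho> iso\<close>)
qed

text \<open>Together with \<open>flavoured_morphism_Invr\<close> this makes \<xi>, a composite of
  one composition isomorphism with the inverse of another, a morphism in each setting.\<close>

lemma flavoured_morphism_comp:
  assumes \<rho>: "flavoured_morphism k C D F G \<rho>" and \<sigma>: "flavoured_morphism k C D G H \<sigma>"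
    and s: "k \<noteq> Plain \<Longrightarrow> suspended C \<and> suspended D"
  shows "flavoured_morphism k C D F H (\<lambda>A. \<sigma> A \<cdot>\<^bsub>D\<^esub> \<rho> A)"
proof -
  have nt: "nat_trans C D F G \<rho>" "nat_trans C D G H \<sigma>"
    using assms by (simp_all add: flavoured_morphism_def)
  note nt_simps = nat_trans_simps(1-3)[OF nt(1)] nat_trans_simps(1-3)[OF nt(2)]
  have "suspended_morphism C D F H (\<lambda>A. \<sigma> A \<cdot>\<^bsub>D\<^esub> \<rho> A)" if k: "k \<noteq> Plain"
  proof -
    interpret C: suspended C using s k by simp
    interpret D: suspended D using s k by simp
    interpret TC: cat_functor C C "Sus C" by (simp add: cat_functor_iff C.Sus_functor)
    interpret TD: cat_functor D D "Sus D" by (simp add: cat_functor_iff D.Sus_functor)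
    have sm: "suspended_morphism C D F G \<rho>" "suspended_morphism C D G H \<sigma>"
      using \<rho> \<sigma> k by (simp_all add: flavoured_morphism_def)
    then have sf: "suspended_functor C D F" "suspended_functor C D G" "suspended_functor C D H"
      and eq: "\<And>A. A \<in> Ob C \<Longrightarrow> Theta G A \<cdot>\<^bsub>D\<^esub> \<rho> (Fob (Sus C) A) = Far (Sus D) (\<rho> A) \<cdot>\<^bsub>D\<^esub> Theta F A"
        "\<And>A. A \<in> Ob C \<Longrightarrow> Theta H A \<cdot>\<^bsub>D\<^esub> \<sigma> (Fob (Sus C) A) = Far (Sus D) (\<sigma> A) \<cdot>\<^bsub>D\<^esub> Theta G A"
      by (simp_all add: suspended_morphism_def)
    interpret F: cat_functor C D F using suspended_functorD(1)[OF sf(1)] by (simp add: cat_functor_iff)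
    interpret G: cat_functor C D G using suspended_functorD(1)[OF sf(2)] by (simp add: cat_functor_iff)
    interpret H: cat_functor C D H using suspended_functorD(1)[OF sf(3)] by (simp add: cat_functor_iff)
    note sf_simps = sf(1)[THEN suspended_functorD(2)] sf(1)[THEN suspended_functorD(3)] sf(1)[THEN suspended_functorD(4)]
      sf(2)[THEN suspended_functorD(2)] sf(2)[THEN suspended_functorD(3)] sf(2)[THEN suspended_functorD(4)]
      sf(3)[THEN suspended_functorD(2)] sf(3)[THEN suspended_functorD(3)] sf(3)[THEN suspended_functorD(4)]
    have "Theta H A \<cdot>\<^bsub>D\<^esub> \<sigma> (Fob (Sus C) A) \<cdot>\<^bsub>D\<^esub> \<rho> (Fob (Sus C) A)
        = Far (Sus D) (\<sigma> A \<cdot>\<^bsub>D\<^esub> \<rho> A) \<cdot>\<^bsub>D\<^esub> Theta F A" if "A \<in> Ob C" for A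
      using that D.Cmp_extend[OF eq(2), of A "\<rho> (Fob (Sus C) A)"] eq(1)[of A]
      by (simp add: nt_simps sf_simps)
    with sf nt show ?thesis
      by (simp add: suspended_morphism_def nat_trans_comp)
  qed
  with nt show ?thesis
    by (auto simp: flavoured_morphism_def nat_trans_comp)
qed

lemma flavoured_morphism_Invr:
  assumes \<rho>: "flavoured_morphism k C D F G \<rho>" and iso: "\<And>A. A \<in> Ob C \<Longrightarrow> Iso D (\<rho> A)"
    and s: "k \<noteq> Plain \<Longrightarrow> suspended C \<and> suspended D"
  shows "flavoured_morphism k C D G F (\<lambda>A. Invr D (\<rho> A))"
proof -
  have nt: "nat_trans C D F G \<rho>"
    using assms by (simp add: flavoured_morphism_def)
  note nt_simps = nat_trans_simps(1-3)[OF nt]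
  have "suspended_morphism C D G F (\<lambda>A. Invr D (\<rho> A))" if k: "k \<noteq> Plain"
  proof -
    interpret C: suspended C using s k by simp
    interpret D: suspended D using s k by simp
    interpret TC: cat_functor C C "Sus C" by (simp add: cat_functor_iff C.Sus_functor)
    interpret TD: cat_functor D D "Sus D" by (simp add: cat_functor_iff D.Sus_functor)
    have sm: "suspended_morphism C D F G \<rho>"
      using \<rho> k by (simp add: flavoured_morphism_def)
    then have sf: "suspended_functor C D F" "suspended_functor C D G"
      and eq: "\<And>A. A \<in> Ob C \<Longrightarrow> Theta G A \<cdot>\<^bsub>D\<^esub> \<rho> (Fob (Sus C) A) = Far (Sus D) (\<rho> A) \<cdot>\<^bsub>D\<^esub> Theta F A"
      by (simp_all add: suspended_morphism_def)
    interpret F: cat_functor C D F using suspended_functorD(1)[OF sf(1)] by (simp add: cat_functor_iff)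
    interpret G: cat_functor C D G using suspended_functorD(1)[OF sf(2)] by (simp add: cat_functor_iff)
    note sf_simps = sf(1)[THEN suspended_functorD(2)] sf(1)[THEN suspended_functorD(3)] sf(1)[THEN suspended_functorD(4)]
      sf(2)[THEN suspended_functorD(2)] sf(2)[THEN suspended_functorD(3)] sf(2)[THEN suspended_functorD(4)]
    have "Theta F A \<cdot>\<^bsub>D\<^esub> Invr D (\<rho> (Fob (Sus C) A)) = Far (Sus D) (Invr D (\<rho> A)) \<cdot>\<^bsub>D\<^esub> Theta G A"
      if A: "A \<in> Ob C" for A
    proof (rule D.Iso_epi[of "\<rho> (Fob (Sus C) A)"])
      \<comment> \<open>Once \<rho> at TA is cancelled on the right, the suspension condition for
        \<rho> leaves only T applied to an arrow and its inverse.\<close>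
      have "Far (Sus D) (Invr D (\<rho> A)) \<cdot>\<^bsub>D\<^esub> Far (Sus D) (\<rho> A) \<cdot>\<^bsub>D\<^esub> Theta F A
        = Far (Sus D) (Invr D (\<rho> A) \<cdot>\<^bsub>D\<^esub> \<rho> A) \<cdot>\<^bsub>D\<^esub> Theta F A"
        using A by (simp add: nt_simps sf_simps iso del: D.Invr_simps(4))
      with A show "(Theta F A \<cdot>\<^bsub>D\<^esub> Invr D (\<rho> (Fob (Sus C) A))) \<cdot>\<^bsub>D\<^esub> \<rho> (Fob (Sus C) A)
        = (Far (Sus D) (Invr D (\<rho> A)) \<cdot>\<^bsub>D\<^esub> Theta G A) \<cdot>\<^bsub>D\<^esub> \<rho> (Fob (Sus C) A)"
        by (simp add: nt_simps sf_simps iso eq)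
    qed (use A in \<open>simp_all add: nt_simps sf_simps iso\<close>)
    with sf nt iso show ?thesis
      by (simp add: suspended_morphism_def nat_trans_Invr)
  qed
  with nt iso show ?thesis
    by (auto simp: flavoured_morphism_def nat_trans_Invr)
qed

text \<open>Compatibility with suspensions is imposed on the three transformations from which
  \<epsilon> is built: the counit for g, the unit for gb, and \<xi>.\<close>

locale suspended_base_change =
  base_change Z X Y V Ff Ffb Fg Gg Fgb Gb af afb ag agb \<eta>g eg \<eta>b eb \<xi> +
  SZ: suspended Z + SX: suspended X + SY: suspended Y + SV: suspended V
  for Z X Y V :: "('o, 'm, 'z) ssmc_scheme"
    and Ff Ffb Fg Gg Fgb Gb :: "('o, 'm, 'o, 'm, 'x) sfctr_scheme"
    and af afb ag agb \<eta>g eg \<eta>b eb \<xi> +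
  assumes Ff: "suspended_functor Z Y Ff" and Ffb: "suspended_functor X V Ffb"
    and Fg: "suspended_functor Z X Fg" and Gg: "suspended_functor X Z Gg"
    and Fgb: "suspended_functor Y V Fgb" and Gb: "suspended_functor V Y Gb"
    and eg: "suspended_morphism X X (comp_sfctr X Fg Gg) (id_sfctr X) eg"
    and \<eta>b: "suspended_morphism Y Y (id_sfctr Y) (comp_sfctr Y Gb Fgb) \<eta>b"
    and \<xi>: "suspended_morphism Z V (comp_sfctr V Fgb Ff) (comp_sfctr V Ffb Fg) \<xi>"
begin

lemma bc_suspended:
  assumes A: "A \<in> Ob X"
  shows "(Theta Gb (Fob Ffb A) \<cdot>\<^bsub>Y\<^esub> Far Gb (Theta Ffb A)) \<cdot>\<^bsub>Y\<^esub> bc (Fob (Sus X) A)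
    = Far (Sus Y) (bc A) \<cdot>\<^bsub>Y\<^esub> Theta Ff (Fob Gg A) \<cdot>\<^bsub>Y\<^esub> Far Ff (Theta Gg A)"
proof -
  interpret TZ: cat_functor Z Z "Sus Z" by (simp add: cat_functor_iff SZ.Sus_functor)
  interpret TX: cat_functor X X "Sus X" by (simp add: cat_functor_iff SX.Sus_functor)
  interpret TY: cat_functor Y Y "Sus Y" by (simp add: cat_functor_iff SY.Sus_functor)
  interpret TV: cat_functor V V "Sus V" by (simp add: cat_functor_iff SV.Sus_functor)
  note [simp] = suspended_functorD(2-4)[OF Ff] suspended_functorD(2-4)[OF Ffb]
    suspended_functorD(2-4)[OF Fg] suspended_functorD(2-4)[OF Gg]
    suspended_functorD(2-4)[OF Fgb] suspended_functorD(2-4)[OF Gb]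
  let ?M = "Fob Gg A" and ?TA = "Fob (Sus X) A" and ?H = "Fob Ff (Fob Gg A)"
  let ?\<Theta> = "Theta Ff ?M \<cdot>\<^bsub>Y\<^esub> Far Ff (Theta Gg A)"
  let ?m = "Far Ffb (eg A) \<cdot>\<^bsub>V\<^esub> \<xi> ?M"
  have eg_eq: "eg ?TA = Far (Sus X) (eg A) \<cdot>\<^bsub>X\<^esub> Theta Fg ?M \<cdot>\<^bsub>X\<^esub> Far Fg (Theta Gg A)"
    using eg A by (simp add: suspended_morphism_def)
  have \<eta>b_eq: "Theta Gb (Fob Fgb ?H) \<cdot>\<^bsub>Y\<^esub> Far Gb (Theta Fgb ?H) \<cdot>\<^bsub>Y\<^esub> \<eta>b (Fob (Sus Y) ?H) = Far (Sus Y) (\<eta>b ?H)"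
    using \<eta>b A by (simp add: suspended_morphism_def)
  have \<xi>_eq: "Theta Ffb (Fob Fg ?M) \<cdot>\<^bsub>V\<^esub> Far Ffb (Theta Fg ?M) \<cdot>\<^bsub>V\<^esub> \<xi> (Fob (Sus Z) ?M)
      = Far (Sus V) (\<xi> ?M) \<cdot>\<^bsub>V\<^esub> Theta Fgb ?H \<cdot>\<^bsub>V\<^esub> Far Fgb (Theta Ff ?M)"
    using \<xi> A by (simp add: suspended_morphism_def)
  \<comment> \<open>All of \<epsilon> except the unit lies under gb_*; its compatibility with
    suspensions is settled here, inside \<open>V\<close>. Naturality of \<xi> at
    \<open>Theta Gg A\<close> prepares the use of \<open>\<xi>_eq\<close>.\<close>
  have inner: "Theta Ffb A \<cdot>\<^bsub>V\<^esub> Far Ffb (eg ?TA) \<cdot>\<^bsub>V\<^esub> \<xi> (Fob Gg ?TA)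
      = Far (Sus V) ?m \<cdot>\<^bsub>V\<^esub> Theta Fgb ?H \<cdot>\<^bsub>V\<^esub> Far Fgb ?\<Theta>"
  proof -
    have "Theta Ffb A \<cdot>\<^bsub>V\<^esub> Far Ffb (eg ?TA) \<cdot>\<^bsub>V\<^esub> \<xi> (Fob Gg ?TA)
      = Far (Sus V) (Far Ffb (eg A)) \<cdot>\<^bsub>V\<^esub> Theta Ffb (Fob Fg ?M) \<cdot>\<^bsub>V\<^esub> Far Ffb (Theta Fg ?M)
        \<cdot>\<^bsub>V\<^esub> Far Ffb (Far Fg (Theta Gg A)) \<cdot>\<^bsub>V\<^esub> \<xi> (Fob Gg ?TA)"
      using A fb.D.Cmp_extend[OF suspended_functorD(5)[OF Ffb], of "eg A"
          "Far Ffb (Theta Fg ?M) \<cdot>\<^bsub>V\<^esub> Far Ffb (Far Fg (Theta Gg A)) \<cdot>\<^bsub>V\<^esub> \<xi> (Fob Gg ?TA)"]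
      by (simp add: eg_eq)
    also have "\<dots> = Far (Sus V) (Far Ffb (eg A)) \<cdot>\<^bsub>V\<^esub> (Theta Ffb (Fob Fg ?M) \<cdot>\<^bsub>V\<^esub> Far Ffb (Theta Fg ?M)
        \<cdot>\<^bsub>V\<^esub> \<xi> (Fob (Sus Z) ?M)) \<cdot>\<^bsub>V\<^esub> Far Fgb (Far Ff (Theta Gg A))"
      using A \<xi>_natural[of "Theta Gg A"] by simp
    finally show ?thesis
      using A unfolding \<xi>_eq by simp
  qed
  have "(Theta Gb (Fob Ffb A) \<cdot>\<^bsub>Y\<^esub> Far Gb (Theta Ffb A)) \<cdot>\<^bsub>Y\<^esub> bc ?TA
      = Theta Gb (Fob Ffb A) \<cdot>\<^bsub>Y\<^esub> Far Gb (Theta Ffb A \<cdot>\<^bsub>V\<^esub> Far Ffb (eg ?TA) \<cdot>\<^bsub>V\<^esub> \<xi> (Fob Gg ?TA))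
        \<cdot>\<^bsub>Y\<^esub> \<eta>b (Fob Ff (Fob Gg ?TA))"
    using A by (simp add: bc_def)
  also have "\<dots> = Far (Sus Y) (Far Gb ?m) \<cdot>\<^bsub>Y\<^esub> Theta Gb (Fob Fgb ?H) \<cdot>\<^bsub>Y\<^esub> Far Gb (Theta Fgb ?H)
      \<cdot>\<^bsub>Y\<^esub> Far Gb (Far Fgb ?\<Theta>) \<cdot>\<^bsub>Y\<^esub> \<eta>b (Fob Ff (Fob Gg ?TA))"
    using A f.D.Cmp_extend[OF suspended_functorD(5)[OF Gb], of ?m
        "Far Gb (Theta Fgb ?H) \<cdot>\<^bsub>Y\<^esub> Far Gb (Far Fgb ?\<Theta>) \<cdot>\<^bsub>Y\<^esub> \<eta>b (Fob Ff (Fob Gg ?TA))"]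
    unfolding inner by simp
  \<comment> \<open>Naturality of the unit moves \<open>?\<Theta>\<close> to the far right, so that
    the unit is now taken at T of \<open>?H\<close>, where \<open>\<eta>b_eq\<close>
    applies.\<close>
  also have "\<dots> = Far (Sus Y) (Far Gb ?m) \<cdot>\<^bsub>Y\<^esub> (Theta Gb (Fob Fgb ?H) \<cdot>\<^bsub>Y\<^esub> Far Gb (Theta Fgb ?H)
      \<cdot>\<^bsub>Y\<^esub> \<eta>b (Fob (Sus Y) ?H)) \<cdot>\<^bsub>Y\<^esub> ?\<Theta>"
    using A gb.unit_natural[of ?\<Theta>] by simp
  also have "\<dots> = Far (Sus Y) (bc A) \<cdot>\<^bsub>Y\<^esub> ?\<Theta>"
    using A unfolding \<eta>b_eq by (simp add: bc_def)
  finally show ?thesis .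
qed

end

section \<open>Pseudo functors\<close>

lemma sym_functor_Pull:
  assumes P: "pseudo_functor u k B P" "monoidal_pf u k B P" and h: "h \<in> Hom B X Y"
  shows "sym_functor (Fib P Y) (Fib P X) (Pull P h) (Pten P h)"
    and "A \<in> Ob (Fib P Y) \<Longrightarrow> E \<in> Ob (Fib P Y) \<Longrightarrow> Iso (Fib P X) (Pten P h A E)"
proof -
  have "category B"
    using P by (simp add: pseudo_functor_def)
  then have "X \<in> Ob B" "Y \<in> Ob B"
    using h category.dom_cod_Ob by (fastforce simp: Hom_def)+
  then have closed: "sym_tensor_closed (Fib P Y)" "sym_tensor_closed (Fib P X)"
    using P by (simp_all add: pseudo_functor_def smc_category_def)
  have "flavoured_functor k (Fib P Y) (Fib P X) (Pull P h)"
    using P h unfolding pseudo_functor_def by blast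
  then have fn: "is_functor (Fib P Y) (Fib P X) (Pull P h)"
    by (simp add: flavoured_functor_def)
  have mon: "sym_monoidal_functor u (Fib P Y) (Fib P X) (Pull P h) (Pten P h)"
    using P h unfolding monoidal_pf_def by blast
  note ni = mon[unfolded sym_monoidal_functor_def nat_iso_def, THEN conjunct1]
  note nt = nat_trans_simps[OF conjunct1[OF ni]]
  show "sym_functor (Fib P Y) (Fib P X) (Pull P h) (Pten P h)"
  proof (intro sym_functor.intro sym_functor_axioms.intro cat_functor.intro cat_functor_axioms.intro closed fn)
    show "category (Fib P Y)" "category (Fib P X)"
      using fn by (simp_all add: is_functor_def)
  next
    fix A E assume "A \<in> Ob (Fib P Y)" "E \<in> Ob (Fib P Y)"
    then show "Pten P h A E \<in> Hom (Fib P X) (Fob (Pull P h) A \<odot>\<^bsub>Fib P X\<^esub> Fob (Pull P h) E)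
        (Fob (Pull P h) (A \<odot>\<^bsub>Fib P Y\<^esub> E))"
      using nt(1-3)[of "(A, E)"] by (simp add: Hom_def)
    show "Far (Pull P h) (Sym (Fib P Y) A E) \<cdot>\<^bsub>Fib P X\<^esub> Pten P h A E
        = Pten P h E A \<cdot>\<^bsub>Fib P X\<^esub> Sym (Fib P X) (Fob (Pull P h) A) (Fob (Pull P h) E)"
      using mon \<open>A \<in> _\<close> \<open>E \<in> _\<close> by (simp add: sym_monoidal_functor_def)
  next
    fix p q assume "p \<in> Ar (Fib P Y)" "q \<in> Ar (Fib P Y)"
    then show "Pten P h (Cod (Fib P Y) p) (Cod (Fib P Y) q) \<cdot>\<^bsub>Fib P X\<^esub> (Far (Pull P h) p \<bullet>\<^bsub>Fib P X\<^esub> Far (Pull P h) q)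
      = Far (Pull P h) (p \<bullet>\<^bsub>Fib P Y\<^esub> q) \<cdot>\<^bsub>Fib P X\<^esub> Pten P h (Dom (Fib P Y) p) (Dom (Fib P Y) q)"
      using nt(4)[of "(p, q)"] by simp
  qed
  show "A \<in> Ob (Fib P Y) \<Longrightarrow> E \<in> Ob (Fib P Y) \<Longrightarrow> Iso (Fib P X) (Pten P h A E)"
    using ni by simp
qed

section \<open>Pull-back and push-forward as duality preserving functors\<close>

lemma dp_functor_hom_compare:
  assumes F: "sym_functor C D F \<nu>" and K: "K \<in> Ob C" and s: "k \<noteq> Plain \<Longrightarrow> suspended_functor C D F"
  shows "dp_functor k (with_duality C K) (with_duality D (Fob F K)) (F, \<lambda>A. hom_compare C D F \<nu> A K)"
proof -
  interpret sym_functor C D F \<nu> by fact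
  show ?thesis
    by (rule dp_functorI)
      (use K s in \<open>simp_all add: C.sym_tensor_closed_axioms D.sym_tensor_closed_axioms is_functor
        hom_compare_natural hom_compare_bidual\<close>)
qed

text \<open>For F = h_* and \<open>c\<close> the counit of h_* \<stileturn> h^! the structure is
  \<zeta>. It preserves dualities because it is \<mu> composed with the change of dualising object
  along \<open>c\<close>.\<close>

lemma dp_functor_hom_compare_post:
  assumes F: "sym_functor C D F \<nu>" and R: "R \<in> Ob C" and c: "c \<in> Hom D (Fob F R) K"
    and s: "k \<noteq> Plain \<Longrightarrow> suspended C \<and> suspended D \<and> suspended_functor C D F"
  shows "dp_functor k (with_duality C R) (with_duality D K)
    (F, \<lambda>A. IHomA D (Ide D (Fob F A)) c \<cdot>\<^bsub>D\<^esub> hom_compare C D F \<nu> A R)"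
proof -
  interpret sym_functor C D F \<nu> by fact
  note closed = C.sym_tensor_closed_axioms D.sym_tensor_closed_axioms
  have K: "K \<in> Ob D"
    using c by (auto simp: Hom_def)
  have "dp_functor k (with_duality C R) (with_duality D K)
    (dp_comp D (dp_change D c) (F, \<lambda>A. hom_compare C D F \<nu> A R))"
    unfolding dp_change_def
    by (rule dp_functor_comp[OF closed(1,2,2) R _ K _ dp_functor_hom_compare[OF F R]
          dp_functor_change[OF closed(2) _ c, unfolded dp_change_def]])
      (use R s in simp_all)
  then have "dp_functor k (with_duality C R) (with_duality D K)
    (comp_sfctr D (id_sfctr D) F, \<lambda>A. IHomA D (Ide D (Fob F A)) c \<cdot>\<^bsub>D\<^esub> hom_compare C D F \<nu> A R)"
    by (simp add: dp_change_def)
  \<comment> \<open>The composite with the identity functor has a \<open>Theta\<close> with an extra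
    identity factor. The conditions on the structure arrows do not involve \<open>Theta\<close>, so
    they transfer to \<open>F\<close> itself.\<close>
  note dp = dp_functorD(3-)[OF this]
  show ?thesis
    by (rule dp_functorI[OF closed R K is_functor]) (use s dp in simp_all)
qed

lemma dp_morphismI:
  assumes "dp_functor k (with_duality C K) (with_duality D M) (F, \<phi>)"
    and "dp_functor k (with_duality C K) (with_duality D M) (F', \<phi>')"
    and "flavoured_morphism k C D F F' \<rho>"
    and "\<And>A. A \<in> Ob C \<Longrightarrow> \<phi> A = IHomA D (\<rho> A) (Ide D M) \<cdot>\<^bsub>D\<^esub> \<phi>' A \<cdot>\<^bsub>D\<^esub> \<rho> (IHom C A K)"
  shows "dp_morphism k (with_duality C K) (with_duality D M) (F, \<phi>) (F', \<phi>') \<rho>"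
  using assms by (simp add: with_duality_def)

theorem theorem5p2p1:
  fixes u :: bool and k :: flavour
    and B :: "('b, 'a) cat"
    and P :: "('b, 'a, 'o, 'm) pfctr"
    and S :: "('a, 'o, 'm) adjoints"
    and V X Y Z :: 'b and fb gb f g :: 'a and K :: 'o
  assumes "pseudo_functor u k B P" and "associative_pf B P" and "monoidal_pf u k B P"
    and "adjoint_choice k B P S"
    and "fb \<in> Hom B V X" and "gb \<in> Hom B V Y" and "f \<in> Hom B Y Z" and "g \<in> Hom B X Z"
    and "f \<cdot>\<^bsub>B\<^esub> gb = g \<cdot>\<^bsub>B\<^esub> fb"
    and "g \<in> Ar (adjoint_subcat B P)" and "gb \<in> Ar (adjoint_subcat B P)"
    and "\<forall>A \<in> Ob (Fib P X). Iso (Fib P Y) (bc_epsilon B P S fb gb f g A)"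
    and "K \<in> Ob (Fib P Z)"
  shows "dp_morphism k
           (with_duality (Fib P X) (Fob (Shriek S g) K))
           (with_duality (Fib P Y) (Fob (Pull P f) K))
           (dp_comp (Fib P Y) (dp_pull B P f K) (dp_push B P S g K))
           (dp_comp (Fib P Y)
              (dp_comp (Fib P Y)
                 (dp_push B P S gb (Fob (Pull P f) K))
                 (dp_change (Fib P V) (bc_gamma B P S fb gb f g K)))
              (dp_pull B P fb (Fob (Shriek S g) K)))
           (bc_epsilon B P S fb gb f g)"
proof -
  let ?V = "Fib P V" and ?X = "Fib P X" and ?Y = "Fib P Y" and ?Z = "Fib P Z"
  let ?R = "Fob (Shriek S g) K" and ?K = "Fob (Pull P f) K"
  let ?\<xi> = "bc_xi B P fb gb f g" and ?\<epsilon> = "bc_epsilon B P S fb gb f g"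
  let ?\<gamma> = "bc_gamma B P S fb gb f g K"
  note pf = assms(1) and mon = assms(3) and sides = assms(5-8) and K = assms(13)
  have sides_simps [simp]: "Dom B fb = V" "Cod B fb = X" "Dom B gb = V" "Cod B gb = Y"
    "Dom B f = Y" "Cod B f = Z" "Dom B g = X" "Cod B g = Z"
    using sides by (simp_all add: Hom_def)
  have Obs: "V \<in> Ob B" "X \<in> Ob B" "Y \<in> Ob B" "Z \<in> Ob B"
    using sides category.dom_cod_Ob[of B fb] category.dom_cod_Ob[of B f] conjunct1[OF pf[unfolded pseudo_functor_def]]
    by (simp_all add: Hom_def)
  then have smc: "smc_category u k ?V" "smc_category u k ?X" "smc_category u k ?Y" "smc_category u k ?Z"
    using pf by (simp_all add: pseudo_functor_def)
  have closed: "sym_tensor_closed ?V" "sym_tensor_closed ?X" "sym_tensor_closed ?Y" "sym_tensor_closed ?Z"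
    using smc by (simp_all add: smc_category_def)
  have sus: "suspended ?V" "suspended ?X" "suspended ?Y" "suspended ?Z" if "k \<noteq> Plain"
    using that smc by (simp_all add: smc_category_def suspended_tensor_def)
  have pull: "sym_functor ?Z ?Y (Pull P f) (Pten P f)" "sym_functor ?X ?V (Pull P fb) (Pten P fb)"
    "sym_functor ?Z ?X (Pull P g) (Pten P g)" "sym_functor ?Y ?V (Pull P gb) (Pten P gb)"
    using sides sym_functor_Pull(1)[OF pf mon] by blast+
  have ff: "flavoured_functor k ?Z ?Y (Pull P f)" "flavoured_functor k ?X ?V (Pull P fb)"
    "flavoured_functor k ?Z ?X (Pull P g)" "flavoured_functor k ?Y ?V (Pull P gb)"
    using sides pf unfolding pseudo_functor_def by blast+
  then have pull_sus: "suspended_functor ?Z ?Y (Pull P f)" "suspended_functor ?X ?V (Pull P fb)"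
    "suspended_functor ?Z ?X (Pull P g)" "suspended_functor ?Y ?V (Pull P gb)" if "k \<noteq> Plain"
    using that by (simp_all add: flavoured_functor_def)
  have adj_hom: "g \<in> Hom (adjoint_subcat B P) X Z" "gb \<in> Hom (adjoint_subcat B P) V Y"
    using assms(10,11) by (simp_all add: Hom_def adjoint_subcat_def)
  have choice_g: "adjunction ?Z ?X (Pull P g) (Push S g) (Eta S g) (Eps S g)"
      "adjunction ?X ?Z (Push S g) (Shriek S g) (Eta' S g) (Eps' S g)"
      "k \<noteq> Plain \<Longrightarrow> suspended_functor ?X ?Z (Push S g)"
      "k \<noteq> Plain \<Longrightarrow> suspended_morphism ?X ?X
         (comp_sfctr ?X (Pull P g) (Push S g)) (id_sfctr ?X) (Eps S g)"
    and choice_gb: "adjunction ?Y ?V (Pull P gb) (Push S gb) (Eta S gb) (Eps S gb)"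
      "adjunction ?V ?Y (Push S gb) (Shriek S gb) (Eta' S gb) (Eps' S gb)"
      "k \<noteq> Plain \<Longrightarrow> suspended_functor ?V ?Y (Push S gb)"
      "k \<noteq> Plain \<Longrightarrow> suspended_morphism ?Y ?Y
         (id_sfctr ?Y) (comp_sfctr ?Y (Push S gb) (Pull P gb)) (Eta S gb)"
    using adj_hom assms(4) unfolding adjoint_choice_def by blast+
  interpret F: sym_functor ?Z ?Y "Pull P f" "Pten P f" by (rule pull)
  interpret FB: sym_functor ?X ?V "Pull P fb" "Pten P fb" by (rule pull)
  interpret G: sym_adjunction ?Z ?X "Pull P g" "Pten P g" "Push S g" "Eta S g" "Eps S g"
    by (intro sym_adjunction.intro pull adjoint_pair.intro adjoint_pair_axioms.intro
        sym_adjunction_axioms.intro choice_g sym_functor_Pull(2)[OF pf mon sides(4)])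
      (use pull in \<open>auto simp: sym_functor_def sym_tensor_closed_def sym_tensor_def cat_functor_iff\<close>)
  interpret GB: sym_adjunction ?Y ?V "Pull P gb" "Pten P gb" "Push S gb" "Eta S gb" "Eps S gb"
    by (intro sym_adjunction.intro pull adjoint_pair.intro adjoint_pair_axioms.intro
        sym_adjunction_axioms.intro choice_gb sym_functor_Pull(2)[OF pf mon sides(2)])
      (use pull in \<open>auto simp: sym_functor_def sym_tensor_closed_def sym_tensor_def cat_functor_iff\<close>)
  interpret SG: adjoint_pair ?X ?Z "Push S g" "Shriek S g" "Eta' S g" "Eps' S g"
    using choice_g(2) by (intro adjoint_pair.intro adjoint_pair_axioms.intro)
      (auto simp: G.G.cat_functor_axioms FB.C.category_axioms F.C.category_axioms)
  interpret SGB: adjoint_pair ?V ?Y "Push S gb" "Shriek S gb" "Eta' S gb" "Eps' S gb"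
    using choice_gb(2) by (intro adjoint_pair.intro adjoint_pair_axioms.intro)
      (auto simp: GB.G.cat_functor_axioms FB.D.category_axioms F.D.category_axioms)
  let ?c = "Pcomp P f gb" and ?d = "Pcomp P g fb"
  \<comment> \<open>Since f gb = g fb, both composition isomorphisms end in the same functor,
    written (f gb)^*; this is what allows \<xi> to be formed.\<close>
  have comp: "flavoured_morphism k ?Z ?V (comp_sfctr ?V (Pull P gb) (Pull P f)) (Pull P (f \<cdot>\<^bsub>B\<^esub> gb)) ?c"
      "flavoured_morphism k ?Z ?V (comp_sfctr ?V (Pull P fb) (Pull P g)) (Pull P (f \<cdot>\<^bsub>B\<^esub> gb)) ?d"
    and comp_Iso [simp]: "\<And>A. A \<in> Ob ?Z \<Longrightarrow> Iso ?V (?c A)" "\<And>A. A \<in> Ob ?Z \<Longrightarrow> Iso ?V (?d A)"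
    using sides pf unfolding pseudo_functor_def assms(9)[symmetric] by (metis assms(9))+
  have "flavoured_morphism k ?Z ?V (comp_sfctr ?V (Pull P gb) (Pull P f)) (comp_sfctr ?V (Pull P fb) (Pull P g))
      (\<lambda>A. Invr ?V (?d A) \<cdot>\<^bsub>?V\<^esub> ?c A)"
    by (rule flavoured_morphism_comp[OF comp(1) flavoured_morphism_Invr[OF comp(2)]]) (use sus in auto)
  then have \<xi>_fm: "flavoured_morphism k ?Z ?V (comp_sfctr ?V (Pull P gb) (Pull P f))
      (comp_sfctr ?V (Pull P fb) (Pull P g)) ?\<xi>"
    by (simp add: bc_xi_def[abs_def])
  note \<xi> = nat_trans_simps[OF conjunct1[OF \<xi>_fm[unfolded flavoured_morphism_def]]]
  note c [simp] = nat_trans_simps(1-3)[OF conjunct1[OF comp(1)[unfolded flavoured_morphism_def]]]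
    and d [simp] = nat_trans_simps(1-3)[OF conjunct1[OF comp(2)[unfolded flavoured_morphism_def]]]
  interpret PC: sym_functor ?Z ?V "Pull P (f \<cdot>\<^bsub>B\<^esub> gb)" "Pten P (f \<cdot>\<^bsub>B\<^esub> gb)"
    by (rule sym_functor_Pull(1)[OF pf mon category.Cmp_Hom[OF conjunct1[OF pf[unfolded pseudo_functor_def]] sides(2,3)]])
  have \<xi>_monoidal: "?\<xi> (M \<odot>\<^bsub>?Z\<^esub> N) \<cdot>\<^bsub>?V\<^esub> Far (Pull P gb) (Pten P f M N)
        \<cdot>\<^bsub>?V\<^esub> Pten P gb (Fob (Pull P f) M) (Fob (Pull P f) N)
      = Far (Pull P fb) (Pten P g M N) \<cdot>\<^bsub>?V\<^esub> Pten P fb (Fob (Pull P g) M) (Fob (Pull P g) N)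
        \<cdot>\<^bsub>?V\<^esub> (?\<xi> M \<bullet>\<^bsub>?V\<^esub> ?\<xi> N)" if MN: "M \<in> Ob ?Z" "N \<in> Ob ?Z" for M N
  proof -
    have mon_c: "?c (M \<odot>\<^bsub>?Z\<^esub> N) \<cdot>\<^bsub>?V\<^esub> Far (Pull P gb) (Pten P f M N)
        \<cdot>\<^bsub>?V\<^esub> Pten P gb (Fob (Pull P f) M) (Fob (Pull P f) N)
      = Pten P (f \<cdot>\<^bsub>B\<^esub> gb) M N \<cdot>\<^bsub>?V\<^esub> (?c M \<bullet>\<^bsub>?V\<^esub> ?c N)"
      and mon_d: "?d (M \<odot>\<^bsub>?Z\<^esub> N) \<cdot>\<^bsub>?V\<^esub> Far (Pull P fb) (Pten P g M N)
        \<cdot>\<^bsub>?V\<^esub> Pten P fb (Fob (Pull P g) M) (Fob (Pull P g) N)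
      = Pten P (f \<cdot>\<^bsub>B\<^esub> gb) M N \<cdot>\<^bsub>?V\<^esub> (?d M \<bullet>\<^bsub>?V\<^esub> ?d N)"
      using mon sides MN assms(9) unfolding monoidal_pf_def by metis+
    let ?D = "?d (M \<odot>\<^bsub>?Z\<^esub> N)"
    \<comment> \<open>\<open>?c\<close> and \<open>?d\<close> are compared with the same tensor
      structure on (f gb)^*. Solving \<open>mon_d\<close> for the tensor structure of fb^*g^* makes
      the factors \<open>?d\<close> cancel against their inverses in \<xi>, and \<open>mon_c\<close>
      does the rest.\<close>
    have "Far (Pull P fb) (Pten P g M N) \<cdot>\<^bsub>?V\<^esub> Pten P fb (Fob (Pull P g) M) (Fob (Pull P g) N)
        = Invr ?V ?D \<cdot>\<^bsub>?V\<^esub> Pten P (f \<cdot>\<^bsub>B\<^esub> gb) M N \<cdot>\<^bsub>?V\<^esub> (?d M \<bullet>\<^bsub>?V\<^esub> ?d N)"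
      using MN by (simp flip: mon_d)
    then have "(Far (Pull P fb) (Pten P g M N) \<cdot>\<^bsub>?V\<^esub> Pten P fb (Fob (Pull P g) M) (Fob (Pull P g) N))
        \<cdot>\<^bsub>?V\<^esub> (?\<xi> M \<bullet>\<^bsub>?V\<^esub> ?\<xi> N)
      = Invr ?V ?D \<cdot>\<^bsub>?V\<^esub> Pten P (f \<cdot>\<^bsub>B\<^esub> gb) M N \<cdot>\<^bsub>?V\<^esub> (?c M \<bullet>\<^bsub>?V\<^esub> ?c N)"
      using MN by (simp add: bc_xi_def FB.D.TenA_Cmp)
    then show ?thesis
      using MN by (simp add: bc_xi_def mon_c)
  qed
  interpret BC: base_change ?Z ?X ?Y ?V "Pull P f" "Pull P fb" "Pull P g" "Push S g" "Pull P gb" "Push S gb"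
    "Pten P f" "Pten P fb" "Pten P g" "Pten P gb" "Eta S g" "Eps S g" "Eta S gb" "Eps S gb" ?\<xi>
    by (intro base_change.intro base_change_axioms.intro pull G.sym_adjunction_axioms
        GB.sym_adjunction_axioms \<xi>_monoidal) (use \<xi> in \<open>simp_all add: Hom_def\<close>)
  have \<epsilon>_eq: "?\<epsilon> = BC.bc"
    by (simp add: fun_eq_iff bc_epsilon_def BC.bc_def)
  have lam_eq: "push_lambda B P S g = G.lam" "push_lambda B P S gb = GB.lam"
    by (simp_all add: fun_eq_iff push_lambda_def G.lam_def GB.lam_def Let_def)
  have Iso_bc [simp]: "\<And>A. A \<in> Ob ?X \<Longrightarrow> Iso ?Y (BC.bc A)"
    using assms(12) by (simp add: \<epsilon>_eq)
  note [simp] = K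
  have \<gamma>: "?\<gamma> \<in> Hom ?V (Fob (Pull P fb) ?R) (Fob (Shriek S gb) ?K)"
    by (simp add: bc_gamma_def \<epsilon>_eq Hom_def)
  \<comment> \<open>By its definition \<gamma> corresponds to \<open>?m\<close> under gb_*
    \<stileturn> gb^!, so the counit after gb_*(\<gamma>) is \<open>?m\<close>; composing with
    \<epsilon> cancels the inverse in \<open>?m\<close>.\<close>
  have square: "Eps' S gb ?K \<cdot>\<^bsub>?Y\<^esub> Far (Push S gb) ?\<gamma> \<cdot>\<^bsub>?Y\<^esub> BC.bc ?R = Far (Pull P f) (Eps' S g K)"
  proof -
    let ?m = "Far (Pull P f) (Eps' S g K) \<cdot>\<^bsub>?Y\<^esub> Invr ?Y (BC.bc ?R)"
    have "Eps' S gb ?K \<cdot>\<^bsub>?Y\<^esub> Far (Push S gb) ?\<gamma> = ?m"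
      using SGB.transpose[of "Fob (Pull P fb) ?R" ?m] by (simp add: bc_gamma_def \<epsilon>_eq)
    moreover have "?m \<cdot>\<^bsub>?Y\<^esub> BC.bc ?R = Far (Pull P f) (Eps' S g K)"
      by simp
    ultimately show ?thesis
      using \<gamma> by (simp add: Hom_def flip: F.D.Cmp_assoc_Ar)
  qed
  let ?L = "dp_comp ?Y (dp_pull B P f K) (dp_push B P S g K)"
  let ?M = "dp_comp ?Y (dp_push B P S gb ?K) (dp_change ?V ?\<gamma>)"
  let ?N = "dp_comp ?Y ?M (dp_pull B P fb ?R)"
  \<comment> \<open>\<zeta> is displayed as \<mu> followed by a counit, the shape shared by
    \<open>dp_functor_hom_compare_post\<close> and \<open>duality_compatible\<close>.\<close>
  have push_eq: "dp_push B P S g K = (Push S g, \<lambda>A. IHomA ?Z (Ide ?Z (Fob (Push S g) A)) (Eps' S g K)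
        \<cdot>\<^bsub>?Z\<^esub> G.push.hc A ?R)"
    "dp_push B P S gb ?K = (Push S gb, \<lambda>A. IHomA ?Y (Ide ?Y (Fob (Push S gb) A)) (Eps' S gb ?K)
        \<cdot>\<^bsub>?Y\<^esub> GB.push.hc A (Fob (Shriek S gb) ?K))"
    and pull_eq: "dp_pull B P f K = (Pull P f, \<lambda>A. F.hc A K)"
    "dp_pull B P fb ?R = (Pull P fb, \<lambda>A. FB.hc A ?R)"
    by (simp_all add: dp_push_def push_zeta_def push_mu_def lam_eq dp_pull_def pull_beta_def)
  have dp_pull: "dp_functor k (with_duality ?Z K) (with_duality ?Y ?K) (dp_pull B P f K)"
    "dp_functor k (with_duality ?X ?R) (with_duality ?V (Fob (Pull P fb) ?R)) (dp_pull B P fb ?R)"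
    unfolding pull_eq by (rule dp_functor_hom_compare; use pull pull_sus in simp)+
  have dp_push: "dp_functor k (with_duality ?X ?R) (with_duality ?Z K) (dp_push B P S g K)"
    "dp_functor k (with_duality ?V (Fob (Shriek S gb) ?K)) (with_duality ?Y ?K) (dp_push B P S gb ?K)"
    unfolding push_eq
    by (rule dp_functor_hom_compare_post[OF G.push.sym_functor_axioms]
        dp_functor_hom_compare_post[OF GB.push.sym_functor_axioms];
        use sus choice_g(3) choice_gb(3) in \<open>simp add: Hom_def\<close>)+
  have dp_L: "dp_functor k (with_duality ?X ?R) (with_duality ?Y ?K) ?L"
    using dp_functor_comp[OF closed(2,4,3) _ _ _ _ dp_push(1)[unfolded push_eq] dp_pull(1)[unfolded pull_eq]] sus
    by (simp only: push_eq pull_eq) simp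
  have dp_M: "dp_functor k (with_duality ?V (Fob (Pull P fb) ?R)) (with_duality ?Y ?K) ?M"
    using dp_functor_comp[OF closed(1,1,3) _ _ _ _ dp_functor_change[OF closed(1) _ \<gamma>, unfolded dp_change_def]
        dp_push(2)[unfolded push_eq]] sus
    by (simp only: push_eq dp_change_def) simp
  have dp_N: "dp_functor k (with_duality ?X ?R) (with_duality ?Y ?K) ?N"
    using dp_functor_comp[OF closed(2,1,3) _ _ _ _ dp_pull(2)[unfolded pull_eq]
        dp_M[unfolded push_eq dp_change_def dp_comp.simps]] sus
    by (simp only: push_eq pull_eq dp_change_def dp_comp.simps) simp
  let ?F = "comp_sfctr ?Y (Pull P f) (Push S g)"
  let ?F' = "comp_sfctr ?Y (comp_sfctr ?Y (Push S gb) (id_sfctr ?V)) (Pull P fb)"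
  note LN = dp_L[unfolded push_eq pull_eq dp_comp.simps]
    dp_N[unfolded push_eq pull_eq dp_change_def dp_comp.simps]
  have nt: "nat_trans ?X ?Y ?F ?F' BC.bc"
    by (rule nat_transI[OF dp_functorD(1)[OF LN(1)] dp_functorD(1)[OF LN(2)]]) (simp_all add: BC.bc_natural)
  have sm: "suspended_morphism ?X ?Y ?F ?F' BC.bc" if k: "k \<noteq> Plain"
  proof -
    interpret SBC: suspended_base_change ?Z ?X ?Y ?V "Pull P f" "Pull P fb" "Pull P g" "Push S g" "Pull P gb"
      "Push S gb" "Pten P f" "Pten P fb" "Pten P g" "Pten P gb" "Eta S g" "Eps S g" "Eta S gb" "Eps S gb" ?\<xi>
      by (intro suspended_base_change.intro suspended_base_change_axioms.intro BC.base_change_axioms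
          sus[OF k] pull_sus[OF k] choice_g(3,4)[OF k] choice_gb(3,4)[OF k])
        (use \<xi>_fm k in \<open>simp add: flavoured_morphism_def\<close>)
    have "Theta ?F' A \<cdot>\<^bsub>?Y\<^esub> BC.bc (Fob (Sus ?X) A) = Far (Sus ?Y) (BC.bc A) \<cdot>\<^bsub>?Y\<^esub> Theta ?F A"
      if A: "A \<in> Ob ?X" for A
    proof -
      \<comment> \<open>The identity functor underlying I_\<gamma> contributes gb_* of an identity
        to \<open>Theta\<close>, which disappears here.\<close>
      have "Theta ?F' A = Theta (Push S gb) (Fob (Pull P fb) A) \<cdot>\<^bsub>?Y\<^esub> Far (Push S gb) (Theta (Pull P fb) A)"
        using A suspended_functorD(2-4)[OF choice_gb(3)[OF k]] suspended_functorD(2-4)[OF pull_sus(2)[OF k]]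
          cat_functor.Fob_Ob[of ?V ?V "Sus ?V"] suspended.Sus_functor[OF sus(1)[OF k]]
        by (simp add: cat_functor_iff)
      then show ?thesis
        using SBC.bc_suspended[OF A] by simp
    qed
    then show ?thesis
      using nt dp_functorD(2)[OF LN(1) k] dp_functorD(2)[OF LN(2) k] by (simp add: suspended_morphism_def)
  qed
  show ?thesis
    unfolding push_eq pull_eq dp_change_def dp_comp.simps \<epsilon>_eq
  proof (rule dp_morphismI[OF LN])
    show "flavoured_morphism k ?X ?Y ?F ?F' BC.bc"
      using nt sm by (simp add: flavoured_morphism_def)
  next
    fix A assume A: "A \<in> Ob ?X"
    note \<gamma>_simps = \<gamma>[unfolded Hom_def]
    \<comment> \<open>This is \<open>duality_compatible\<close> for the counits of h_* \<stileturn>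
      h^!, up to bracketing, the identity functor in I_\<gamma>, and gb_* being distributed over the
      composite of \<gamma> with \<beta>.\<close>
    show "F.hc (Fob (Push S g) A) K \<cdot>\<^bsub>?Y\<^esub>
        Far (Pull P f) (IHomA ?Z (Ide ?Z (Fob (Push S g) A)) (Eps' S g K) \<cdot>\<^bsub>?Z\<^esub> G.push.hc A ?R)
      = IHomA ?Y (BC.bc A) (Ide ?Y ?K) \<cdot>\<^bsub>?Y\<^esub>
        (((IHomA ?Y (Ide ?Y (Fob (Push S gb) (Fob (id_sfctr ?V) (Fob (Pull P fb) A)))) (Eps' S gb ?K) \<cdot>\<^bsub>?Y\<^esub>
            GB.push.hc (Fob (id_sfctr ?V) (Fob (Pull P fb) A)) (Fob (Shriek S gb) ?K)) \<cdot>\<^bsub>?Y\<^esub>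
          Far (Push S gb) (IHomA ?V (Ide ?V (Fob (Pull P fb) A)) ?\<gamma>)) \<cdot>\<^bsub>?Y\<^esub>
          Far (comp_sfctr ?Y (Push S gb) (id_sfctr ?V)) (FB.hc A ?R)) \<cdot>\<^bsub>?Y\<^esub> BC.bc (IHom ?X A ?R)"
      using A \<gamma>_simps BC.duality_compatible[OF K _ _ A _ _ \<gamma> square]
      by (simp add: Hom_def)
  qed
qed

end
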